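(* (i) For $d=1$ and every $\alpha\in\mathbb{C}$ such that $\operatorname{Re}\alpha<|\operatorname{Im}\alpha|$, one has $$\sigma_{\mathrm p}(H_{\alpha\delta})=\left\{\tfrac14\,\alpha^{4/3}e^{-i\pi/3}\right\},$$ where $\alpha^{4/3}:=|\alpha|^{4/3}e^{\frac{4}{3}i\arg\alpha}$ with $\arg\alpha\in(\pi/4,7\pi/4)$. (ii) For $d=3$ and every $\alpha\in\mathbb{C}$ such that $\operatorname{Re}\alpha<-|\operatorname{Im}\alpha|$, one has $$\sigma_{\mathrm p}(H_{4\pi\alpha\delta})\supset\left\{-\tfrac14\,\alpha^{4}\right\}.$$
   Context: For $d\in\{1,3\}$ and $\gamma\in\mathbb{C}$, the operator $H_{\gamma\delta}=\Delta^2\dot{+}\gamma\delta$ in $L^2(\mathbb{R}^d)$ is the m-sectorial operator associated, via the representation theorem, with the closed sectorial form $h_{\gamma\delta}(\varphi,\psi)=\int_{\mathbb{R}^d}\overline{\Delta\varphi}\,\Delta\psi+\gamma\,\overline{\varphi(0)}\,\psi(0)$ with form domain $H^2(\mathbb{R}^d)$ (complex-valued functions; the value at $0$ is that of the continuous representative, which exists since $d\le3$). That is, $\psi\in H^2(\mathbb{R}^d)$ belongs to the domain of $H_{\gamma\delta}$ with $H_{\gamma\delta}\psi=f\in L^2(\mathbb{R}^d)$ if and only if $h_{\gamma\delta}(\varphi,\psi)=\int_{\mathbb{R}^d}\overline{\varphi}f$ for all $\varphi\in H^2(\mathbb{R}^d)$. The point spectrum $\sigma_{\mathrm p}$ is the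 set of all eigenvalues. In (i), $\gamma=\alpha$; in (ii), $\gamma=4\pi\alpha$. *)

theory Defs
  imports "HOL-Analysis.Analysis"
begin

(* Elements of L^2 and H^2 are represented by Borel functions; every notion below is
   invariant under changing a representative on a Lebesgue null set. *)

definition L2 :: "('a::euclidean_space \<Rightarrow> complex) set" where
  "L2 = {u. u \<in> borel_measurable lborel \<and> integrable lborel (\<lambda>x. (norm (u x))\<^sup>2)}"

definition partial_deriv ::
    "'a::euclidean_space \<Rightarrow> ('a \<Rightarrow> complex) \<Rightarrow> 'a \<Rightarrow> complex" where
  "partial_deriv i f = (\<lambda>x. frechet_derivative f (at x) i)"

primrec C_k :: "nat \<Rightarrow> ('a::euclidean_space \<Rightarrow> complex) \<Rightarrow> bool" where
  "C_k 0 f \<longleftrightarrow> continuous_on UNIV f"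
| "C_k (Suc k) f \<longleftrightarrow>
     (\<forall>x. f differentiable (at x)) \<and> (\<forall>i\<in>Basis. C_k k (partial_deriv i f))"

definition test_functions :: "('a::euclidean_space \<Rightarrow> complex) set" where
  "test_functions = {\<eta>. (\<forall>k. C_k k \<eta>) \<and> compact (closure {x. \<eta> x \<noteq> 0})}"

definition has_weak_deriv ::
    "'a::euclidean_space \<Rightarrow> ('a \<Rightarrow> complex) \<Rightarrow> ('a \<Rightarrow> complex) \<Rightarrow> bool" where
  "has_weak_deriv i u g \<longleftrightarrow> u \<in> L2 \<and> g \<in> L2 \<and>
     (\<forall>\<eta>\<in>test_functions.
        (LINT x|lborel. u x * partial_deriv i \<eta> x) = - (LINT x|lborel. g x * \<eta> x))"

definition H1 :: "('a::euclidean_space \<Rightarrow> complex) set" where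
  "H1 = {u \<in> L2. \<forall>i\<in>Basis. \<exists>g. has_weak_deriv i u g}"

definition H2 :: "('a::euclidean_space \<Rightarrow> complex) set" where
  "H2 = {u \<in> L2. \<forall>i\<in>Basis. \<exists>g\<in>H1. has_weak_deriv i u g}"

(* Weak derivatives are unique only up to null sets, hence SOME rather than THE. *)
definition weak_deriv ::
    "'a::euclidean_space \<Rightarrow> ('a \<Rightarrow> complex) \<Rightarrow> 'a \<Rightarrow> complex" where
  "weak_deriv i u = (SOME g. has_weak_deriv i u g)"

definition laplacian :: "('a::euclidean_space \<Rightarrow> complex) \<Rightarrow> 'a \<Rightarrow> complex" where
  "laplacian u = (\<lambda>x. \<Sum>i\<in>Basis. weak_deriv i (weak_deriv i u) x)"

definition continuous_rep :: "('a::euclidean_space \<Rightarrow> complex) \<Rightarrow> 'a \<Rightarrow> complex" where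
  "continuous_rep u = (THE v. continuous_on UNIV v \<and> (AE x in lborel. v x = u x))"

definition h_delta ::
    "complex \<Rightarrow> ('a::euclidean_space \<Rightarrow> complex) \<Rightarrow> ('a \<Rightarrow> complex) \<Rightarrow> complex" where
  "h_delta \<gamma> \<phi> \<psi> = (LINT x|lborel. cnj (laplacian \<phi> x) * laplacian \<psi> x)
     + \<gamma> * cnj (continuous_rep \<phi> 0) * continuous_rep \<psi> 0"

(* The graph of the operator: H_delta gamma psi f says that psi lies in the domain and is
   mapped to f. *)
definition H_delta ::
    "complex \<Rightarrow> ('a::euclidean_space \<Rightarrow> complex) \<Rightarrow> ('a \<Rightarrow> complex) \<Rightarrow> bool" where
  "H_delta \<gamma> \<psi> f \<longleftrightarrow> \<psi> \<in> H2 \<and> f \<in> L2 \<and>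
     (\<forall>\<phi>\<in>H2. h_delta \<gamma> \<phi> \<psi> = (LINT x|lborel. cnj (\<phi> x) * f x))"

definition point_spectrum ::
    "(('a::euclidean_space \<Rightarrow> complex) \<Rightarrow> ('a \<Rightarrow> complex) \<Rightarrow> bool) \<Rightarrow> complex set" where
  "point_spectrum T =
     {z. \<exists>\<psi>. \<not> (AE x in lborel. \<psi> x = 0) \<and> T \<psi> (\<lambda>x. z * \<psi> x)}"

(* Well defined for Re z < |Im z|, i.e. off the closed sector |arg z| <= pi/4. *)
definition arg_branch :: "complex \<Rightarrow> real" where
  "arg_branch z = (THE t. pi / 4 < t \<and> t < 7 * pi / 4 \<and> is_Arg z t)"

definition pow_four_thirds :: "complex \<Rightarrow> complex" where
  "pow_four_thirds z =
     of_real (norm z powr (4 / 3)) * exp (4 / 3 * \<i> * of_real (arg_branch z))"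

end

theory Submission
  imports Defs "HOL-Real_Asymp.Real_Asymp"
begin

text \<open>
  Away from the origin an eigenfunction satisfies \<open>\<Delta>\<^sup>2 \<psi> = z \<psi>\<close>, and the delta interaction prescribes
  its singularity there. So \<open>\<psi>\<close> must be a multiple of the Green function of \<open>\<Delta>\<^sup>2 - z\<close> with pole at the
  origin, and \<open>z\<close> is an eigenvalue exactly if \<open>1 + \<gamma> G(0) = 0\<close>. Write \<open>z = k\<^sup>4\<close> with \<open>k\<close> in the open first
  quadrant. Since \<open>\<Delta>\<^sup>2 - k\<^sup>4\<close> is the product of \<open>\<Delta> + k\<^sup>2\<close> and \<open>\<Delta> - k\<^sup>2\<close>, the function \<open>2 k\<^sup>2 G\<close> is the difference of
  the resolvent kernels of the Laplacian with parameters \<open>\<mu> = - \<i> k\<close> and \<open>\<nu> = k\<close>, both of positive real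
  part. These kernels are \<open>exp (- \<mu> r) / (2 \<mu>)\<close> in dimension one and \<open>exp (- \<mu> r) / (4 \<pi> r)\<close> in dimension
  three. The condition becomes \<open>4 k\<^sup>3 = \<alpha> (1 - \<i>)\<close> in dimension one and \<open>2 k = - \<alpha> (1 + \<i>)\<close> in dimension
  three, and the assumptions on \<open>\<alpha>\<close> say that it has a solution in the quadrant.

  The analytic core is \<open>helmholtz_representation\<close>: every \<open>\<phi>\<close> in \<^const>\<open>H2\<close> has a continuous representative,
  and its value at \<open>y\<close> is minus the integral of \<open>\<Delta>\<phi> - \<mu>\<^sup>2 \<phi>\<close> against the kernel with pole \<open>y\<close>. The proof
  replaces the distance \<open>r\<close> by \<open>sqrt (r\<^sup>2 + \<epsilon>\<^sup>2)\<close>. The regularised kernel is smooth, so the definition of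
  weak derivatives applies to it after a cutoff, and its defect in the Helmholtz equation is an
  approximate identity. The same regularisation shows in \<open>radial_H2\<close> that radial functions have the
  expected weak derivatives. Both arguments are uniform in the dimension; what is special to dimensions
  one and three is collected in the assumptions of the locale \<open>helmholtz_kernel\<close>.

  Two representations combine to \<open>biharmonic_identity\<close>, the weak form of the equation of \<open>G\<close>. With the
  pole at the origin it shows that \<open>G\<close> is an eigenfunction (\<open>eigenvalue_if\<close>). For the converse in
  dimension one, an eigenfunction is tested with the Green functions with arbitrary pole and
  spectral parameter (\<open>eigenfunction_equation\<close>). With the parameter equal to \<open>z\<close> this says that \<open>\<psi>\<close> is a
  multiple of \<open>G\<close>. For \<open>z \<ge> 0\<close>, however, \<open>k\<close> lies on the boundary of the quadrant and has to be
  approached from inside; the error terms vanish in the limit (\<open>eigenfunction_estimate\<close>). The limit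
  gives \<open>(4 k\<^sup>3 - \<alpha> (1 - \<i>)) \<psi>(0) = 0\<close>, and \<open>\<psi> = 0\<close> if \<open>\<psi>(0) = 0\<close> (\<open>eigenvalue_condition\<close>). For \<open>z > 0\<close> the fourth
  roots on the two boundary rays give contradictory conditions, and \<open>z = 0\<close> would force \<open>\<alpha> = 0\<close>.
\<close>

section \<open>Smooth functions\<close>

lemma partial_deriv_eq:
  assumes "(f has_derivative f') (at x)"
  shows "partial_deriv i f x = f' i"
  using frechet_derivative_at[OF assms] by (simp add: partial_deriv_def)

lemma C_k_SucI:
  assumes "\<And>x. (f has_derivative D x) (at x)" "\<And>i. i \<in> Basis \<Longrightarrow> C_k k (\<lambda>x. D x i)"
  shows "C_k (Suc k) f"
proof -
  have "partial_deriv i f = (\<lambda>x. D x i)" for i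
    using partial_deriv_eq[OF assms(1)] by (intro ext) simp
  then show ?thesis using assms by (auto simp: differentiable_def)
qed

lemma C_k_Suc_has_derivative:
  assumes "C_k (Suc k) f"
  shows "(f has_derivative frechet_derivative f (at x)) (at x)"
  using assms by (simp flip: frechet_derivative_works)

lemma C_k_Suc_D: "C_k (Suc k) f \<Longrightarrow> C_k k f"
proof (induction k arbitrary: f)
  case 0
  then show ?case
    by (auto intro!: continuous_at_imp_continuous_on differentiable_imp_continuous_within)
qed auto

lemma C_k_const: "C_k k (\<lambda>x. c)"
proof (induction k arbitrary: c)
  case (Suc k)
  show ?case by (rule C_k_SucI[where D="\<lambda>x h. 0"]) (use Suc in auto)
qed simp

lemma C_k_add: "C_k k f \<Longrightarrow> C_k k g \<Longrightarrow> C_k k (\<lambda>x. f x + g x)"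
proof (induction k arbitrary: f g)
  case (Suc k)
  show ?case
    by (rule C_k_SucI[OF has_derivative_add[OF C_k_Suc_has_derivative[OF Suc.prems(1)]
          C_k_Suc_has_derivative[OF Suc.prems(2)]]])
      (use Suc in \<open>auto simp: partial_deriv_def\<close>)
qed (auto intro!: continuous_intros)

lemma C_k_mult: "C_k k f \<Longrightarrow> C_k k g \<Longrightarrow> C_k k (\<lambda>x. f x * g x)"
proof (induction k arbitrary: f g)
  case (Suc k)
  have "C_k k f" "C_k k g" using Suc.prems C_k_Suc_D by blast+
  then show ?case
    by (intro C_k_SucI[OF has_derivative_mult[OF C_k_Suc_has_derivative[OF Suc.prems(1)]
          C_k_Suc_has_derivative[OF Suc.prems(2)]]] C_k_add Suc.IH)
      (use Suc.prems in \<open>auto simp: partial_deriv_def\<close>)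
qed (auto intro!: continuous_intros)

definition smooth :: "('a::euclidean_space \<Rightarrow> complex) \<Rightarrow> bool" where
  "smooth f \<longleftrightarrow> (\<forall>k. C_k k f)"

lemma smooth_const: "smooth (\<lambda>x. c)"
  by (simp add: smooth_def C_k_const)

lemma smooth_mult: "smooth f \<Longrightarrow> smooth g \<Longrightarrow> smooth (\<lambda>x. f x * g x)"
  by (simp add: smooth_def C_k_mult)

lemma smooth_prod: "(\<And>i. i \<in> I \<Longrightarrow> smooth (f i)) \<Longrightarrow> smooth (\<lambda>x. \<Prod>i\<in>I. f i x)"
  by (induction I rule: infinite_finite_induct) (auto intro: smooth_const smooth_mult)

lemma smooth_partial_deriv: "smooth f \<Longrightarrow> i \<in> Basis \<Longrightarrow> smooth (partial_deriv i f)"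
  unfolding smooth_def by (metis C_k.simps(2))

lemma smooth_has_derivative: "smooth f \<Longrightarrow> (f has_derivative frechet_derivative f (at x)) (at x)"
  unfolding smooth_def using C_k_Suc_has_derivative by blast

lemma smooth_continuous: "smooth f \<Longrightarrow> continuous_on UNIV f"
  unfolding smooth_def by (metis C_k.simps(1))

lemma smooth_borel [measurable_dest]: "smooth f \<Longrightarrow> f \<in> borel_measurable borel"
  by (intro borel_measurable_continuous_onI smooth_continuous)

lemma smoothI:
  assumes "\<And>x. (f has_derivative D x) (at x)" "\<And>i. i \<in> Basis \<Longrightarrow> smooth (\<lambda>x. D x i)"
  shows "smooth f"
  unfolding smooth_def
proof
  fix k
  have "C_k (Suc k) f" by (rule C_k_SucI[OF assms(1)]) (use assms(2) in \<open>auto simp: smooth_def\<close>)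
  then show "C_k k f" by (rule C_k_Suc_D)
qed

lemma smooth_inner: "smooth (\<lambda>x. complex_of_real ((x - y) \<bullet> j))"
  by (rule smoothI[where D="\<lambda>x h. of_real (h \<bullet> j)"])
    (auto intro!: derivative_eq_intros smooth_const)

text \<open>The outer function is given together with all of its derivatives: differentiating
  the composition raises the index by one and leaves a smooth factor.\<close>

lemma smooth_compose:
  assumes h: "\<And>n t. t \<in> T \<Longrightarrow> (h n has_vector_derivative h (Suc n) t) (at t)"
    and q: "\<And>x. (q has_derivative q' x) (at x)" "\<And>x. q x \<in> T"
    and q': "\<And>i. i \<in> Basis \<Longrightarrow> smooth (\<lambda>x. complex_of_real (q' x i))"
  shows "smooth (\<lambda>x. h n (q x))"
proof -
  have D: "((\<lambda>x. h n (q x)) has_derivative (\<lambda>v. q' x v *\<^sub>R h (Suc n) (q x))) (at x)" for n x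
    using has_derivative_compose[OF q(1) h[OF q(2), unfolded has_vector_derivative_def]] by simp
  have "C_k k (\<lambda>x. h n (q x))" for k
  proof (induction k arbitrary: n)
    case 0
    show ?case using has_derivative_continuous[OF D]
      by (auto intro!: continuous_at_imp_continuous_on)
  next
    case (Suc k)
    show ?case
      by (rule C_k_SucI[OF D]) (use Suc q' in \<open>auto simp: scaleR_conv_of_real smooth_def intro!: C_k_mult\<close>)
  qed
  then show ?thesis by (simp add: smooth_def)
qed

section \<open>A flat function\<close>

text \<open>The function \<open>flat n\<close> is the \<open>n\<close>-th derivative of \<open>exp (- 1 / t)\<close>, extended by zero to
  \<open>t \<le> 0\<close>: a polynomial in \<open>1 / t\<close> times the exponential, where differentiation acts on the
  polynomial \<open>p\<close> in \<open>u = 1 / t\<close> as \<open>p \<mapsto> (p - p') * u\<^sup>2\<close>.\<close>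

definition flat_poly :: "nat \<Rightarrow> real poly" where
  "flat_poly n = ((\<lambda>p. (p - pderiv p) * [:0, 0, 1:]) ^^ n) 1"

definition flat :: "nat \<Rightarrow> real \<Rightarrow> real" where
  "flat n t = (if t > 0 then poly (flat_poly n) (1 / t) * exp (- 1 / t) else 0)"

lemma poly_exp_tendsto_0: "((\<lambda>u. poly p u * exp (- u)) \<longlongrightarrow> (0::real)) at_top"
proof -
  have "((\<lambda>u. \<Sum>i\<le>degree p. coeff p i * (u ^ i / exp u)) \<longlongrightarrow> (\<Sum>i\<le>degree p. coeff p i * 0)) at_top"
    by (intro tendsto_intros tendsto_power_div_exp_0)
  then show ?thesis
    by (simp add: poly_altdef sum_distrib_right exp_minus divide_inverse mult.assoc)
qed

lemma flat_poly_Suc: "flat_poly (Suc n) = (flat_poly n - pderiv (flat_poly n)) * [:0, 0, 1:]"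
  by (simp add: flat_poly_def)

lemma flat_has_deriv: "(flat n has_real_derivative flat (Suc n) t) (at t)"
proof (cases "t = 0")
  case False
  show ?thesis
  proof (cases "t > 0")
    case True
    have "((\<lambda>t. poly (flat_poly n) (1 / t) * exp (- 1 / t)) has_real_derivative flat (Suc n) t) (at t)"
      using True by (auto simp: flat_def flat_poly_Suc field_simps power2_eq_square
          intro!: derivative_eq_intros DERIV_chain'[OF _ poly_DERIV])
    then show ?thesis
      by (rule has_field_derivative_transform_within_open[where S="{0<..}"]) (use True in \<open>auto simp: flat_def\<close>)
  next
    case f: False
    have "((\<lambda>t. 0) has_real_derivative flat (Suc n) t) (at t)"
      using f by (auto simp: flat_def)
    then show ?thesis
      by (rule has_field_derivative_transform_within_open[where S="{..<0}"]) (use f False in \<open>auto simp: flat_def\<close>)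
  qed
next
  case True
  have "((\<lambda>h. flat n h / h) \<longlongrightarrow> 0) (at_right 0)"
  proof -
    have "((\<lambda>h::real. poly (pCons 0 (flat_poly n)) (inverse h) * exp (- inverse h)) \<longlongrightarrow> 0) (at_right 0)"
      by (rule filterlim_compose[OF poly_exp_tendsto_0 filterlim_inverse_at_top_right])
    then show ?thesis
      by (rule tendsto_cong[THEN iffD1, rotated])
        (auto simp: eventually_at_filter flat_def field_simps)
  qed
  moreover have "((\<lambda>h. flat n h / h) \<longlongrightarrow> 0) (at_left 0)"
    by (rule tendsto_eventually) (auto simp: eventually_at_filter flat_def)
  ultimately have "((\<lambda>h. flat n h / h) \<longlongrightarrow> 0) (at 0)"
    by (simp add: filterlim_split_at)
  then show ?thesis using True
    by (simp add: DERIV_def flat_def)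
qed

lemma smooth_flat:
  assumes q: "\<And>x. (q has_derivative q' x) (at x)"
    and q': "\<And>i. i \<in> Basis \<Longrightarrow> smooth (\<lambda>x. complex_of_real (q' x i))"
  shows "smooth (\<lambda>x. complex_of_real (flat n (q x)))"
proof (rule smooth_compose[where h="\<lambda>n t. complex_of_real (flat n t)" and T=UNIV and q=q])
  fix n t
  show "((\<lambda>t. complex_of_real (flat n t)) has_vector_derivative of_real (flat (Suc n) t)) (at t)"
    using flat_has_deriv
    by (simp add: has_real_derivative_iff_has_vector_derivative has_vector_derivative_of_real)
qed (use q q' in auto)

lemma flat_0: "flat 0 t = (if t > 0 then exp (- 1 / t) else 0)"
  by (simp add: flat_def flat_poly_def)

lemma flat_0_bounds: "0 \<le> flat 0 t" "flat 0 t \<le> 1"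
  by (auto simp: flat_0)

section \<open>The regularised distance\<close>

text \<open>Radial functions become smooth once the distance is replaced by this regularisation.\<close>

definition reg_dist :: "real \<Rightarrow> 'a::euclidean_space \<Rightarrow> 'a \<Rightarrow> real" where
  "reg_dist \<epsilon> y x = sqrt ((x - y) \<bullet> (x - y) + \<epsilon>\<^sup>2)"

lemma reg_dist_pos: "\<epsilon> > 0 \<Longrightarrow> reg_dist \<epsilon> y x > 0"
  unfolding reg_dist_def by (simp add: add_nonneg_pos)

lemma reg_dist_sq: "(reg_dist \<epsilon> y x)\<^sup>2 = (norm (x - y))\<^sup>2 + \<epsilon>\<^sup>2"
  by (simp add: reg_dist_def dot_square_norm)

lemma reg_dist_ge: "norm (x - y) \<le> reg_dist \<epsilon> y x" "\<epsilon> > 0 \<Longrightarrow> \<epsilon> \<le> reg_dist \<epsilon> y x"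
  by (auto simp: reg_dist_def dot_square_norm intro!: real_le_rsqrt)

lemma sq_dist_has_derivative:
  "((\<lambda>x. (x - y) \<bullet> (x - y) + c) has_derivative (\<lambda>h. 2 * ((x - y) \<bullet> h))) (at x)"
  by (auto intro!: derivative_eq_intros simp: inner_commute)

lemma reg_dist_has_derivative:
  assumes "\<epsilon> > 0"
  shows "(reg_dist \<epsilon> y has_derivative (\<lambda>h. ((x - y) \<bullet> h) / reg_dist \<epsilon> y x)) (at x)"
proof -
  have "(x - y) \<bullet> (x - y) + \<epsilon>\<^sup>2 > 0" using assms by (simp add: add_nonneg_pos)
  then show ?thesis unfolding reg_dist_def
    by (auto intro!: derivative_eq_intros sq_dist_has_derivative simp: field_simps inner_commute)
qed

lemma smooth_sq_dist_powr:
  fixes y :: "'a::euclidean_space"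
  assumes "\<epsilon> > 0"
  shows "smooth (\<lambda>x. complex_of_real (((x - y) \<bullet> (x - y) + \<epsilon>\<^sup>2) powr p))"
proof -
  let ?h = "\<lambda>n t. complex_of_real ((\<Prod>j<n. p - real j) * t powr (p - real n))"
  have "smooth (\<lambda>x. ?h 0 ((x - y) \<bullet> (x - y) + \<epsilon>\<^sup>2))"
  proof (rule smooth_compose[where h="?h" and T="{0<..}"])
    fix n and t :: real assume "t \<in> {0<..}"
    then have "((\<lambda>t. (\<Prod>j<n. p - real j) * t powr (p - real n)) has_real_derivative
        ((\<Prod>j<Suc n. p - real j) * t powr (p - real (Suc n)))) (at t)"
      by (auto intro!: derivative_eq_intros simp: algebra_simps)
    then show "(?h n has_vector_derivative ?h (Suc n) t) (at t)"
      by (simp only: has_real_derivative_iff_has_vector_derivative has_vector_derivative_of_real)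
  next
    fix i :: 'a assume "i \<in> Basis"
    have "smooth (\<lambda>x. 2 * complex_of_real ((x - y) \<bullet> i))"
      by (intro smooth_mult smooth_const smooth_inner)
    then show "smooth (\<lambda>x. complex_of_real (2 * ((x - y) \<bullet> i)))" by simp
  qed (use sq_dist_has_derivative assms in \<open>auto simp: add_nonneg_pos\<close>)
  then show ?thesis by simp
qed

lemma smooth_inverse_reg_dist:
  assumes "\<epsilon> > 0"
  shows "smooth (\<lambda>x. complex_of_real (1 / reg_dist \<epsilon> y x))"
proof -
  have "((x - y) \<bullet> (x - y) + \<epsilon>\<^sup>2) powr (-(1/2)) = 1 / reg_dist \<epsilon> y x" for x
    using assms by (simp add: reg_dist_def powr_minus powr_half_sqrt add_nonneg_pos field_simps)
  then show ?thesis using smooth_sq_dist_powr[OF assms, of y "-(1/2)"] by simp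
qed

lemma smooth_exp_reg_dist:
  fixes y :: "'a::euclidean_space"
  assumes "\<epsilon> > 0"
  shows "smooth (\<lambda>x. exp (- \<mu> * complex_of_real (reg_dist \<epsilon> y x)))"
proof -
  let ?h = "\<lambda>n t. (- \<mu>) ^ n * exp (- \<mu> * complex_of_real t)"
  have "smooth (\<lambda>x. ?h 0 (reg_dist \<epsilon> y x))"
  proof (rule smooth_compose[where h="?h" and T="UNIV"])
    fix n and t :: real
    show "(?h n has_vector_derivative ?h (Suc n) t) (at t)"
      by (rule has_vector_derivative_real_field) (auto intro!: derivative_eq_intros)
  next
    fix i :: 'a assume "i \<in> Basis"
    have "smooth (\<lambda>x. complex_of_real ((x - y) \<bullet> i) * complex_of_real (1 / reg_dist \<epsilon> y x))"
      by (intro smooth_mult smooth_inner smooth_inverse_reg_dist assms)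
    then show "smooth (\<lambda>x. complex_of_real ((x - y) \<bullet> i / reg_dist \<epsilon> y x))"
      by (simp add: divide_inverse)
  qed (use reg_dist_has_derivative assms in auto)
  then show ?thesis by simp
qed

section \<open>Square-integrable functions\<close>

lemma L2_borel [measurable_dest]: "u \<in> L2 \<Longrightarrow> u \<in> borel_measurable borel"
  by (simp add: L2_def)

lemma L2_integrable_sq: "u \<in> L2 \<Longrightarrow> integrable lborel (\<lambda>x. (norm (u x))\<^sup>2)"
  by (simp add: L2_def)

lemma L2_bound:
  assumes "v \<in> L2" "u \<in> borel_measurable borel" "AE x in lborel. norm (u x) \<le> norm (v x)"
  shows "u \<in> L2"
proof -
  have "AE x in lborel. norm ((norm (u x))\<^sup>2) \<le> norm ((norm (v x))\<^sup>2)"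
    using assms(3) by eventually_elim (auto intro!: power_mono)
  then have "integrable lborel (\<lambda>x. (norm (u x))\<^sup>2)"
    by (rule_tac Bochner_Integration.integrable_bound[OF L2_integrable_sq[OF assms(1)]])
      (use assms(2) in auto)
  then show ?thesis using assms(2) by (simp add: L2_def)
qed

lemma L2_cmult: "u \<in> L2 \<Longrightarrow> (\<lambda>x. c * u x) \<in> L2"
  by (auto simp: L2_def norm_mult power_mult_distrib)

lemma borel_measurable_cnj [measurable]: "cnj \<in> borel_measurable borel"
  by (intro borel_measurable_continuous_onI continuous_intros)

lemma L2_add:
  assumes "u \<in> L2" "v \<in> L2"
  shows "(\<lambda>x. u x + v x) \<in> L2"
proof -
  have [measurable]: "u \<in> borel_measurable borel" "v \<in> borel_measurable borel"
    using assms by (auto simp: L2_def)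
  have "(norm (u x + v x))\<^sup>2 \<le> 2 * (norm (u x))\<^sup>2 + 2 * (norm (v x))\<^sup>2" for x
  proof -
    have "(norm (u x + v x))\<^sup>2 \<le> (norm (u x) + norm (v x))\<^sup>2"
      by (intro power_mono norm_triangle_ineq) auto
    also have "\<dots> \<le> 2 * (norm (u x))\<^sup>2 + 2 * (norm (v x))\<^sup>2"
      using zero_le_power2[of "norm (u x) - norm (v x)"]
      by (simp add: power2_eq_square algebra_simps)
    finally show ?thesis .
  qed
  then have "norm ((norm (u x + v x))\<^sup>2) \<le> norm (2 * (norm (u x))\<^sup>2 + 2 * (norm (v x))\<^sup>2)" for x
    by (simp only: real_norm_def abs_of_nonneg zero_le_power2 order_trans[OF _ abs_ge_self])
  moreover have "integrable lborel (\<lambda>x. 2 * (norm (u x))\<^sup>2 + 2 * (norm (v x))\<^sup>2)"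
    by (intro Bochner_Integration.integrable_add integrable_mult_right L2_integrable_sq assms)
  ultimately have "integrable lborel (\<lambda>x. (norm (u x + v x))\<^sup>2)"
    by (rule_tac Bochner_Integration.integrable_bound[where f="\<lambda>x. 2 * (norm (u x))\<^sup>2 + 2 * (norm (v x))\<^sup>2"])
      auto
  then show ?thesis by (simp add: L2_def)
qed

lemma L2_diff: "u \<in> L2 \<Longrightarrow> v \<in> L2 \<Longrightarrow> (\<lambda>x. u x - v x) \<in> L2"
  using L2_add[of u "\<lambda>x. - 1 * v x"] L2_cmult[of v "-1"] by simp

lemma L2_sum: "(\<And>i. i \<in> I \<Longrightarrow> u i \<in> L2) \<Longrightarrow> (\<lambda>x. \<Sum>i\<in>I. u i x) \<in> L2"
proof (induction I rule: infinite_finite_induct)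
  case (insert i I)
  then show ?case using L2_add[of "u i" "\<lambda>x. \<Sum>i\<in>I. u i x"] by simp
qed (auto simp: L2_def)

lemma L2_mult_integrable:
  assumes "u \<in> L2" "v \<in> L2"
  shows "integrable lborel (\<lambda>x. u x * v x)"
proof -
  have [measurable]: "u \<in> borel_measurable borel" "v \<in> borel_measurable borel"
    using assms by (auto simp: L2_def)
  have "norm (u x * v x) \<le> norm ((norm (u x))\<^sup>2 + (norm (v x))\<^sup>2)" for x
  proof -
    have "2 * norm (u x) * norm (v x) \<le> (norm (u x))\<^sup>2 + (norm (v x))\<^sup>2" by (rule sum_squares_bound)
    moreover have "0 \<le> norm (u x) * norm (v x)" by simp
    ultimately show ?thesis unfolding norm_mult real_norm_def by linarith
  qed
  moreover have "integrable lborel (\<lambda>x. (norm (u x))\<^sup>2 + (norm (v x))\<^sup>2)"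
    by (intro Bochner_Integration.integrable_add L2_integrable_sq assms)
  ultimately show ?thesis
    by (rule_tac Bochner_Integration.integrable_bound[where f="\<lambda>x. (norm (u x))\<^sup>2 + (norm (v x))\<^sup>2"])
      auto
qed

definition l2_norm :: "('a::euclidean_space \<Rightarrow> complex) \<Rightarrow> real" where
  "l2_norm u = sqrt (LINT x|lborel. (norm (u x))\<^sup>2)"

lemma l2_norm_nonneg [simp]: "l2_norm u \<ge> 0"
  by (simp add: l2_norm_def)

lemma L2_Cauchy_Schwarz_norm:
  assumes "u \<in> L2" "v \<in> L2"
  shows "(LINT x|lborel. norm (u x * v x)) \<le> l2_norm u * l2_norm v"
proof -
  have [measurable]: "u \<in> borel_measurable borel" "v \<in> borel_measurable borel"
    using assms by (auto simp: L2_def)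
  define I where "I = (LINT x|lborel. norm (u x * v x))"
  have I0: "I \<ge> 0" unfolding I_def by simp
  have eqI: "(\<integral>\<^sup>+x. ennreal (norm (u x)) * ennreal (norm (v x)) \<partial>lborel) = ennreal I"
    unfolding I_def using integrable_norm[OF L2_mult_integrable[OF assms]]
    by (subst nn_integral_eq_integral[symmetric]) (auto simp: ennreal_mult norm_mult)
  have eq: "(\<integral>\<^sup>+x. (ennreal (norm (w x)))\<^sup>2 \<partial>lborel) = ennreal ((l2_norm w)\<^sup>2)" if "w \<in> L2"
    for w :: "'a \<Rightarrow> complex"
    unfolding l2_norm_def using L2_integrable_sq[OF that]
    by (simp add: nn_integral_eq_integral ennreal_power)
  have "ennreal I ^ 2 \<le> ennreal ((l2_norm u)\<^sup>2) * ennreal ((l2_norm v)\<^sup>2)"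
    using Cauchy_Schwarz_nn_integral[of "\<lambda>x. ennreal (norm (u x))" lborel "\<lambda>x. ennreal (norm (v x))"]
    by (simp add: eqI eq assms)
  then have "I\<^sup>2 \<le> (l2_norm u * l2_norm v)\<^sup>2"
    using I0 by (simp add: ennreal_power ennreal_mult[symmetric] power_mult_distrib)
  then show ?thesis unfolding I_def
    by (rule power2_le_imp_le) simp
qed

lemma L2_Cauchy_Schwarz:
  assumes "u \<in> L2" "v \<in> L2"
  shows "norm (LINT x|lborel. u x * v x) \<le> l2_norm u * l2_norm v"
  using L2_Cauchy_Schwarz_norm[OF assms] integral_norm_bound[of lborel "\<lambda>x. u x * v x"] by linarith

lemma integral_translate:
  fixes f :: "'a::euclidean_space \<Rightarrow> 'b::{banach, second_countable_topology}"
  assumes "f \<in> borel_measurable borel"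
  shows "(LINT x|lborel. f (a + x)) = (LINT x|lborel. f x)"
proof -
  have "(LINT x|lborel. f x) = (LINT x|distr lborel borel ((+) a). f x)"
    by (simp add: lborel_distr_plus)
  also have "\<dots> = (LINT x|lborel. f (a + x))"
    using assms by (subst integral_distr) auto
  finally show ?thesis by simp
qed

lemma integrable_translate:
  fixes f :: "'a::euclidean_space \<Rightarrow> 'b::{banach, second_countable_topology}"
  assumes "f \<in> borel_measurable borel"
  shows "integrable lborel (\<lambda>x. f (a + x)) \<longleftrightarrow> integrable lborel f"
proof -
  have "integrable lborel f \<longleftrightarrow> integrable (distr lborel borel ((+) a)) f"
    by (simp add: lborel_distr_plus)
  also have "\<dots> \<longleftrightarrow> integrable lborel (\<lambda>x. f (a + x))"
    using assms by (subst integrable_distr_eq) auto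
  finally show ?thesis by simp
qed

lemma L2_translate:
  assumes "u \<in> L2"
  shows "(\<lambda>x. u (a + x)) \<in> L2" "l2_norm (\<lambda>x. u (a + x)) = l2_norm u"
proof -
  have [measurable]: "u \<in> borel_measurable borel" using assms by auto
  show "(\<lambda>x. u (a + x)) \<in> L2"
    using assms integrable_translate[of "\<lambda>x. (norm (u x))\<^sup>2" a] by (auto simp: L2_def)
  show "l2_norm (\<lambda>x. u (a + x)) = l2_norm u"
    unfolding l2_norm_def by (subst integral_translate[of "\<lambda>x. (norm (u x))\<^sup>2"]) auto
qed

lemma L2_locally_integrable:
  assumes "u \<in> L2"
  shows "integrable lborel (\<lambda>x. indicator (cbox a b) x *\<^sub>R u x)"
proof -
  have "(norm (complex_of_real (indicator (cbox a b) x)))\<^sup>2 = indicator (cbox a b) x" for x :: 'a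
    by (auto split: split_indicator)
  moreover have "integrable lborel (indicat_real (cbox a b))"
    by (intro integrable_real_indicator emeasure_lborel_cbox_finite) auto
  ultimately have "(\<lambda>x. complex_of_real (indicator (cbox a b) x)) \<in> L2" by (simp add: L2_def)
  from L2_mult_integrable[OF this assms] show ?thesis by (simp add: scaleR_conv_of_real)
qed

section \<open>Test functions\<close>

lemma test_functionI:
  assumes "smooth \<eta>" "\<And>x. \<eta> x \<noteq> 0 \<Longrightarrow> x \<in> K" "bounded K"
  shows "\<eta> \<in> test_functions"
proof -
  have "bounded {x. \<eta> x \<noteq> 0}" using assms(2,3) by (auto intro: bounded_subset)
  then show ?thesis using assms(1) by (auto simp: test_functions_def smooth_def compact_closure)
qed

lemma test_function_smooth: "\<eta> \<in> test_functions \<Longrightarrow> smooth \<eta>"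
  by (simp add: test_functions_def smooth_def)

lemma test_function_support:
  assumes "\<eta> \<in> test_functions"
  obtains R where "R > 0" "\<And>x. \<eta> x \<noteq> 0 \<Longrightarrow> norm x \<le> R"
proof -
  have "bounded {x. \<eta> x \<noteq> 0}" using assms by (simp add: test_functions_def compact_closure)
  then show ?thesis using that bounded_pos[of "{x. \<eta> x \<noteq> 0}"] by auto
qed

lemma test_function_mult:
  assumes "smooth f" "\<eta> \<in> test_functions"
  shows "(\<lambda>x. f x * \<eta> x) \<in> test_functions"
proof -
  have "bounded {x. \<eta> x \<noteq> 0}" using assms(2) by (simp add: test_functions_def compact_closure)
  then show ?thesis
    by (rule test_functionI[rotated -1]) (use assms in \<open>auto intro: smooth_mult test_function_smooth\<close>)
qed

lemma compact_support_bounded: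
  fixes f :: "'a::euclidean_space \<Rightarrow> complex"
  assumes "continuous_on UNIV f" "\<And>x. f x \<noteq> 0 \<Longrightarrow> norm x \<le> R"
  obtains B where "B > 0" "\<And>x. norm (f x) \<le> B * indicator (cball 0 R) x"
proof -
  have "compact (f ` cball 0 R)"
    by (rule compact_continuous_image[OF continuous_on_subset[OF assms(1)]]) auto
  then obtain B where B: "B > 0" "\<And>x. x \<in> cball 0 R \<Longrightarrow> norm (f x) \<le> B"
    using compact_imp_bounded bounded_pos by (metis imageI)
  have "norm (f x) \<le> B * indicator (cball 0 R) x" for x
    using B(2)[of x] assms(2)[of x] by (cases "norm x \<le> R") auto
  with B(1) show ?thesis using that by blast
qed

lemma integrable_indicator_cball:
  "integrable lborel (\<lambda>x. B * indicator (cball (0::'a::euclidean_space) R) x :: real)"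
  by (intro integrable_mult_right integrable_real_indicator emeasure_lborel_cball_finite) auto

lemma compact_support_L2:
  fixes f :: "'a::euclidean_space \<Rightarrow> complex"
  assumes "continuous_on UNIV f" "\<And>x. f x \<noteq> 0 \<Longrightarrow> norm x \<le> R"
  shows "f \<in> L2" "integrable lborel f"
proof -
  obtain B where B: "B > 0" "\<And>x. norm (f x) \<le> B * indicator (cball 0 R) x"
    using compact_support_bounded[OF assms] by blast
  have [measurable]: "f \<in> borel_measurable borel"
    by (intro borel_measurable_continuous_onI assms)
  show "integrable lborel f"
    by (rule Bochner_Integration.integrable_bound[OF integrable_indicator_cball[of B R]])
      (use B in \<open>auto intro!: AE_I2 intro: order_trans[OF _ abs_ge_self]\<close>)
  have "(norm (f x))\<^sup>2 \<le> B\<^sup>2 * indicator (cball 0 R) x" for x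
    using power_mono[OF B(2)[of x], of 2] by (auto simp: power_mult_distrib split: split_indicator)
  then have "integrable lborel (\<lambda>x. (norm (f x))\<^sup>2)"
    by (intro Bochner_Integration.integrable_bound[OF integrable_indicator_cball[of "B\<^sup>2" R]])
      (auto intro!: AE_I2)
  then show "f \<in> L2" by (simp add: L2_def)
qed

lemma partial_deriv_zero_outside:
  assumes "\<And>x. f x \<noteq> 0 \<Longrightarrow> norm x \<le> R" "partial_deriv i f x \<noteq> 0"
  shows "norm x \<le> R"
proof (rule ccontr)
  assume "\<not> norm x \<le> R"
  then have "x \<in> - cball 0 R" by simp
  moreover have "((\<lambda>x. 0) has_derivative (\<lambda>h. 0)) (at x)" by simp
  ultimately have "(f has_derivative (\<lambda>h. 0)) (at x)"
    using assms(1) by (intro has_derivative_transform_within_open[where s="- cball 0 R" and g=f and f="\<lambda>x. 0"]) auto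
  then show False using partial_deriv_eq assms(2) by blast
qed

lemma test_function_L2:
  assumes "\<eta> \<in> test_functions"
  shows "\<eta> \<in> L2" "integrable lborel \<eta>"
proof -
  obtain R where "R > 0" "\<And>x. \<eta> x \<noteq> 0 \<Longrightarrow> norm x \<le> R" using test_function_support[OF assms] by blast
  then show "\<eta> \<in> L2" "integrable lborel \<eta>"
    using compact_support_L2 smooth_continuous[OF test_function_smooth[OF assms]] by blast+
qed

lemma partial_deriv_test_L2:
  assumes "\<eta> \<in> test_functions" "i \<in> Basis"
  shows "partial_deriv i \<eta> \<in> L2"
proof -
  obtain R where R: "\<And>x. \<eta> x \<noteq> 0 \<Longrightarrow> norm x \<le> R" using test_function_support[OF assms(1)] by blast
  show ?thesis
    by (rule compact_support_L2(1)[where R=R])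
      (use partial_deriv_zero_outside[OF R] smooth_continuous smooth_partial_deriv test_function_smooth assms in blast)+
qed

text \<open>The constant \<open>exp 1\<close> normalises the value at the origin, hence the pointwise limit, to one.
  Dilation by \<open>n\<close> makes the gradient of order \<open>1 / n\<close>.\<close>

definition cutoff :: "nat \<Rightarrow> 'a::euclidean_space \<Rightarrow> complex" where
  "cutoff n x = of_real (exp 1 * flat 0 (1 - (x \<bullet> x) / (real (Suc n))\<^sup>2))"

lemma cutoff_has_derivative:
  "(cutoff n has_derivative (\<lambda>h. of_real (exp 1 * (flat 1 (1 - (x \<bullet> x) / (real (Suc n))\<^sup>2) *
     (- 2 * (x \<bullet> h) / (real (Suc n))\<^sup>2))))) (at x)"
proof -
  have q: "((\<lambda>x. 1 - (x \<bullet> x) / (real (Suc n))\<^sup>2) has_derivative (\<lambda>h. - 2 * (x \<bullet> h) / (real (Suc n))\<^sup>2)) (at x)"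
    by (auto intro!: derivative_eq_intros simp: inner_commute power2_eq_square field_simps simp del: of_nat_Suc)
  have "((\<lambda>x. flat 0 (1 - (x \<bullet> x) / (real (Suc n))\<^sup>2)) has_derivative
     (\<lambda>h. flat 1 (1 - (x \<bullet> x) / (real (Suc n))\<^sup>2) * (- 2 * (x \<bullet> h) / (real (Suc n))\<^sup>2))) (at x)"
    using has_derivative_compose[OF q flat_has_deriv[of 0, unfolded has_field_derivative_def]] by simp
  then show ?thesis unfolding cutoff_def
    by (intro has_derivative_of_real has_derivative_mult_right)
qed

lemma smooth_cutoff: "smooth (cutoff n :: 'a::euclidean_space \<Rightarrow> complex)"
proof -
  have "smooth (\<lambda>x::'a. complex_of_real (flat 0 (1 - (x \<bullet> x) / (real (Suc n))\<^sup>2)))"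
  proof (rule smooth_flat)
    show "((\<lambda>x. 1 - (x \<bullet> x) / (real (Suc n))\<^sup>2) has_derivative (\<lambda>h. - 2 / (real (Suc n))\<^sup>2 * (x \<bullet> h))) (at x)" for x :: 'a
      by (auto intro!: derivative_eq_intros simp: inner_commute power2_eq_square field_simps simp del: of_nat_Suc)
  next
    fix i :: 'a
    have "smooth (\<lambda>x. complex_of_real (- 2 / (real (Suc n))\<^sup>2) * complex_of_real ((x - 0) \<bullet> i))"
      by (intro smooth_mult smooth_const smooth_inner)
    then show "smooth (\<lambda>x. complex_of_real (- 2 / (real (Suc n))\<^sup>2 * (x \<bullet> i)))"
      by (simp only: of_real_mult diff_zero)
  qed
  from smooth_mult[OF smooth_const this] show ?thesis
    unfolding cutoff_def of_real_mult .
qed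

lemma flat_1_bounds: "0 \<le> flat 1 t" "flat 1 t \<le> 2"
proof -
  have *: "flat 1 t = (if t > 0 then (1 / t)\<^sup>2 * exp (- 1 / t) else 0)"
    by (simp add: flat_def flat_poly_def power2_eq_square)
  show "0 \<le> flat 1 t" unfolding * by simp
  show "flat 1 t \<le> 2"
  proof (cases "t > 0")
    case True
    then have "(1 / t)\<^sup>2 \<le> 2 * exp (1 / t)"
      using exp_lower_Taylor_quadratic[of "1 / t"] by (smt (verit) divide_nonneg_pos field_sum_of_halves)
    then have "(1 / t)\<^sup>2 * exp (- 1 / t) \<le> 2 * exp (1 / t) * exp (- 1 / t)"
      by (intro mult_right_mono) auto
    then show ?thesis unfolding * by (simp add: mult.assoc flip: exp_add)
  qed (use * in simp)
qed

lemma cutoff_support: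
  assumes "cutoff n x \<noteq> 0"
  shows "norm x \<le> Suc n"
proof (rule ccontr)
  assume "\<not> norm x \<le> Suc n"
  then have "(real (Suc n))\<^sup>2 \<le> x \<bullet> x"
    unfolding dot_square_norm by (intro power_mono) auto
  then have "1 - (x \<bullet> x) / (real (Suc n))\<^sup>2 \<le> 0" by (simp add: field_simps)
  then show False using assms by (simp add: cutoff_def flat_0)
qed

lemma cutoff_test: "cutoff n \<in> test_functions"
  by (rule test_functionI[OF smooth_cutoff, of _ "cball 0 (Suc n)"]) (use cutoff_support in auto)

lemma cutoff_bound: "norm (cutoff n x) \<le> 1"
proof -
  have "flat 0 (1 - (x \<bullet> x) / (real (Suc n))\<^sup>2) \<le> exp (- 1)"
  proof (cases "1 - (x \<bullet> x) / (real (Suc n))\<^sup>2 > 0")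
    case True
    then have "1 \<le> 1 / (1 - (x \<bullet> x) / (real (Suc n))\<^sup>2)" by simp
    then show ?thesis using True by (simp add: flat_0)
  qed (simp add: flat_0)
  then have "exp 1 * flat 0 (1 - (x \<bullet> x) / (real (Suc n))\<^sup>2) \<le> exp 1 * exp (- 1)"
    by (intro mult_left_mono) auto
  then show ?thesis
    by (simp add: cutoff_def norm_mult flat_0_bounds flip: exp_add)
qed

lemma cutoff_tendsto: "(\<lambda>n. cutoff n x) \<longlonglongrightarrow> 1"
proof -
  have "(\<lambda>n. (x \<bullet> x) / (real (Suc n))\<^sup>2) \<longlonglongrightarrow> 0"
    by real_asymp
  from tendsto_diff[OF tendsto_const[of 1] this]
  have "(\<lambda>n. 1 - (x \<bullet> x) / (real (Suc n))\<^sup>2) \<longlonglongrightarrow> 1" by simp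
  then have "(\<lambda>n. flat 0 (1 - (x \<bullet> x) / (real (Suc n))\<^sup>2)) \<longlonglongrightarrow> flat 0 1"
    by (rule isCont_tendsto_compose[OF DERIV_isCont[OF flat_has_deriv]])
  from tendsto_of_real[OF tendsto_mult[OF tendsto_const[of "exp 1"] this]]
  show ?thesis by (simp add: cutoff_def flat_0 flip: exp_add of_real_mult)
qed

lemma partial_deriv_cutoff_bound:
  assumes "i \<in> Basis"
  shows "norm (partial_deriv i (cutoff n) x) \<le> 4 * exp 1 / real (Suc n)"
proof (cases "norm x \<le> Suc n")
  case False
  then have "partial_deriv i (cutoff n) x = 0"
    using partial_deriv_zero_outside[where f="cutoff n", OF cutoff_support] by blast
  then show ?thesis by simp
next
  case True
  have "norm (partial_deriv i (cutoff n) x) = exp 1 * flat 1 (1 - (x \<bullet> x) / (real (Suc n))\<^sup>2) *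
     (2 * \<bar>x \<bullet> i\<bar> / (real (Suc n))\<^sup>2)"
    unfolding partial_deriv_eq[OF cutoff_has_derivative] norm_of_real
    by (simp add: abs_mult abs_of_nonneg[OF flat_1_bounds(1)] del: of_nat_Suc One_nat_def)
  also have "\<dots> \<le> exp 1 * 2 * (2 * real (Suc n) / (real (Suc n))\<^sup>2)"
    using True Basis_le_norm[OF assms, of x] flat_1_bounds
    by (intro mult_mono divide_right_mono) (auto simp: algebra_simps)
  also have "\<dots> = 4 * exp 1 / real (Suc n)"
    by (simp add: power2_eq_square del: of_nat_Suc)
  finally show ?thesis .
qed

section \<open>The fundamental lemma of the calculus of variations\<close>

text \<open>Smooth functions that increase to the indicator function of the open box from \<open>a\<close> to \<open>b\<close>, since
  \<open>flat 0 (n * c)\<close> tends to one for \<open>c > 0\<close>.\<close>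

definition box_bump :: "'a::euclidean_space \<Rightarrow> 'a \<Rightarrow> nat \<Rightarrow> 'a \<Rightarrow> complex" where
  "box_bump a b n x = (\<Prod>i\<in>Basis. of_real (flat 0 (real n * ((x - a) \<bullet> i))) * of_real (flat 0 (real n * ((b - x) \<bullet> i))))"

lemma box_bump_test:
  fixes a b :: "'a::euclidean_space"
  shows "box_bump a b n \<in> test_functions"
proof (rule test_functionI)
  have 1: "smooth (\<lambda>x. complex_of_real (flat 0 (real n * ((x - a) \<bullet> i))))" for a i :: 'a
    by (rule smooth_flat[where q'="\<lambda>x h. real n * (h \<bullet> i)"])
      (auto intro!: derivative_eq_intros smooth_const simp flip: of_real_mult)
  have 2: "smooth (\<lambda>x. complex_of_real (flat 0 (real n * ((b - x) \<bullet> i))))" for b i :: 'a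
    by (rule smooth_flat[where q'="\<lambda>x h. - real n * (h \<bullet> i)"])
      (auto intro!: derivative_eq_intros smooth_const simp flip: of_real_mult)
  show "smooth (box_bump a b n)" unfolding box_bump_def by (intro smooth_prod smooth_mult 1 2)
  fix x assume "box_bump a b n x \<noteq> 0"
  then have *: "flat 0 (real n * ((x - a) \<bullet> i)) \<noteq> 0" "flat 0 (real n * ((b - x) \<bullet> i)) \<noteq> 0" if "i \<in> Basis" for i
    using that unfolding box_bump_def by auto
  have "x \<bullet> i > a \<bullet> i" "b \<bullet> i > x \<bullet> i" if "i \<in> Basis" for i
    using *[OF that] by (auto simp: flat_0 inner_diff_left zero_less_mult_iff split: if_splits)
  then show "x \<in> cbox a b" by (auto simp: mem_box intro: less_imp_le)
qed auto

lemma box_bump_bound: "norm (box_bump a b n x) \<le> 1"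
  unfolding box_bump_def prod_norm[symmetric]
  by (rule prod_le_1) (auto simp: norm_mult flat_0_bounds intro!: mult_le_one)

lemma flat_0_scaled_tendsto: "(\<lambda>n. flat 0 (real n * c)) \<longlonglongrightarrow> indicator {0<..} c"
proof (cases "c > 0")
  case True
  have "(\<lambda>n. exp (- 1 / (real n * c))) \<longlonglongrightarrow> exp (- 0)"
  proof (intro tendsto_exp)
    show "(\<lambda>n. - 1 / (real n * c)) \<longlonglongrightarrow> - 0" using True by real_asymp
  qed
  moreover have "\<forall>\<^sub>F n in sequentially. exp (- 1 / (real n * c)) = flat 0 (real n * c)"
    using eventually_gt_at_top[of 0] by eventually_elim (use True in \<open>simp add: flat_0\<close>)
  ultimately show ?thesis using True by (simp add: tendsto_cong)
next
  case False
  then have "flat 0 (real n * c) = 0" for n by (simp add: flat_0 zero_less_mult_iff)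
  then show ?thesis using False by simp
qed

lemma box_bump_tendsto: "(\<lambda>n. box_bump a b n x) \<longlonglongrightarrow> indicator (box a b) x"
proof -
  have lim: "(\<lambda>n. box_bump a b n x) \<longlonglongrightarrow>
    (\<Prod>i\<in>Basis. of_real (indicat_real {0<..} ((x - a) \<bullet> i)) * of_real (indicat_real {0<..} ((b - x) \<bullet> i)))"
    unfolding box_bump_def by (intro tendsto_intros flat_0_scaled_tendsto)
  have "(\<Prod>i\<in>Basis. of_real (indicat_real {0<..} ((x - a) \<bullet> i)) * of_real (indicat_real {0<..} ((b - x) \<bullet> i)) :: complex)
    = indicator (box a b) x"
  proof (cases "x \<in> box a b")
    case True
    then show ?thesis by (auto simp: mem_box inner_diff_left intro!: prod.neutral)
  next
    case False
    then obtain i where "i \<in> Basis" "\<not> (a \<bullet> i < x \<bullet> i \<and> x \<bullet> i < b \<bullet> i)" by (auto simp: mem_box)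
    then show ?thesis using False
      by (auto intro!: prod_zero bexI[of _ i] simp: inner_diff_left)
  qed
  with lim show ?thesis by simp
qed

text \<open>Boxes are an intersection-stable generator of the Borel sets, so the integral over every Borel
  set vanishes.\<close>

lemma AE_zero_if_box_integrals_zero:
  fixes f :: "'a::euclidean_space \<Rightarrow> complex"
  assumes f: "integrable lborel f"
    and box: "\<And>a b. (LINT x|lborel. indicator (box a b) x *\<^sub>R f x) = 0"
  shows "AE x in lborel. f x = 0"
proof (rule sigma_finite_measure.density_zero[OF sigma_finite_lborel f])
  have [measurable]: "f \<in> borel_measurable borel" using borel_measurable_integrable[OF f] by simp
  have si: "set_integrable lborel A f" if "A \<in> sets borel" for A
    unfolding set_integrable_def using that by (intro integrable_mult_indicator f) auto
  have total: "(LINT x|lborel. f x) = 0"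
  proof -
    have "(\<lambda>n. LINT x|lborel. indicator (box (- (real n *\<^sub>R One)) (real n *\<^sub>R One)) x *\<^sub>R f x) \<longlonglongrightarrow> (LINT x|lborel. f x)"
    proof (rule integral_dominated_convergence[where w="\<lambda>x. norm (f x)"])
      show "AE x in lborel. (\<lambda>n. indicator (box (- (real n *\<^sub>R One)) (real n *\<^sub>R One)) x *\<^sub>R f x) \<longlonglongrightarrow> f x"
      proof (rule AE_I2, rule tendsto_eventually)
        fix x :: 'a
        obtain N where N: "norm x < real N" using reals_Archimedean2 by blast
        have "x \<in> box (- (real n *\<^sub>R One)) (real n *\<^sub>R One)" if "n \<ge> N" for n
        proof -
          have "\<bar>x \<bullet> i\<bar> < real n" if "i \<in> Basis" for i
            using Basis_le_norm[OF that, of x] N \<open>n \<ge> N\<close> by linarith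
          then show ?thesis by (auto simp: mem_box abs_less_iff minus_less_iff)
        qed
        then show "\<forall>\<^sub>F n in sequentially. indicator (box (- (real n *\<^sub>R One)) (real n *\<^sub>R One)) x *\<^sub>R f x = f x"
          by (auto intro!: eventually_mono[OF eventually_ge_at_top[of N]])
      qed
    qed (use f in \<open>auto split: split_indicator\<close>)
    moreover have "(\<lambda>n. LINT x|lborel. indicator (box (- (real n *\<^sub>R One)) (real n *\<^sub>R One)) x *\<^sub>R f x) \<longlonglongrightarrow> 0"
      by (simp add: box)
    ultimately show ?thesis using LIMSEQ_unique by blast
  qed
  fix A :: "'a set" assume "A \<in> sets lborel"
  then have gen: "A \<in> sigma_sets UNIV (range (\<lambda>(a, b). box a b))"
    using borel_eq_box by (metis sets_lborel sets_measure_of top_greatest Pow_UNIV)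
  have stable: "Int_stable (range (\<lambda>(a, b). box a b :: 'a set))"
    by (auto simp: Int_stable_def box_Int_box)
  have "range (\<lambda>(a, b). box a b :: 'a set) \<subseteq> Pow UNIV" by simp
  from stable this gen show "set_lebesgue_integral lborel A f = 0"
  proof (induction rule: sigma_sets_induct_disjoint)
    case (basic A)
    then show ?case using box by (auto simp: set_lebesgue_integral_def)
  next
    case (compl A)
    have A[measurable]: "A \<in> sets borel" using compl(1) borel_eq_box by (metis sets_measure_of top_greatest Pow_UNIV)
    have "set_lebesgue_integral lborel (UNIV - A) f = (LINT x|lborel. f x - indicator A x *\<^sub>R f x)"
      unfolding set_lebesgue_integral_def by (intro Bochner_Integration.integral_cong) (auto split: split_indicator)
    also have "\<dots> = 0"
      using compl(2) total f si[OF A] by (simp add: set_lebesgue_integral_def set_integrable_def)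
    finally show ?case .
  next
    case (union A)
    have A: "A n \<in> sets borel" for n
      using union(2) borel_eq_box by (metis sets_measure_of top_greatest Pow_UNIV range_subsetD)
    then have "(\<Union>n. A n) \<in> sets borel" by auto
    then have "(\<Sum>n. set_lebesgue_integral lborel (A n) f) = set_lebesgue_integral lborel (\<Union>n. A n) f"
      using union(1) A si by (intro lebesgue_integral_countable_add[symmetric]) (auto simp: disjoint_family_on_def)
    then show ?case using union(3) by simp
  qed (auto simp: set_lebesgue_integral_def)
qed

text \<open>Letting the bumps tend to the indicator function of a box reduces the claim to integrals over boxes.\<close>

theorem fundamental_lemma:
  fixes u :: "'a::euclidean_space \<Rightarrow> complex"
  assumes [measurable]: "u \<in> borel_measurable borel"
    and int: "\<And>a b. integrable lborel (\<lambda>x. indicator (cbox a b) x *\<^sub>R u x)"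
    and test: "\<And>\<eta>. \<eta> \<in> test_functions \<Longrightarrow> (LINT x|lborel. u x * \<eta> x) = 0"
  shows "AE x in lborel. u x = 0"
proof -
  have box: "(LINT x|lborel. indicator (box a b) x *\<^sub>R u x) = 0" for a b
  proof -
    have "(\<lambda>n. LINT x|lborel. u x * box_bump a b n x) \<longlonglongrightarrow> (LINT x|lborel. indicator (box a b) x *\<^sub>R u x)"
    proof (rule integral_dominated_convergence[where w="\<lambda>x. norm (indicator (cbox a b) x *\<^sub>R u x)"])
      show "AE x in lborel. (\<lambda>n. u x * box_bump a b n x) \<longlonglongrightarrow> indicator (box a b) x *\<^sub>R u x"
      proof (rule AE_I2)
        fix x
        have "indicator (box a b) x *\<^sub>R u x = u x * indicator (box a b) x"
          by (auto split: split_indicator)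
        then show "(\<lambda>n. u x * box_bump a b n x) \<longlonglongrightarrow> indicator (box a b) x *\<^sub>R u x"
          by (auto intro!: tendsto_mult box_bump_tendsto)
      qed
      fix n
      have "box_bump a b n x = 0" if "x \<notin> cbox a b" for x
      proof -
        from that obtain i where "i \<in> Basis" "x \<bullet> i < a \<bullet> i \<or> b \<bullet> i < x \<bullet> i" by (auto simp: mem_box)
        then show ?thesis unfolding box_bump_def
          by (auto intro!: prod_zero bexI[of _ i] simp: flat_0 inner_diff_left zero_less_mult_iff)
      qed
      then show "AE x in lborel. norm (u x * box_bump a b n x) \<le> norm (indicator (cbox a b) x *\<^sub>R u x)"
        using box_bump_bound[of a b n] by (auto split: split_indicator simp: norm_mult intro!: AE_I2 mult_left_le)
      show "(\<lambda>x. u x * box_bump a b n x) \<in> borel_measurable lborel"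
        using smooth_borel[OF test_function_smooth[OF box_bump_test]] by measurable
    qed (use integrable_norm[OF int] in auto)
    then show ?thesis using test[OF box_bump_test] LIMSEQ_const_iff by (simp add: LIMSEQ_const_iff)
  qed
  have "AE x in lborel. indicator (cbox (- (real n *\<^sub>R One)) (real n *\<^sub>R One)) x *\<^sub>R u x = 0" for n
  proof (rule AE_zero_if_box_integrals_zero[OF int])
    fix a b
    define c d where "c = (- (real n *\<^sub>R One) :: 'a)" and "d = (real n *\<^sub>R One :: 'a)"
    have ae: "AE x in lborel. x \<in> cbox c d \<longleftrightarrow> x \<in> box c d"
      using AE_not_in[OF null_sets_cbox_Diff_box[of c d]] box_subset_cbox by auto
    obtain a' b' where ab: "box a b \<inter> box c d = box a' b'" using box_Int_box by blast
    have "(LINT x|lborel. indicator (box a b) x *\<^sub>R indicator (cbox c d) x *\<^sub>R u x) =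
      (LINT x|lborel. indicator (box a' b') x *\<^sub>R u x)"
      by (rule integral_cong_AE)
        (use ae in \<open>auto simp flip: ab split: split_indicator elim!: eventually_mono\<close>)
    then show "(LINT x|lborel. indicator (box a b) x *\<^sub>R indicator (cbox c d) x *\<^sub>R u x) = 0"
      by (simp add: box)
  qed
  then have "AE x in lborel. \<forall>n. indicator (cbox (- (real n *\<^sub>R One)) (real n *\<^sub>R One)) x *\<^sub>R u x = 0"
    unfolding AE_all_countable by blast
  then show ?thesis
  proof eventually_elim
    fix x assume *: "\<forall>n. indicator (cbox (- (real n *\<^sub>R One)) (real n *\<^sub>R One)) x *\<^sub>R u x = 0"
    obtain n where n: "norm x < real n" using reals_Archimedean2 by blast
    have "\<bar>x \<bullet> i\<bar> \<le> real n" if "i \<in> Basis" for i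
      using Basis_le_norm[OF that, of x] n by linarith
    then have "x \<in> cbox (- (real n *\<^sub>R One)) (real n *\<^sub>R One)" by (auto simp: mem_box abs_le_iff minus_le_iff)
    with * show "u x = 0" by (auto dest: spec[of _ n])
  qed
qed

section \<open>Weak derivatives\<close>

text \<open>The difference quotients of \<^term>\<open>F\<close> have integral zero by translation invariance, and
  they converge boundedly; this replaces the iterated integral in the usual proof.\<close>

lemma integral_derivative_zero:
  fixes F :: "'a::euclidean_space \<Rightarrow> complex"
  assumes F: "\<And>x. (F has_derivative D x) (at x)" and cont: "continuous_on UNIV (\<lambda>x. D x i)"
    and supp: "\<And>x. F x \<noteq> 0 \<Longrightarrow> norm x \<le> R" and i: "i \<in> Basis"
  shows "(LINT x|lborel. D x i) = 0"
proof -
  have contF: "continuous_on UNIV F"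
    using has_derivative_continuous[OF F] by (auto intro!: continuous_at_imp_continuous_on)
  have [measurable]: "F \<in> borel_measurable borel" "(\<lambda>x. D x i) \<in> borel_measurable borel"
    by (intro borel_measurable_continuous_onI contF cont)+
  have eq: "partial_deriv i F x = D x i" for x by (rule partial_deriv_eq[OF F])
  have suppD: "norm x \<le> R" if "D x i \<noteq> 0" for x
    by (rule partial_deriv_zero_outside[where f=F and i=i]) (use supp that eq in auto)
  obtain B where B: "B > 0" "\<And>x. norm (D x i) \<le> B * indicator (cball 0 R) x"
    using compact_support_bounded[OF cont suppD] by blast
  have B': "norm (D x i) \<le> B" for x using B(2)[of x] B(1) by (auto split: split_indicator_asm)
  define t where "t n = 1 / real (Suc n)" for n
  have t: "t n > 0" "t n \<le> 1" for n by (auto simp: t_def)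
  define q where "q n x = (F (t n *\<^sub>R i + x) - F x) /\<^sub>R t n" for n x
  have int_q: "(LINT x|lborel. q n x) = 0" for n
  proof -
    have "integrable lborel F" by (rule compact_support_L2[OF contF supp])
    then have "(LINT x|lborel. F (t n *\<^sub>R i + x) - F x) = 0"
      using integrable_translate[of F "t n *\<^sub>R i"] integral_translate[of F "t n *\<^sub>R i"] by simp
    then show ?thesis unfolding q_def by simp
  qed
  have "(\<lambda>n. LINT x|lborel. q n x) \<longlonglongrightarrow> (LINT x|lborel. D x i)"
  proof (rule integral_dominated_convergence[where w="\<lambda>x. B * indicator (cball 0 (R + 1)) x"])
    show "(\<lambda>x. D x i) \<in> borel_measurable lborel" by simp
    show "q n \<in> borel_measurable lborel" for n unfolding q_def by measurable
    show "integrable lborel (\<lambda>x. B * indicator (cball (0::'a) (R + 1)) x :: real)"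
      by (rule integrable_indicator_cball)
    show "AE x in lborel. (\<lambda>n. q n x) \<longlonglongrightarrow> D x i"
    proof (rule AE_I2)
      fix x
      have "((\<lambda>s. F (x + s *\<^sub>R i)) has_vector_derivative D x i) (at 0)"
      proof -
        have "((\<lambda>s. x + s *\<^sub>R i) has_vector_derivative i) (at 0)"
          by (auto intro!: derivative_eq_intros simp: has_vector_derivative_def)
        moreover have "(F has_derivative D x) (at (x + 0 *\<^sub>R i))" using F by simp
        ultimately show ?thesis
          using vector_derivative_diff_chain_within[of "\<lambda>s. x + s *\<^sub>R i" i 0 UNIV F "D x"]
          by (simp add: o_def has_derivative_at_withinI)
      qed
      then have "((\<lambda>h. (F (x + h *\<^sub>R i) - F x) /\<^sub>R h) \<longlongrightarrow> D x i) (at 0)"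
        unfolding has_vector_derivative_def has_derivative_at
      proof -
        assume "bounded_linear (\<lambda>h. h *\<^sub>R D x i) \<and>
          ((\<lambda>h. norm (F (x + (0 + h) *\<^sub>R i) - F (x + 0 *\<^sub>R i) - h *\<^sub>R D x i) / norm h) \<longlongrightarrow> 0) (at 0)"
        then have *: "((\<lambda>h. norm (F (x + h *\<^sub>R i) - F x - h *\<^sub>R D x i) / norm h) \<longlongrightarrow> 0) (at 0)" by simp
        have "norm ((F (x + h *\<^sub>R i) - F x) /\<^sub>R h - D x i) = norm (F (x + h *\<^sub>R i) - F x - h *\<^sub>R D x i) / norm h"
          if "h \<noteq> 0" for h
        proof -
          have "(F (x + h *\<^sub>R i) - F x) /\<^sub>R h - D x i = (F (x + h *\<^sub>R i) - F x - h *\<^sub>R D x i) /\<^sub>R h"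
            using that by (simp add: scaleR_diff_right)
          then show ?thesis by (simp add: divide_inverse mult.commute)
        qed
        then have "((\<lambda>h. norm ((F (x + h *\<^sub>R i) - F x) /\<^sub>R h - D x i)) \<longlongrightarrow> 0) (at 0)"
          by (intro Lim_transform_eventually[OF *]) (auto simp: eventually_at_filter)
        then show ?thesis by (simp add: LIM_zero_iff tendsto_norm_zero_iff)
      qed
      moreover have "filterlim t (at 0) sequentially"
        unfolding filterlim_at t_def by (auto, real_asymp)
      ultimately show "(\<lambda>n. q n x) \<longlonglongrightarrow> D x i"
        unfolding q_def by (auto dest: filterlim_compose simp: add.commute)
    qed
    fix n
    have "norm (q n x) \<le> B * indicator (cball 0 (R + 1)) x" for x
    proof (cases "norm x \<le> R + 1")
      case False
      have "norm x \<le> norm (t n *\<^sub>R i + x) + norm (t n *\<^sub>R i)"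
        using norm_triangle_ineq4[of "t n *\<^sub>R i + x" "t n *\<^sub>R i"] by simp
      then have "\<not> norm (t n *\<^sub>R i + x) \<le> R" using False t[of n] i by auto
      then have "F (t n *\<^sub>R i + x) = 0" "F x = 0" using supp[of x] supp[of "t n *\<^sub>R i + x"] False by auto
      then show ?thesis using B(1) by (simp add: q_def)
    next
      case True
      have "norm (F (x + t n *\<^sub>R i) - F (x + 0 *\<^sub>R i)) \<le> B * norm (t n - 0)"
      proof (rule differentiable_bound[where S=UNIV and f="\<lambda>s. F (x + s *\<^sub>R i)" and f'="\<lambda>s h. D (x + s *\<^sub>R i) (h *\<^sub>R i)"])
        fix s :: real
        show "((\<lambda>s. F (x + s *\<^sub>R i)) has_derivative (\<lambda>h. D (x + s *\<^sub>R i) (h *\<^sub>R i))) (at s)"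
          by (rule has_derivative_compose[OF _ F]) (auto intro!: derivative_eq_intros)
        have "linear (D (x + s *\<^sub>R i))" using F has_derivative_linear by blast
        then have "norm (D (x + s *\<^sub>R i) (h *\<^sub>R i)) \<le> B * norm h" for h
          using B'[of "x + s *\<^sub>R i"] by (simp add: linear_scale mult.commute[of B] mult_left_mono)
        then show "onorm (\<lambda>h. D (x + s *\<^sub>R i) (h *\<^sub>R i)) \<le> B"
          using B(1) by (intro onorm_bound) auto
      qed auto
      then have "norm (q n x) \<le> B"
        using t[of n] unfolding q_def norm_scaleR add.commute[of "t n *\<^sub>R i"]
        by (simp add: divide_inverse_commute[symmetric] divide_le_eq)
      then show ?thesis using True by simp
    qed
    then show "AE x in lborel. norm (q n x) \<le> B * indicator (cball 0 (R + 1)) x" by simp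
  qed
  then show ?thesis by (simp add: int_q LIMSEQ_const_iff)
qed

lemma integral_by_parts_test:
  fixes u :: "'a::euclidean_space \<Rightarrow> complex"
  assumes u: "\<And>x. (u has_derivative U x) (at x)" and cont: "continuous_on UNIV (\<lambda>x. U x i)"
    and \<eta>: "\<eta> \<in> test_functions" and i: "i \<in> Basis"
  shows "(LINT x|lborel. u x * partial_deriv i \<eta> x) = - (LINT x|lborel. U x i * \<eta> x)"
proof -
  obtain R where R: "\<And>x. \<eta> x \<noteq> 0 \<Longrightarrow> norm x \<le> R" using test_function_support[OF \<eta>] by blast
  have contu: "continuous_on UNIV u"
    using has_derivative_continuous[OF u] by (auto intro!: continuous_at_imp_continuous_on)
  note sm = test_function_smooth[OF \<eta>]
  have c\<eta>: "continuous_on UNIV \<eta>" "continuous_on UNIV (partial_deriv i \<eta>)"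
    using smooth_continuous smooth_partial_deriv sm i by blast+
  have 1: "integrable lborel (\<lambda>x. u x * partial_deriv i \<eta> x)"
    by (rule compact_support_L2(2)[where R=R])
      (use partial_deriv_zero_outside[OF R] contu c\<eta> in \<open>auto intro!: continuous_intros\<close>)
  have 2: "integrable lborel (\<lambda>x. U x i * \<eta> x)"
    by (rule compact_support_L2(2)[where R=R]) (use R cont c\<eta> in \<open>auto intro!: continuous_intros\<close>)
  define D where "D x h = u x * frechet_derivative \<eta> (at x) h + U x h * \<eta> x" for x h
  have D: "D x i = u x * partial_deriv i \<eta> x + U x i * \<eta> x" for x
    by (simp add: D_def partial_deriv_def)
  have "(LINT x|lborel. D x i) = 0"
  proof (rule integral_derivative_zero[where F="\<lambda>x. u x * \<eta> x" and R=R])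
    show "((\<lambda>x. u x * \<eta> x) has_derivative D x) (at x)" for x
      unfolding D_def by (intro has_derivative_mult u smooth_has_derivative[OF sm])
    show "continuous_on UNIV (\<lambda>x. D x i)" unfolding D by (intro continuous_intros contu c\<eta> cont)
  qed (use R i in auto)
  then have "(LINT x|lborel. u x * partial_deriv i \<eta> x + U x i * \<eta> x) = 0" by (simp add: D)
  with 1 2 show ?thesis by (simp add: add_eq_0_iff2)
qed

text \<open>Every weak derivative below is obtained from this lemma: the singular radial functions are
  limits of smooth ones.\<close>

lemma has_weak_deriv_limit:
  fixes u g :: "'a::euclidean_space \<Rightarrow> complex" and w :: "'a \<Rightarrow> complex"
  assumes un: "\<And>n x. (un n has_derivative dun n x) (at x)" and cont: "\<And>n. continuous_on UNIV (\<lambda>x. dun n x i)"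
    and i: "i \<in> Basis" and w: "w \<in> L2"
    and bound: "\<And>n. AE x in lborel. norm (un n x) \<le> norm (w x)" "\<And>n. AE x in lborel. norm (dun n x i) \<le> norm (w x)"
    and lim: "AE x in lborel. (\<lambda>n. un n x) \<longlonglongrightarrow> u x" "AE x in lborel. (\<lambda>n. dun n x i) \<longlonglongrightarrow> g x"
    and meas: "u \<in> borel_measurable borel" "g \<in> borel_measurable borel"
  shows "has_weak_deriv i u g"
proof -
  have dom: "f \<in> L2" if m: "f \<in> borel_measurable borel"
    and b: "\<And>n. AE x in lborel. norm (fn n x) \<le> norm (w x)" and l: "AE x in lborel. (\<lambda>n. fn n x) \<longlonglongrightarrow> f x"
    for f :: "'a \<Rightarrow> complex" and fn
  proof (rule L2_bound[OF w m])
    have "AE x in lborel. \<forall>n. norm (fn n x) \<le> norm (w x)" using b unfolding AE_all_countable by blast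
    then show "AE x in lborel. norm (f x) \<le> norm (w x)"
      using l by eventually_elim (intro LIMSEQ_le_const2[OF tendsto_norm], auto)
  qed
  have contu: "continuous_on UNIV (un n)" for n
    using has_derivative_continuous[OF un] by (auto intro!: continuous_at_imp_continuous_on)
  have conv: "(\<lambda>n. LINT x|lborel. fn n x * \<eta> x) \<longlonglongrightarrow> (LINT x|lborel. f x * \<eta> x)"
    if m: "f \<in> borel_measurable borel" and c: "\<And>n. continuous_on UNIV (fn n)"
      and b: "\<And>n. AE x in lborel. norm (fn n x) \<le> norm (w x)" and l: "AE x in lborel. (\<lambda>n. fn n x) \<longlonglongrightarrow> f x"
      and \<eta>: "\<eta> \<in> L2"
    for f \<eta> :: "'a \<Rightarrow> complex" and fn
  proof (rule integral_dominated_convergence[where w="\<lambda>x. norm (w x * \<eta> x)"])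
    have [measurable]: "\<eta> \<in> borel_measurable borel" "fn n \<in> borel_measurable borel" for n
      using \<eta> by (auto intro: borel_measurable_continuous_onI c)
    show "(\<lambda>x. f x * \<eta> x) \<in> borel_measurable lborel" "(\<lambda>x. fn n x * \<eta> x) \<in> borel_measurable lborel" for n
      using m by measurable
    show "integrable lborel (\<lambda>x. norm (w x * \<eta> x))" by (intro integrable_norm L2_mult_integrable w \<eta>)
    show "AE x in lborel. (\<lambda>n. fn n x * \<eta> x) \<longlonglongrightarrow> f x * \<eta> x"
      using l by eventually_elim (intro tendsto_intros)
    show "AE x in lborel. norm (fn n x * \<eta> x) \<le> norm (w x * \<eta> x)" for n
      using b[of n] by eventually_elim (auto simp: norm_mult intro: mult_right_mono)
  qed
  have "(LINT x|lborel. u x * partial_deriv i \<eta> x) = - (LINT x|lborel. g x * \<eta> x)"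
    if \<eta>: "\<eta> \<in> test_functions" for \<eta>
  proof (rule LIMSEQ_unique)
    show "(\<lambda>n. LINT x|lborel. un n x * partial_deriv i \<eta> x) \<longlonglongrightarrow> (LINT x|lborel. u x * partial_deriv i \<eta> x)"
      by (intro conv meas contu bound lim partial_deriv_test_L2 \<eta> i)
    show "(\<lambda>n. LINT x|lborel. un n x * partial_deriv i \<eta> x) \<longlonglongrightarrow> - (LINT x|lborel. g x * \<eta> x)"
      unfolding integral_by_parts_test[OF un cont \<eta> i]
      by (intro tendsto_minus conv meas cont bound lim test_function_L2 \<eta> i)
  qed
  then show ?thesis using dom[OF meas(1) bound(1) lim(1)] dom[OF meas(2) bound(2) lim(2)]
    by (simp add: has_weak_deriv_def)
qed

lemma has_weak_deriv_L2: "has_weak_deriv i u g \<Longrightarrow> u \<in> L2" "has_weak_deriv i u g \<Longrightarrow> g \<in> L2"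
  by (auto simp: has_weak_deriv_def)

lemma has_weak_deriv_unique:
  assumes "has_weak_deriv i u g" "has_weak_deriv i u g'"
  shows "AE x in lborel. g x = g' x"
proof -
  note L2 = has_weak_deriv_L2(2)[OF assms(1)] has_weak_deriv_L2(2)[OF assms(2)]
  have "AE x in lborel. g x - g' x = 0"
  proof (rule fundamental_lemma)
    show "(\<lambda>x. g x - g' x) \<in> borel_measurable borel" using L2_borel[OF L2_diff[OF L2]] .
    show "integrable lborel (\<lambda>x. indicator (cbox a b) x *\<^sub>R (g x - g' x))" for a b
      by (rule L2_locally_integrable[OF L2_diff[OF L2]])
    fix \<eta> :: "'a \<Rightarrow> complex" assume \<eta>: "\<eta> \<in> test_functions"
    have "(LINT x|lborel. g x * \<eta> x) = (LINT x|lborel. g' x * \<eta> x)"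
      using assms \<eta> unfolding has_weak_deriv_def by (metis add.inverse_inverse)
    then show "(LINT x|lborel. (g x - g' x) * \<eta> x) = 0"
      using L2_mult_integrable[OF L2(1) test_function_L2(1)[OF \<eta>]] L2_mult_integrable[OF L2(2) test_function_L2(1)[OF \<eta>]]
      by (simp add: left_diff_distrib)
  qed
  then show ?thesis by simp
qed

lemma has_weak_deriv_cong:
  assumes "has_weak_deriv i u g" "u' \<in> L2" "AE x in lborel. u x = u' x" and i: "i \<in> Basis"
  shows "has_weak_deriv i u' g"
proof -
  have [measurable]: "u \<in> borel_measurable borel" "u' \<in> borel_measurable borel"
    using assms has_weak_deriv_L2 by (auto intro: L2_borel)
  have "(LINT x|lborel. u x * partial_deriv i \<eta> x) = (LINT x|lborel. u' x * partial_deriv i \<eta> x)"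
    if "\<eta> \<in> test_functions" for \<eta>
  proof (rule integral_cong_AE)
    have [measurable]: "partial_deriv i \<eta> \<in> borel_measurable borel"
      using partial_deriv_test_L2[OF that i] by (rule L2_borel)
    show "(\<lambda>x. u x * partial_deriv i \<eta> x) \<in> borel_measurable lborel" "(\<lambda>x. u' x * partial_deriv i \<eta> x) \<in> borel_measurable lborel"
      by measurable
    show "AE x in lborel. u x * partial_deriv i \<eta> x = u' x * partial_deriv i \<eta> x"
      using assms(3) by eventually_elim simp
  qed
  then show ?thesis using assms by (auto simp: has_weak_deriv_def)
qed

text \<open>A weak derivative is only determined up to a null set. What is known of one weak derivative has
  to be transferred to the one that \<^const>\<open>weak_deriv\<close> chooses, which is why uniqueness, and with it
  the fundamental lemma, enters every statement about \<^const>\<open>laplacian\<close>.\<close>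

lemma weak_deriv_works:
  assumes "has_weak_deriv i u g"
  shows "has_weak_deriv i u (weak_deriv i u)" "AE x in lborel. g x = weak_deriv i u x"
proof -
  show *: "has_weak_deriv i u (weak_deriv i u)"
    unfolding weak_deriv_def by (rule someI[where P="has_weak_deriv i u"], rule assms)
  show "AE x in lborel. g x = weak_deriv i u x" by (rule has_weak_deriv_unique[OF assms *])
qed

lemma H2_weak_derivs:
  assumes "\<phi> \<in> H2" "i \<in> Basis"
  shows "has_weak_deriv i \<phi> (weak_deriv i \<phi>)"
    and "has_weak_deriv i (weak_deriv i \<phi>) (weak_deriv i (weak_deriv i \<phi>))"
proof -
  obtain g h where g: "has_weak_deriv i \<phi> g" and h: "has_weak_deriv i g h"
    using assms unfolding H2_def H1_def by blast
  show *: "has_weak_deriv i \<phi> (weak_deriv i \<phi>)" by (rule weak_deriv_works[OF g])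
  have "has_weak_deriv i (weak_deriv i \<phi>) h"
    by (rule has_weak_deriv_cong[OF h has_weak_deriv_L2(2)[OF *] weak_deriv_works(2)[OF g] assms(2)])
  then show "has_weak_deriv i (weak_deriv i \<phi>) (weak_deriv i (weak_deriv i \<phi>))"
    by (rule weak_deriv_works)
qed

lemma H2_L2: "\<phi> \<in> H2 \<Longrightarrow> \<phi> \<in> L2"
  by (simp add: H2_def)

lemma laplacian_L2: "\<phi> \<in> H2 \<Longrightarrow> laplacian \<phi> \<in> L2"
  unfolding laplacian_def by (intro L2_sum) (blast dest: H2_weak_derivs(2) has_weak_deriv_L2(2))

lemma H2_I:
  fixes u :: "'a::euclidean_space \<Rightarrow> complex"
  assumes g: "\<And>i. i \<in> Basis \<Longrightarrow> has_weak_deriv i u (g i)"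
    and h: "\<And>i j. i \<in> Basis \<Longrightarrow> j \<in> Basis \<Longrightarrow> has_weak_deriv j (g i) (h i j)"
  shows "u \<in> H2" "AE x in lborel. laplacian u x = (\<Sum>i\<in>Basis. h i i x)"
proof -
  obtain i0 :: 'a where "i0 \<in> Basis" using nonempty_Basis by blast
  then have "u \<in> L2" using g has_weak_deriv_L2(1) by blast
  moreover have "g i \<in> H1" if i: "i \<in> Basis" for i
    unfolding H1_def using has_weak_deriv_L2(2)[OF g[OF i]] h[OF i] by auto
  ultimately show "u \<in> H2" unfolding H2_def using g by auto
  have "AE x in lborel. weak_deriv i (weak_deriv i u) x = h i i x" if i: "i \<in> Basis" for i
  proof -
    have "has_weak_deriv i (weak_deriv i u) (h i i)"
      by (rule has_weak_deriv_cong[OF h[OF i i] has_weak_deriv_L2(2) weak_deriv_works(2)[OF g[OF i]] i])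
        (rule weak_deriv_works[OF g[OF i]])
    from weak_deriv_works(2)[OF this] show ?thesis by eventually_elim simp
  qed
  then have "AE x in lborel. \<forall>i\<in>Basis. weak_deriv i (weak_deriv i u) x = h i i x"
    by (intro AE_finite_allI) auto
  then show "AE x in lborel. laplacian u x = (\<Sum>i\<in>Basis. h i i x)"
    by eventually_elim (simp add: laplacian_def)
qed

text \<open>Test functions may be replaced by smooth functions without compact support,
  because the gradient of the cutoff functions tends to zero uniformly.\<close>

lemma weak_deriv_by_parts:
  fixes u g \<zeta> :: "'a::euclidean_space \<Rightarrow> complex"
  assumes wd: "has_weak_deriv i u g" and i: "i \<in> Basis"
    and sm: "smooth \<zeta>" and \<zeta>: "\<zeta> \<in> L2" "partial_deriv i \<zeta> \<in> L2"
  shows "(LINT x|lborel. u x * partial_deriv i \<zeta> x) = - (LINT x|lborel. g x * \<zeta> x)"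
proof -
  note L2 = has_weak_deriv_L2[OF wd]
  have [measurable]: "u \<in> borel_measurable borel" "g \<in> borel_measurable borel" "\<zeta> \<in> borel_measurable borel"
    "partial_deriv i \<zeta> \<in> borel_measurable borel"
    using L2 \<zeta> by (auto intro: L2_borel)
  have [measurable]: "cutoff n \<in> borel_measurable borel" "partial_deriv i (cutoff n) \<in> borel_measurable borel" for n
    by (intro smooth_borel smooth_cutoff smooth_partial_deriv i)+
  let ?\<zeta> = "\<lambda>n x. \<zeta> x * cutoff n x"
  have pd: "partial_deriv i (?\<zeta> n) x = \<zeta> x * partial_deriv i (cutoff n) x + partial_deriv i \<zeta> x * cutoff n x" for n x
    unfolding partial_deriv_eq[OF has_derivative_mult[OF smooth_has_derivative[OF sm] smooth_has_derivative[OF smooth_cutoff]]]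
    by (simp add: partial_deriv_def)
  have eq: "(LINT x|lborel. u x * (\<zeta> x * partial_deriv i (cutoff n) x + partial_deriv i \<zeta> x * cutoff n x)) =
    - (LINT x|lborel. g x * (\<zeta> x * cutoff n x))" for n
    using wd test_function_mult[OF sm cutoff_test[of n]] unfolding has_weak_deriv_def pd[symmetric] by blast
  have lim_g: "(\<lambda>n. LINT x|lborel. g x * (\<zeta> x * cutoff n x)) \<longlonglongrightarrow> (LINT x|lborel. g x * \<zeta> x)"
  proof (rule integral_dominated_convergence[where w="\<lambda>x. norm (g x * \<zeta> x)"])
    show "integrable lborel (\<lambda>x. norm (g x * \<zeta> x))" by (intro integrable_norm L2_mult_integrable L2 \<zeta>)
    show "AE x in lborel. (\<lambda>n. g x * (\<zeta> x * cutoff n x)) \<longlonglongrightarrow> g x * \<zeta> x"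
      by (rule AE_I2) (auto intro!: tendsto_eq_intros cutoff_tendsto)
    show "AE x in lborel. norm (g x * (\<zeta> x * cutoff n x)) \<le> norm (g x * \<zeta> x)" for n
      using cutoff_bound[of n] by (auto simp: norm_mult mult_left_le intro!: AE_I2 mult_left_mono mult_left_le)
  qed auto
  have lim_u: "(\<lambda>n. LINT x|lborel. u x * (\<zeta> x * partial_deriv i (cutoff n) x + partial_deriv i \<zeta> x * cutoff n x))
    \<longlonglongrightarrow> (LINT x|lborel. u x * partial_deriv i \<zeta> x)"
  proof (rule integral_dominated_convergence[where w="\<lambda>x. 4 * exp 1 * norm (u x * \<zeta> x) + norm (u x * partial_deriv i \<zeta> x)"])
    show "integrable lborel (\<lambda>x. 4 * exp 1 * norm (u x * \<zeta> x) + norm (u x * partial_deriv i \<zeta> x))"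
      by (intro Bochner_Integration.integrable_add integrable_mult_right integrable_norm L2_mult_integrable L2 \<zeta>)
    have lim: "(\<lambda>n. partial_deriv i (cutoff n) x) \<longlonglongrightarrow> 0" for x
    proof (rule Lim_null_comparison)
      show "\<forall>\<^sub>F n in sequentially. norm (partial_deriv i (cutoff n) x) \<le> 4 * exp 1 / real (Suc n)"
        by (intro always_eventually allI partial_deriv_cutoff_bound i)
      show "(\<lambda>n. 4 * exp 1 / real (Suc n)) \<longlonglongrightarrow> 0" by real_asymp
    qed
    show "AE x in lborel. (\<lambda>n. u x * (\<zeta> x * partial_deriv i (cutoff n) x + partial_deriv i \<zeta> x * cutoff n x))
        \<longlonglongrightarrow> u x * partial_deriv i \<zeta> x"
      by (rule AE_I2) (auto intro!: tendsto_eq_intros cutoff_tendsto lim)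
    fix n
    have "norm (u x * (\<zeta> x * partial_deriv i (cutoff n) x + partial_deriv i \<zeta> x * cutoff n x))
        \<le> 4 * exp 1 * norm (u x * \<zeta> x) + norm (u x * partial_deriv i \<zeta> x)" for x
    proof -
      have "4 * exp 1 / real (Suc n) \<le> 4 * exp 1" by (simp add: field_simps)
      then have c: "norm (partial_deriv i (cutoff n) x) \<le> 4 * exp 1"
        using partial_deriv_cutoff_bound[OF i, of n x] by linarith
      have "norm (u x * (\<zeta> x * partial_deriv i (cutoff n) x + partial_deriv i \<zeta> x * cutoff n x))
        \<le> norm (u x * \<zeta> x) * norm (partial_deriv i (cutoff n) x) + norm (u x * partial_deriv i \<zeta> x) * norm (cutoff n x)"
        unfolding norm_mult[symmetric] by (rule order_trans[OF _ norm_triangle_ineq]) (simp add: algebra_simps)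
      also have "\<dots> \<le> norm (u x * \<zeta> x) * (4 * exp 1) + norm (u x * partial_deriv i \<zeta> x) * 1"
        by (intro add_mono mult_left_mono c cutoff_bound) auto
      finally show ?thesis by (simp add: mult.commute)
    qed
    then show "AE x in lborel. norm (u x * (\<zeta> x * partial_deriv i (cutoff n) x + partial_deriv i \<zeta> x * cutoff n x))
        \<le> 4 * exp 1 * norm (u x * \<zeta> x) + norm (u x * partial_deriv i \<zeta> x)" by simp
  qed auto
  show ?thesis
    by (rule LIMSEQ_unique[OF lim_u[unfolded eq] tendsto_minus[OF lim_g]])
qed

lemma laplacian_by_parts:
  fixes \<phi> \<zeta> :: "'a::euclidean_space \<Rightarrow> complex"
  assumes \<phi>: "\<phi> \<in> H2" and sm: "smooth \<zeta>"
    and \<zeta>: "\<zeta> \<in> L2" "\<And>i. i \<in> Basis \<Longrightarrow> partial_deriv i \<zeta> \<in> L2"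
      "\<And>i. i \<in> Basis \<Longrightarrow> partial_deriv i (partial_deriv i \<zeta>) \<in> L2"
  shows "(LINT x|lborel. laplacian \<phi> x * \<zeta> x) =
    (LINT x|lborel. \<phi> x * (\<Sum>i\<in>Basis. partial_deriv i (partial_deriv i \<zeta>) x))"
proof -
  have eq: "(LINT x|lborel. weak_deriv i (weak_deriv i \<phi>) x * \<zeta> x) =
    (LINT x|lborel. \<phi> x * partial_deriv i (partial_deriv i \<zeta>) x)" if i: "i \<in> Basis" for i
    using weak_deriv_by_parts[OF H2_weak_derivs(2)[OF \<phi> i] i sm \<zeta>(1) \<zeta>(2)[OF i]]
      weak_deriv_by_parts[OF H2_weak_derivs(1)[OF \<phi> i] i smooth_partial_deriv[OF sm i] \<zeta>(2)[OF i] \<zeta>(3)[OF i]]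
    by simp
  have int1: "integrable lborel (\<lambda>x. weak_deriv i (weak_deriv i \<phi>) x * \<zeta> x)" if i: "i \<in> Basis" for i
    using H2_weak_derivs(2)[OF \<phi> i] \<zeta>(1) by (blast intro: L2_mult_integrable has_weak_deriv_L2)
  have int2: "integrable lborel (\<lambda>x. \<phi> x * partial_deriv i (partial_deriv i \<zeta>) x)" if i: "i \<in> Basis" for i
    by (intro L2_mult_integrable H2_L2 \<phi> \<zeta>(3) i)
  have "(LINT x|lborel. laplacian \<phi> x * \<zeta> x) =
      (\<Sum>i\<in>Basis. LINT x|lborel. weak_deriv i (weak_deriv i \<phi>) x * \<zeta> x)"
    unfolding laplacian_def sum_distrib_right by (rule Bochner_Integration.integral_sum[OF int1])
  also have "\<dots> = (\<Sum>i\<in>Basis. LINT x|lborel. \<phi> x * partial_deriv i (partial_deriv i \<zeta>) x)"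
    by (rule sum.cong[OF refl eq])
  also have "\<dots> = (LINT x|lborel. \<phi> x * (\<Sum>i\<in>Basis. partial_deriv i (partial_deriv i \<zeta>) x))"
    unfolding sum_distrib_left by (rule Bochner_Integration.integral_sum[OF int2, symmetric])
  finally show ?thesis .
qed

lemma continuous_rep_eq:
  fixes v :: "'a::euclidean_space \<Rightarrow> complex"
  assumes "continuous_on UNIV v" "AE x in lborel. v x = u x"
  shows "continuous_rep u = v"
  unfolding continuous_rep_def
proof (rule the_equality)
  show "continuous_on UNIV v \<and> (AE x in lborel. v x = u x)" using assms by simp
  fix w assume w: "continuous_on UNIV w \<and> (AE x in lborel. w x = u x)"
  have "AE x in lborel. w x = v x" using conjunct2[OF w] assms(2) by eventually_elim simp
  then have "AE x in lebesgue. x \<in> {x. w x = v x}" by (intro AE_completion) simp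
  moreover have "closed {x. w x = v x}" using w assms by (intro closed_Collect_eq) auto
  ultimately show "w = v" using mem_closed_if_AE_lebesgue by blast
qed

section \<open>Integrals of radial functions\<close>

text \<open>Integration in polar coordinates, for radial integrands only: both measures give the interval
  up to \<open>r\<close> the volume of the ball of radius \<open>r\<close>, which is all that enters.\<close>

lemma distr_norm_lborel:
  "distr (lborel :: 'a::euclidean_space measure) borel norm =
    density lborel (\<lambda>r. ennreal (unit_ball_vol DIM('a) * DIM('a) * r ^ (DIM('a) - 1)) * indicator {0..} r)"
  (is "?M = ?N")
proof (rule measure_eqI_generator_eq[where \<Omega>=UNIV and E="range (\<lambda>a::real. {..a})" and A="\<lambda>n. {..real n}"])
  let ?d = "DIM('a)"
  have M: "emeasure ?M {..a} = ennreal (if 0 \<le> a then unit_ball_vol ?d * a ^ ?d else 0)" for a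
  proof -
    have "norm -` {..a} = (cball 0 a :: 'a set)" by auto
    then have "emeasure ?M {..a} = emeasure lborel (cball 0 a :: 'a set)" by (simp add: emeasure_distr)
    then show ?thesis by (auto simp: emeasure_cball)
  qed
  have N: "emeasure ?N {..a} = ennreal (if 0 \<le> a then unit_ball_vol ?d * a ^ ?d else 0)" for a
  proof (cases "0 \<le> a")
    case True
    have "emeasure ?N {..a} = (\<integral>\<^sup>+r. ennreal (unit_ball_vol ?d * ?d * r ^ (?d - 1)) * indicator {0..a} r \<partial>lborel)"
      by (subst emeasure_density) (auto intro!: nn_integral_cong split: split_indicator)
    also have "\<dots> = ennreal (unit_ball_vol ?d * a ^ ?d - unit_ball_vol ?d * 0 ^ ?d)"
      by (rule nn_integral_FTC_Icc[OF _ _ _ True]) (auto intro!: derivative_eq_intros simp: has_real_derivative_iff_has_vector_derivative[symmetric])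
    finally show ?thesis using True by (simp add: power_0_left)
  next
    case False
    have "emeasure ?N {..a} = (\<integral>\<^sup>+r. 0 \<partial>(lborel :: real measure))"
      using False by (subst emeasure_density, simp, simp, intro nn_integral_cong) (auto split: split_indicator)
    then show ?thesis using False by simp
  qed
  show "emeasure ?M X = emeasure ?N X" if "X \<in> range (\<lambda>a::real. {..a})" for X
    using that M N by auto
  show "emeasure ?M {..real n} \<noteq> \<infinity>" for n by (simp add: M)
  show "Int_stable (range (\<lambda>a::real. {..a}))" by (auto simp: Int_stable_def)
  show "(\<Union>n. {..real n}) = UNIV" using real_arch_simple by auto
  show "sets ?M = sigma_sets UNIV (range (\<lambda>a::real. {..a}))" "sets ?N = sigma_sets UNIV (range (\<lambda>a::real. {..a}))"
    by (simp_all add: borel_eq_atMost)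
qed auto

lemma nn_integral_radial:
  assumes [measurable]: "f \<in> borel_measurable borel"
  shows "(\<integral>\<^sup>+x. f (norm (x::'a::euclidean_space)) \<partial>lborel) =
    (\<integral>\<^sup>+r. ennreal (unit_ball_vol DIM('a) * DIM('a) * r ^ (DIM('a) - 1)) * indicator {0..} r * f r \<partial>lborel)"
proof -
  have "(\<integral>\<^sup>+x. f (norm (x::'a)) \<partial>lborel) = (\<integral>\<^sup>+r. f r \<partial>distr (lborel :: 'a measure) borel norm)"
    by (subst nn_integral_distr) auto
  also have "\<dots> = (\<integral>\<^sup>+r. ennreal (unit_ball_vol DIM('a) * DIM('a) * r ^ (DIM('a) - 1)) * indicator {0..} r * f r \<partial>lborel)"
    unfolding distr_norm_lborel by (subst nn_integral_density) auto
  finally show ?thesis .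
qed

lemma power_le_exp:
  fixes x :: real
  assumes "x \<ge> 0"
  shows "x ^ n \<le> (real n) ^ n * exp x"
proof (cases "n = 0")
  case False
  have "(x / n) ^ n \<le> (1 + x / n) ^ n" using assms by (intro power_mono) auto
  also have "\<dots> \<le> exp x" using assms False by (intro exp_ge_one_plus_x_over_n_power_n) auto
  finally show ?thesis using False by (simp add: power_divide field_simps)
qed (use assms in auto)

lemma power_times_exp_le:
  fixes c r :: real
  assumes "c > 0" "r \<ge> 0"
  shows "r ^ n * exp (- c * r) \<le> real n ^ n / c ^ n"
proof -
  have "(c * r) ^ n \<le> real n ^ n * exp (c * r)" using assms by (intro power_le_exp) auto
  then show ?thesis using assms by (simp add: exp_minus power_mult_distrib field_simps)
qed

lemma nn_integral_exp_decay:
  assumes "c > 0"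
  shows "(\<integral>\<^sup>+r. ennreal (exp (- c * r)) * indicator {0..} r \<partial>lborel) < \<infinity>"
proof -
  have "(\<integral>\<^sup>+r. ennreal (exp (- c * r)) * indicator {0..} r \<partial>lborel) = ennreal (0 - (- exp (- c * 0) / c))"
  proof (rule nn_integral_FTC_atLeast)
    show "((\<lambda>r. - exp (- c * r) / c) \<longlongrightarrow> 0) at_top" using assms by real_asymp
  qed (use assms in \<open>auto intro!: derivative_eq_intros\<close>)
  then show ?thesis by simp
qed

text \<open>Upper bounds for the resolvent kernels: \<open>m\<close> is the order of the pole at the origin, \<open>c\<close> the rate of
  decay.\<close>

definition decay :: "nat \<Rightarrow> real \<Rightarrow> real \<Rightarrow> real" where
  "decay m c r = exp (- c * r) * (1 + 1 / r ^ m)"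

lemma decay_mono:
  assumes "0 < r" "r \<le> s" "c \<ge> 0"
  shows "decay m c s \<le> decay m c r"
  unfolding decay_def using assms
  by (intro mult_mono add_left_mono divide_left_mono power_mono) (auto intro: mult_left_mono)

lemma decay_nonneg: "r \<ge> 0 \<Longrightarrow> decay m c r \<ge> 0"
  by (simp add: decay_def)

lemma decay_rate_mono:
  assumes "c \<le> d" "s \<ge> 0"
  shows "decay m d s \<le> decay m c s"
  unfolding decay_def using assms by (intro mult_right_mono) (auto intro: mult_right_mono)

lemma decay_bound_nonneg:
  assumes "norm a \<le> K * decay m c s" "s > 0"
  shows "K \<ge> 0"
proof -
  have "0 \<le> K * decay m c s" using assms(1) norm_ge_zero order_trans by blast
  moreover have "decay m c s > 0" using assms(2) by (simp add: decay_def add_pos_nonneg)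
  ultimately show ?thesis by (simp add: zero_le_mult_iff)
qed

lemma AE_off_point:
  fixes y :: "'a::euclidean_space"
  assumes "\<And>x. x \<noteq> y \<Longrightarrow> P x"
  shows "AE x in lborel. P x"
  using AE_lborel_singleton[of y] by eventually_elim (rule assms)

text \<open>In polar coordinates the square contributes \<open>r ^ (DIM('a) - 1 - 2 * m)\<close> near the origin; the
  exponent is non-negative by the assumption on \<open>m\<close>.\<close>

lemma decay_L2:
  fixes y :: "'a::euclidean_space"
  assumes c: "c > 0" and m: "2 * m < DIM('a)"
  shows "(\<lambda>x. complex_of_real (K * decay m c (norm (x - y)))) \<in> L2"
proof -
  let ?p = "DIM('a) - 1"
  let ?B = "unit_ball_vol DIM('a) * DIM('a)"
  have [measurable]: "decay m c \<in> borel_measurable borel" unfolding decay_def by measurable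
  let ?C = "2 * ?B * (((real ?p) ^ ?p / c ^ ?p) + (real (?p - 2 * m)) ^ (?p - 2 * m) / c ^ (?p - 2 * m))"
  have pw: "r ^ k * exp (- 2 * c * r) \<le> (real k ^ k / c ^ k) * exp (- c * r)" if "r \<ge> 0" for r k
    using mult_right_mono[OF power_times_exp_le[OF c that, of k], of "exp (- c * r)"]
    by (simp add: mult.assoc flip: exp_add)
  have bound: "?B * r ^ ?p * (decay m c r)\<^sup>2 \<le> ?C * exp (- c * r)" if r: "r > 0" for r
  proof -
    have "(1 + 1 / r ^ m)\<^sup>2 \<le> 2 + 2 / r ^ (2 * m)"
      using zero_le_power2[of "1 - 1 / r ^ m"]
      by (simp add: power2_eq_square algebra_simps power_mult mult_2 power_add)
    then have "(decay m c r)\<^sup>2 \<le> exp (- 2 * c * r) * (2 + 2 / r ^ (2 * m))"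
      unfolding decay_def power_mult_distrib by (simp add: exp_double[symmetric] mult.assoc)
    then have "?B * r ^ ?p * (decay m c r)\<^sup>2 \<le> ?B * r ^ ?p * (exp (- 2 * c * r) * (2 + 2 / r ^ (2 * m)))"
      using r by (intro mult_left_mono) auto
    also have "\<dots> = 2 * ?B * (r ^ ?p * exp (- 2 * c * r) + r ^ (?p - 2 * m) * exp (- 2 * c * r))"
    proof -
      have "r ^ ?p = r ^ (?p - 2 * m) * r ^ (2 * m)" using m by (simp flip: power_add)
      then show ?thesis using r by (simp add: field_simps)
    qed
    also have "\<dots> \<le> 2 * ?B * ((real ?p ^ ?p / c ^ ?p) * exp (- c * r) + (real (?p - 2 * m) ^ (?p - 2 * m) / c ^ (?p - 2 * m)) * exp (- c * r))"
      using pw[of r ?p] pw[of r "?p - 2 * m"] r by (intro mult_left_mono add_mono) auto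
    finally show ?thesis by (simp add: algebra_simps)
  qed
  have "(\<integral>\<^sup>+x. ennreal ((decay m c (norm (x::'a)))\<^sup>2) \<partial>lborel) =
    (\<integral>\<^sup>+r. ennreal (?B * r ^ ?p) * indicator {0..} r * ennreal ((decay m c r)\<^sup>2) \<partial>lborel)"
    by (rule nn_integral_radial) measurable
  also have "\<dots> \<le> (\<integral>\<^sup>+r. ennreal ?C * (ennreal (exp (- c * r)) * indicator {0..} r) \<partial>lborel)"
  proof (rule nn_integral_mono_AE)
    have "AE r in lborel. r \<noteq> (0::real)" by (rule AE_lborel_singleton)
    then show "AE r in lborel. ennreal (?B * r ^ ?p) * indicator {0..} r * ennreal ((decay m c r)\<^sup>2)
        \<le> ennreal ?C * (ennreal (exp (- c * r)) * indicator {0..} r)"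
    proof eventually_elim
      fix r :: real assume "r \<noteq> 0"
      show "ennreal (?B * r ^ ?p) * indicator {0..} r * ennreal ((decay m c r)\<^sup>2)
        \<le> ennreal ?C * (ennreal (exp (- c * r)) * indicator {0..} r)"
      proof (cases "r > 0")
        case True
        have "ennreal (?B * r ^ ?p) * ennreal ((decay m c r)\<^sup>2) \<le> ennreal ?C * ennreal (exp (- c * r))"
          using ennreal_leI[OF bound[OF True]] True c by (subst (asm) (1 2) ennreal_mult) auto
        then show ?thesis using True by simp
      qed (use \<open>r \<noteq> 0\<close> in auto)
    qed
  qed
  also have "\<dots> < \<infinity>"
    using nn_integral_exp_decay[OF c] by (simp add: nn_integral_cmult ennreal_mult_less_top)
  finally have fin: "(\<integral>\<^sup>+x. ennreal ((decay m c (norm (x::'a)))\<^sup>2) \<partial>lborel) < \<infinity>" .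
  have "(\<lambda>x::'a. complex_of_real (decay m c (norm x))) \<in> L2"
    unfolding L2_def using fin by (auto intro!: integrableI_bounded simp: norm_power)
  from L2_cmult[OF L2_translate(1)[OF this, of "- y"], of "of_real K"] show ?thesis by simp
qed

text \<open>In polar coordinates the integrand is the derivative of \<open>(r / sqrt (1 + r\<^sup>2)) ^ DIM('a)\<close>, up to
  the factor \<open>unit_ball_vol DIM('a)\<close>.\<close>

lemma kernel_mass:
  "integrable lborel (\<lambda>w::'a::euclidean_space. 1 / (reg_dist 1 0 w) ^ (DIM('a) + 2))"
  "(LINT w|lborel. 1 / (reg_dist 1 0 (w::'a)) ^ (DIM('a) + 2)) = unit_ball_vol DIM('a)"
proof -
  let ?d = "DIM('a)" and ?s = "\<lambda>r::real. sqrt (1 + r\<^sup>2)"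
  have s: "reg_dist 1 0 w = ?s (norm w)" for w :: 'a by (simp add: reg_dist_def dot_square_norm add.commute)
  have pos: "1 + r\<^sup>2 > 0" "?s r > 0" for r :: real by (auto simp: add_pos_nonneg)
  have "(\<integral>\<^sup>+w. ennreal (1 / (reg_dist 1 0 (w::'a)) ^ (?d + 2)) \<partial>lborel) =
    (\<integral>\<^sup>+r. ennreal (unit_ball_vol ?d * ?d * r ^ (?d - 1)) * indicator {0..} r * ennreal (1 / ?s r ^ (?d + 2)) \<partial>lborel)"
    unfolding s by (rule nn_integral_radial) measurable
  also have "\<dots> = (\<integral>\<^sup>+r. ennreal (unit_ball_vol ?d * ?d * r ^ (?d - 1) / ?s r ^ (?d + 2)) * indicator {0..} r \<partial>lborel)"
    by (intro nn_integral_cong) (auto simp: ennreal_mult[symmetric] split: split_indicator)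
  also have "\<dots> = ennreal (unit_ball_vol ?d * 1 ^ ?d - unit_ball_vol ?d * (0 / ?s 0) ^ ?d)"
  proof (rule nn_integral_FTC_atLeast)
    have "((\<lambda>r. r / ?s r) \<longlongrightarrow> 1) at_top" by real_asymp
    then show "((\<lambda>r. unit_ball_vol ?d * (r / ?s r) ^ ?d) \<longlongrightarrow> unit_ball_vol ?d * 1 ^ ?d) at_top"
      by (intro tendsto_intros)
    fix r :: real assume r: "0 \<le> r"
    have "((\<lambda>r. r / ?s r) has_real_derivative (1 / ?s r ^ 3)) (at r)"
    proof -
      have "((\<lambda>r. r / ?s r) has_real_derivative ((1 * ?s r - r * (inverse (?s r) / 2 * (2 * r))) / (?s r * ?s r))) (at r)"
        using pos[of r] by (auto intro!: derivative_eq_intros)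
      moreover have "(1 * ?s r - r * (inverse (?s r) / 2 * (2 * r))) / (?s r * ?s r) = 1 / ?s r ^ 3"
      proof -
        have "?s r * ?s r = 1 + r * r" using pos[of r] by (simp add: power2_eq_square)
        then show ?thesis using pos(2)[of r]
          by (simp add: field_simps power3_eq_cube)
      qed
      ultimately show ?thesis by simp
    qed
    from DERIV_cmult[OF DERIV_power[OF this, of ?d], of "unit_ball_vol ?d"]
    have "((\<lambda>r. unit_ball_vol ?d * (r / ?s r) ^ ?d) has_real_derivative
       unit_ball_vol ?d * (?d * ((1 / ?s r ^ 3) * (r / ?s r) ^ (?d - Suc 0)))) (at r)" by simp
    moreover have "unit_ball_vol ?d * (?d * ((1 / ?s r ^ 3) * (r / ?s r) ^ (?d - Suc 0))) =
        unit_ball_vol ?d * ?d * r ^ (?d - 1) / ?s r ^ (?d + 2)"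
    proof -
      have "?d + 2 = 3 + (?d - Suc 0)" using DIM_positive[where 'a='a] by linarith
      then have "?s r ^ (?d + 2) = ?s r ^ 3 * ?s r ^ (?d - Suc 0)" by (simp only: power_add)
      then show ?thesis by (simp add: power_divide)
    qed
    ultimately show "((\<lambda>r. unit_ball_vol ?d * (r / ?s r) ^ ?d) has_real_derivative
        unit_ball_vol ?d * ?d * r ^ (?d - 1) / ?s r ^ (?d + 2)) (at r)" by simp
  qed (use pos in auto)
  finally have *: "(\<integral>\<^sup>+w. ennreal (1 / (reg_dist 1 0 (w::'a)) ^ (?d + 2)) \<partial>lborel) = ennreal (unit_ball_vol ?d)"
    by (simp add: power_0_left)
  have m: "(\<lambda>w::'a. 1 / (reg_dist 1 0 w) ^ (?d + 2)) \<in> borel_measurable lborel"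
    unfolding reg_dist_def by measurable
  have nn: "AE w::'a in lborel. 0 \<le> 1 / (reg_dist 1 0 w) ^ (?d + 2)"
    by (rule AE_I2) (simp add: reg_dist_pos less_imp_le)
  show "integrable lborel (\<lambda>w::'a. 1 / (reg_dist 1 0 w) ^ (?d + 2))"
    by (rule integrableI_nonneg[OF m nn]) (use * in simp)
  show "(LINT w|lborel. 1 / (reg_dist 1 0 (w::'a)) ^ (?d + 2)) = unit_ball_vol ?d"
    by (rule integral_eq_nn_integral[OF m nn, unfolded *, THEN trans]) simp
qed

section \<open>Radial functions in \<^const>\<open>H2\<close>\<close>

text \<open>First and second partial derivatives of a function of the regularised distance, in terms of
  the derivatives of the profile. For \<^term>\<open>\<epsilon> = 0\<close> they are the derivatives of the radial
  function itself, away from its centre.\<close>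

definition radial1 :: "(real \<Rightarrow> complex) \<Rightarrow> real \<Rightarrow> 'a::euclidean_space \<Rightarrow> 'a \<Rightarrow> 'a \<Rightarrow> complex" where
  "radial1 F1 \<epsilon> y i x = of_real (((x - y) \<bullet> i) / reg_dist \<epsilon> y x) * F1 (reg_dist \<epsilon> y x)"

definition radial2 :: "(real \<Rightarrow> complex) \<Rightarrow> (real \<Rightarrow> complex) \<Rightarrow> real \<Rightarrow> 'a::euclidean_space \<Rightarrow> 'a \<Rightarrow> 'a \<Rightarrow> 'a \<Rightarrow> complex" where
  "radial2 F1 F2 \<epsilon> y i j x =
     of_real (((x - y) \<bullet> i) * ((x - y) \<bullet> j) / (reg_dist \<epsilon> y x)\<^sup>2) * F2 (reg_dist \<epsilon> y x) +
     of_real ((j \<bullet> i) / reg_dist \<epsilon> y x - ((x - y) \<bullet> i) * ((x - y) \<bullet> j) / (reg_dist \<epsilon> y x) ^ 3) * F1 (reg_dist \<epsilon> y x)"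

lemma radial_has_derivative:
  assumes "\<epsilon> > 0" "\<And>s. s > 0 \<Longrightarrow> (F has_vector_derivative F1 s) (at s)"
  shows "((\<lambda>x. F (reg_dist \<epsilon> y x)) has_derivative (\<lambda>h. radial1 F1 \<epsilon> y h x)) (at x)"
proof -
  have "((\<lambda>x. F (reg_dist \<epsilon> y x)) has_derivative (\<lambda>h. (((x - y) \<bullet> h) / reg_dist \<epsilon> y x) *\<^sub>R F1 (reg_dist \<epsilon> y x))) (at x)"
    using has_derivative_compose[OF reg_dist_has_derivative[OF assms(1)] assms(2)[OF reg_dist_pos[OF assms(1)], unfolded has_vector_derivative_def]] .
  then show ?thesis unfolding radial1_def scaleR_conv_of_real .
qed

lemma radial1_has_derivative:
  assumes "\<epsilon> > 0" "\<And>s. s > 0 \<Longrightarrow> (F1 has_vector_derivative F2 s) (at s)"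
  shows "(radial1 F1 \<epsilon> y i has_derivative (\<lambda>h. radial2 F1 F2 \<epsilon> y i h x)) (at x)"
proof -
  let ?s = "reg_dist \<epsilon> y"
  have s: "?s x > 0" by (rule reg_dist_pos[OF assms(1)])
  have "((\<lambda>x. ((x - y) \<bullet> i) / ?s x) has_derivative
     (\<lambda>h. (h \<bullet> i) / ?s x - ((x - y) \<bullet> i) * ((x - y) \<bullet> h) / (?s x) ^ 3)) (at x)"
  proof -
    have "((\<lambda>x. (x - y) \<bullet> i) has_derivative (\<lambda>h. h \<bullet> i)) (at x)" by (auto intro!: derivative_eq_intros)
    from has_derivative_divide'[OF this reg_dist_has_derivative[OF assms(1)]]
    have "((\<lambda>x. ((x - y) \<bullet> i) / ?s x) has_derivative
       (\<lambda>h. ((h \<bullet> i) * ?s x - ((x - y) \<bullet> i) * (((x - y) \<bullet> h) / ?s x)) / (?s x * ?s x))) (at x)" using s by simp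
    moreover have "(\<lambda>h. ((h \<bullet> i) * ?s x - ((x - y) \<bullet> i) * (((x - y) \<bullet> h) / ?s x)) / (?s x * ?s x)) =
       (\<lambda>h. (h \<bullet> i) / ?s x - ((x - y) \<bullet> i) * ((x - y) \<bullet> h) / (?s x) ^ 3)"
      using s by (auto simp: field_simps power3_eq_cube)
    ultimately show ?thesis by simp
  qed
  from has_derivative_mult[OF has_derivative_of_real[OF this] radial_has_derivative[OF assms]]
  show ?thesis
    unfolding radial1_def radial2_def
    by (rule has_derivative_eq_rhs) (use s in \<open>auto simp: fun_eq_iff field_simps power2_eq_square\<close>)
qed

lemma radial1_bound:
  assumes "i \<in> Basis"
  shows "norm (radial1 F1 \<epsilon> y i x) \<le> norm (F1 (reg_dist \<epsilon> y x))"
proof -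
  have "\<bar>(x - y) \<bullet> i\<bar> \<le> reg_dist \<epsilon> y x"
    using Basis_le_norm[OF assms, of "x - y"] reg_dist_ge(1)[of x y \<epsilon>] by linarith
  then have "\<bar>((x - y) \<bullet> i) / reg_dist \<epsilon> y x\<bar> \<le> 1"
    by (simp add: abs_divide divide_le_eq_1) (smt (verit))
  then show ?thesis unfolding radial1_def norm_mult norm_of_real by (intro mult_left_le_one_le) auto
qed

lemma radial2_bound:
  assumes i: "i \<in> Basis" and j: "j \<in> Basis" and pos: "reg_dist \<epsilon> y x > 0"
  shows "norm (radial2 F1 F2 \<epsilon> y i j x) \<le> norm (F2 (reg_dist \<epsilon> y x)) + 2 * norm (F1 (reg_dist \<epsilon> y x)) / reg_dist \<epsilon> y x"
proof -
  let ?s = "reg_dist \<epsilon> y x"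
  have le: "\<bar>(x - y) \<bullet> i\<bar> \<le> ?s" if "i \<in> Basis" for i
    using Basis_le_norm[OF that, of "x - y"] reg_dist_ge(1)[of x y \<epsilon>] by linarith
  have prod: "\<bar>((x - y) \<bullet> i) * ((x - y) \<bullet> j)\<bar> \<le> ?s * ?s"
    unfolding abs_mult by (intro mult_mono le i j) (use pos in auto)
  have 1: "\<bar>((x - y) \<bullet> i) * ((x - y) \<bullet> j) / ?s\<^sup>2\<bar> \<le> 1"
    using prod pos by (simp add: abs_divide power2_eq_square)
  have "\<bar>((x - y) \<bullet> i) * ((x - y) \<bullet> j) / ?s ^ 3\<bar> \<le> 1 / ?s"
  proof -
    have "\<bar>((x - y) \<bullet> i) * ((x - y) \<bullet> j)\<bar> / ?s ^ 3 \<le> ?s * ?s / ?s ^ 3"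
      using prod pos by (intro divide_right_mono) auto
    also have "\<dots> = 1 / ?s" using pos by (simp add: power3_eq_cube)
    finally show ?thesis using pos by (simp add: abs_divide)
  qed
  moreover have "\<bar>(j \<bullet> i) / ?s\<bar> \<le> 1 / ?s"
    using i j pos by (auto simp: abs_divide inner_Basis)
  ultimately have 2: "\<bar>(j \<bullet> i) / ?s - ((x - y) \<bullet> i) * ((x - y) \<bullet> j) / ?s ^ 3\<bar> \<le> 2 / ?s"
    by linarith
  have "norm (radial2 F1 F2 \<epsilon> y i j x) \<le> 1 * norm (F2 ?s) + 2 / ?s * norm (F1 ?s)"
    unfolding radial2_def
    by (rule order_trans[OF norm_triangle_ineq], unfold norm_mult norm_of_real) (intro add_mono mult_right_mono 1 2 norm_ge_zero)
  then show ?thesis by simp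
qed

text \<open>The Laplacian of a radial function, and the error caused by the regularisation, which is
  concentrated near the centre.\<close>

lemma radial2_trace:
  fixes x y :: "'a::euclidean_space"
  assumes pos: "reg_dist \<epsilon> y x > 0"
  defines "s \<equiv> reg_dist \<epsilon> y x"
  shows "(\<Sum>i\<in>Basis. radial2 F1 F2 \<epsilon> y i i x) =
    F2 s + of_nat (DIM('a) - 1) * F1 s / of_real s - of_real (\<epsilon>\<^sup>2 / s\<^sup>2) * (F2 s - F1 s / of_real s)"
proof -
  have r: "(\<Sum>i\<in>Basis. ((x - y) \<bullet> i) * ((x - y) \<bullet> i)) = s\<^sup>2 - \<epsilon>\<^sup>2"
    unfolding s_def reg_dist_sq by (simp add: euclidean_inner[symmetric] dot_square_norm)
  have "radial2 F1 F2 \<epsilon> y i i x = complex_of_real (((x - y) \<bullet> i) * ((x - y) \<bullet> i)) *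
      (F2 s / (of_real s)\<^sup>2 - F1 s / (of_real s) ^ 3) + F1 s / of_real s" if "i \<in> Basis" for i
    unfolding radial2_def s_def[symmetric] using that
    by (simp add: inner_same_Basis field_simps del: inner_diff_left)
  then have "(\<Sum>i\<in>Basis. radial2 F1 F2 \<epsilon> y i i x) =
     (\<Sum>i\<in>Basis. complex_of_real (((x - y) \<bullet> i) * ((x - y) \<bullet> i))) * (F2 s / (of_real s)\<^sup>2 - F1 s / (of_real s) ^ 3)
     + of_nat DIM('a) * (F1 s / of_real s)"
    by (simp add: sum.distrib sum_distrib_right del: of_real_mult)
  also have "\<dots> = of_real (s\<^sup>2 - \<epsilon>\<^sup>2) * (F2 s / (of_real s)\<^sup>2 - F1 s / (of_real s) ^ 3) + of_nat DIM('a) * (F1 s / of_real s)"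
    unfolding r[symmetric] by simp
  also have "\<dots> = F2 s + of_nat (DIM('a) - 1) * F1 s / of_real s - of_real (\<epsilon>\<^sup>2 / s\<^sup>2) * (F2 s - F1 s / of_real s)"
  proof -
    have "complex_of_real s \<noteq> 0" using pos s_def by simp
    moreover have "(of_nat DIM('a) :: complex) = of_nat (DIM('a) - 1) + 1"
      using DIM_positive[where 'a='a] by (simp add: of_nat_diff Suc_leI)
    ultimately show ?thesis
      by (simp add: field_simps power2_eq_square power3_eq_cube)
  qed
  finally show ?thesis .
qed

lemma reg_dist_0: "reg_dist 0 y x = norm (x - y)"
  by (simp add: reg_dist_def norm_eq_sqrt_inner)

text \<open>The regularisation parameters along which limits are taken.\<close>

definition eps :: "nat \<Rightarrow> real" where "eps n = 1 / real (Suc n)"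

lemma eps: "eps n > 0" "eps n \<le> 1" "eps \<longlonglongrightarrow> 0"
proof -
  show "eps \<longlonglongrightarrow> 0" unfolding eps_def by real_asymp
qed (auto simp: eps_def)

lemma reg_dist_eps_tendsto: "(\<lambda>n. reg_dist (eps n) y x) \<longlonglongrightarrow> norm (x - y)"
proof -
  have "(\<lambda>n. sqrt ((x - y) \<bullet> (x - y) + (eps n)\<^sup>2)) \<longlonglongrightarrow> sqrt ((x - y) \<bullet> (x - y) + 0\<^sup>2)"
    by (intro tendsto_intros eps)
  then show ?thesis by (simp add: reg_dist_def norm_eq_sqrt_inner)
qed

lemma borel_measurable_continuous_off_point:
  fixes f :: "'a::euclidean_space \<Rightarrow> complex"
  assumes "continuous_on (- {y}) f"
  shows "f \<in> borel_measurable borel"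
proof -
  have [measurable]: "(\<lambda>x. indicator (- {y}) x *\<^sub>R f x) \<in> borel_measurable borel"
    using assms by (intro borel_measurable_continuous_on_indicator) auto
  have "f = (\<lambda>x. indicator (- {y}) x *\<^sub>R f x + indicator {y} x *\<^sub>R f y)"
    by (auto simp: fun_eq_iff split: split_indicator)
  also have "\<dots> \<in> borel_measurable borel" by measurable
  finally show ?thesis .
qed

lemma continuous_on_profile:
  assumes "\<And>s. s > 0 \<Longrightarrow> (F has_vector_derivative F1 s) (at s)"
  shows "continuous_on {0<..} F"
  using has_vector_derivative_continuous[OF assms] by (auto intro!: continuous_at_imp_continuous_on)

lemma continuous_profile:
  fixes F :: "real \<Rightarrow> complex" and y :: "'a::euclidean_space"
  assumes "continuous_on {0<..} F"
  shows "\<epsilon> > 0 \<Longrightarrow> continuous_on UNIV (\<lambda>x. F (reg_dist \<epsilon> y x))"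
    and "continuous_on (- {y}) (\<lambda>x. F (norm (x - y)))"
    and "s > 0 \<Longrightarrow> isCont F s"
proof -
  show "s > 0 \<Longrightarrow> isCont F s"
    using assms by (simp add: continuous_on_eq_continuous_at)
  show "continuous_on (- {y}) (\<lambda>x. F (norm (x - y)))"
    by (rule continuous_on_compose2[OF assms]) (auto intro!: continuous_intros)
  show "continuous_on UNIV (\<lambda>x. F (reg_dist \<epsilon> y x))" if "\<epsilon> > 0"
    by (rule continuous_on_compose2[OF assms])
      (use reg_dist_pos[OF that] in \<open>auto simp: reg_dist_def intro!: continuous_intros\<close>)
qed

lemma continuous_reg_dist: "continuous_on S (reg_dist \<epsilon> y)"
  unfolding reg_dist_def by (intro continuous_intros)

text \<open>The bound on \<open>F1 s / s\<close> controls the angular part of the second derivatives. The bounds decrease in \<open>s\<close> and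
  the regularised distance exceeds the distance, so one square-integrable function dominates
  all regularisations.\<close>

theorem radial_H2:
  fixes y :: "'a::euclidean_space"
  assumes dF: "\<And>s. s > 0 \<Longrightarrow> (F has_vector_derivative F1 s) (at s)"
    and dF1: "\<And>s. s > 0 \<Longrightarrow> (F1 has_vector_derivative F2 s) (at s)"
    and contF2: "continuous_on {0<..} F2" and c: "c > 0" and m: "2 * m < DIM('a)"
    and bF: "\<And>s. s > 0 \<Longrightarrow> norm (F s) \<le> K * decay m c s"
      "\<And>s. s > 0 \<Longrightarrow> norm (F1 s) \<le> K * decay m c s"
      "\<And>s. s > 0 \<Longrightarrow> norm (F2 s) \<le> K * decay m c s"
      "\<And>s. s > 0 \<Longrightarrow> norm (F1 s) / s \<le> K * decay m c s"
  shows "(\<lambda>x. F (norm (x - y))) \<in> H2"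
    and "AE x in lborel. laplacian (\<lambda>x. F (norm (x - y))) x =
      F2 (norm (x - y)) + of_nat (DIM('a) - 1) * F1 (norm (x - y)) / of_real (norm (x - y))"
proof -
  define w where "w x = complex_of_real ((3 * K) * decay m c (norm (x - y)))" for x
  have w: "w \<in> L2" unfolding w_def by (rule decay_L2[OF c m])
  have K: "K \<ge> 0" by (rule decay_bound_nonneg[OF bF(1)[of 1]]) auto
  let ?s = "\<lambda>n. reg_dist (eps n) y"
  have pos: "?s n x > 0" for n x by (rule reg_dist_pos[OF eps(1)])
  have nw: "norm (w x) = 3 * (K * decay m c (norm (x - y)))" for x
    unfolding w_def norm_of_real using K by (simp add: decay_nonneg abs_mult)
  have dec: "3 * (K * decay m c (?s n x)) \<le> norm (w x)" "0 \<le> K * decay m c (?s n x)" if "x \<noteq> y" for n x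
    unfolding nw using that K c reg_dist_ge(1)[of x y "eps n"] pos[of n x]
    by (auto intro!: mult_left_mono decay_mono mult_nonneg_nonneg decay_nonneg)
  note contF = continuous_on_profile[OF dF] and contF1 = continuous_on_profile[OF dF1]
  have lim: "(\<lambda>n. H (?s n x)) \<longlonglongrightarrow> H (norm (x - y))"
    if "continuous_on {0<..} H" "x \<noteq> y" for H :: "real \<Rightarrow> complex" and x
    by (rule isCont_tendsto_compose[OF continuous_profile(3)[OF that(1)] reg_dist_eps_tendsto]) (use that in auto)
  have bnd1: "AE x in lborel. norm (radial1 F1 (eps n) y i x) \<le> norm (w x)" if i: "i \<in> Basis" for n i
  proof (rule AE_off_point[where y=y])
    fix x assume "x \<noteq> y"
    then show "norm (radial1 F1 (eps n) y i x) \<le> norm (w x)"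
      using radial1_bound[OF i, of F1 "eps n" y x] bF(2)[OF pos, of n x] dec[of x n] by linarith
  qed
  have lim1: "AE x in lborel. (\<lambda>n. radial1 F1 (eps n) y i x) \<longlonglongrightarrow> radial1 F1 0 y i x" for i
    unfolding radial1_def reg_dist_0
    by (rule AE_off_point[where y=y]) (intro tendsto_intros lim contF1 reg_dist_eps_tendsto; simp)
  have meas1: "radial1 F1 0 y i \<in> borel_measurable borel" for i
    unfolding radial1_def reg_dist_0
    by (rule borel_measurable_continuous_off_point[where y=y])
      (intro continuous_intros continuous_profile(2)[OF contF1], auto)
  have wd1: "has_weak_deriv i (\<lambda>x. F (norm (x - y))) (radial1 F1 0 y i)" if i: "i \<in> Basis" for i
  proof (rule has_weak_deriv_limit[where un="\<lambda>n x. F (?s n x)" and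
        dun="\<lambda>n x h. radial1 F1 (eps n) y h x" and w=w, OF _ _ i w _ bnd1[OF i] _ lim1 _ meas1])
    show "((\<lambda>x. F (?s n x)) has_derivative (\<lambda>h. radial1 F1 (eps n) y h x)) (at x)" for n x
      by (rule radial_has_derivative[OF eps(1) dF])
    show "continuous_on UNIV (\<lambda>x. radial1 F1 (eps n) y i x)" for n
      using has_derivative_continuous[OF radial1_has_derivative[OF eps(1) dF1]]
      by (auto intro!: continuous_at_imp_continuous_on)
    show "AE x in lborel. norm (F (?s n x)) \<le> norm (w x)" for n
    proof (rule AE_off_point[where y=y])
      fix x assume "x \<noteq> y"
      then show "norm (F (?s n x)) \<le> norm (w x)" using bF(1)[OF pos, of n x] dec[of x n] by linarith
    qed
    show "AE x in lborel. (\<lambda>n. F (?s n x)) \<longlonglongrightarrow> F (norm (x - y))"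
      by (rule AE_off_point[where y=y]) (rule lim[OF contF])
    show "(\<lambda>x. F (norm (x - y))) \<in> borel_measurable borel"
      by (rule borel_measurable_continuous_off_point[OF continuous_profile(2)[OF contF]])
  qed
  have wd2: "has_weak_deriv j (radial1 F1 0 y i) (radial2 F1 F2 0 y i j)" if i: "i \<in> Basis" and j: "j \<in> Basis" for i j
  proof (rule has_weak_deriv_limit[where un="\<lambda>n. radial1 F1 (eps n) y i" and
        dun="\<lambda>n x h. radial2 F1 F2 (eps n) y i h x" and w=w, OF _ _ j w bnd1[OF i] _ lim1 _ meas1])
    show "(radial1 F1 (eps n) y i has_derivative (\<lambda>h. radial2 F1 F2 (eps n) y i h x)) (at x)" for n x
      by (rule radial1_has_derivative[OF eps(1) dF1])
    have "?s n x \<noteq> 0" for n x using pos[of n x] by simp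
    then show "continuous_on UNIV (\<lambda>x. radial2 F1 F2 (eps n) y i j x)" for n
      unfolding radial2_def
      by (intro continuous_intros continuous_profile(1)[OF contF1 eps(1)] continuous_profile(1)[OF contF2 eps(1)]
          continuous_reg_dist) auto
    show "AE x in lborel. norm (radial2 F1 F2 (eps n) y i j x) \<le> norm (w x)" for n
    proof (rule AE_off_point[where y=y])
      fix x assume "x \<noteq> y"
      then show "norm (radial2 F1 F2 (eps n) y i j x) \<le> norm (w x)"
        using radial2_bound[OF i j pos, of F1 F2 n x] bF(3)[OF pos, of n x] bF(4)[OF pos, of n x] dec[of x n] by linarith
    qed
    show "AE x in lborel. (\<lambda>n. radial2 F1 F2 (eps n) y i j x) \<longlonglongrightarrow> radial2 F1 F2 0 y i j x"
      unfolding radial2_def reg_dist_0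
      by (rule AE_off_point[where y=y]) (intro tendsto_intros lim contF1 contF2 reg_dist_eps_tendsto; simp)
    show "radial2 F1 F2 0 y i j \<in> borel_measurable borel"
      unfolding radial2_def reg_dist_0
      by (rule borel_measurable_continuous_off_point[where y=y])
        (intro continuous_intros continuous_profile(2)[OF contF1] continuous_profile(2)[OF contF2], auto)
  qed
  show "(\<lambda>x. F (norm (x - y))) \<in> H2" by (rule H2_I(1)[OF wd1 wd2])
  have "AE x in lborel. laplacian (\<lambda>x. F (norm (x - y))) x = (\<Sum>i\<in>Basis. radial2 F1 F2 0 y i i x)"
    by (rule H2_I(2)[OF wd1 wd2])
  then show "AE x in lborel. laplacian (\<lambda>x. F (norm (x - y))) x =
      F2 (norm (x - y)) + of_nat (DIM('a) - 1) * F1 (norm (x - y)) / of_real (norm (x - y))"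
    using AE_lborel_singleton[of y]
  proof eventually_elim
    case (elim x)
    then show ?case using radial2_trace[of 0 y x F1 F2] by (simp add: reg_dist_0)
  qed
qed

section \<open>Approximate identities\<close>

lemma integral_affine:
  fixes F :: "'a::euclidean_space \<Rightarrow> complex"
  assumes [measurable]: "F \<in> borel_measurable borel" and c: "c > 0"
  shows "(LINT x|lborel. F x) = of_real (c ^ DIM('a)) * (LINT w|lborel. F (y + c *\<^sub>R w))"
proof -
  have "(LINT x|lborel. F x) = (LINT x|density (distr lborel borel (\<lambda>x. y + c *\<^sub>R x)) (\<lambda>_. \<bar>c\<bar> ^ DIM('a)). F x)"
    using lborel_affine[of c y] c by simp
  also have "\<dots> = (LINT x|distr lborel borel (\<lambda>x. y + c *\<^sub>R x). (c ^ DIM('a)) *\<^sub>R F x)"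
    using c by (subst integral_density) auto
  also have "\<dots> = (LINT w|lborel. (c ^ DIM('a)) *\<^sub>R F (y + c *\<^sub>R w))"
    by (subst integral_distr) auto
  finally show ?thesis by (simp add: scaleR_conv_of_real)
qed

lemma indicator_cball_L2: "(\<lambda>x::'a::euclidean_space. complex_of_real (B * indicator (cball 0 R) x)) \<in> L2"
proof -
  have "(norm (complex_of_real (B * indicator (cball 0 R) x)))\<^sup>2 = B\<^sup>2 * indicator (cball 0 R) x" for x :: 'a
    by (auto split: split_indicator simp: norm_mult power_mult_distrib)
  moreover have "(\<lambda>x::'a. complex_of_real (B * indicator (cball 0 R) x)) \<in> borel_measurable lborel"
  proof -
    have [measurable]: "indicat_real (cball (0::'a) R) \<in> borel_measurable borel"
      by (rule borel_measurable_indicator) simp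
    show ?thesis by measurable
  qed
  ultimately show ?thesis unfolding L2_def using integrable_indicator_cball[of "B\<^sup>2" R] by (simp only: mem_Collect_eq)
qed

text \<open>Only weak convergence is claimed: pairing with a test function moves the small translation
  from \<^term>\<open>\<phi>\<close> to the continuous function \<^term>\<open>\<eta>\<close>.\<close>

lemma approximate_identity:
  fixes \<phi> \<eta> :: "'a::euclidean_space \<Rightarrow> complex" and \<kappa> :: "nat \<Rightarrow> 'a \<Rightarrow> complex"
  assumes \<phi>: "\<phi> \<in> L2" and \<eta>: "\<eta> \<in> test_functions"
    and \<kappa>[measurable]: "\<And>n. \<kappa> n \<in> borel_measurable borel" "\<kappa>0 \<in> borel_measurable borel"
    and k: "integrable lborel k" "\<And>n w. norm (\<kappa> n w) \<le> k w" and lim: "\<And>w. (\<lambda>n. \<kappa> n w) \<longlonglongrightarrow> \<kappa>0 w"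
  shows "(\<lambda>n. LINT y|lborel. (LINT w|lborel. \<phi> (y + eps n *\<^sub>R w) * \<kappa> n w) * \<eta> y) \<longlonglongrightarrow>
    (LINT w|lborel. \<kappa>0 w) * (LINT y|lborel. \<phi> y * \<eta> y)"
proof -
  have [measurable]: "\<phi> \<in> borel_measurable borel" "\<eta> \<in> borel_measurable borel"
    using \<phi> test_function_L2[OF \<eta>] by (auto intro: L2_borel)
  have [measurable]: "k \<in> borel_measurable borel" using borel_measurable_integrable[OF k(1)] by simp
  note \<eta>2 = test_function_L2(1)[OF \<eta>]
  define h where "h t = (LINT y|lborel. \<phi> (y + t) * \<eta> y)" for t
  have tr: "(\<lambda>y. \<phi> (y + t)) \<in> L2" "l2_norm (\<lambda>y. \<phi> (y + t)) = l2_norm \<phi>" for t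
    using L2_translate[OF \<phi>, of t] by (simp_all add: add.commute)
  have h_bound: "norm (h t) \<le> l2_norm \<phi> * l2_norm \<eta>" for t
    using L2_Cauchy_Schwarz[OF tr(1) \<eta>2, of t] by (simp add: h_def tr)
  have swap: "(LINT y|lborel. (LINT w|lborel. \<phi> (y + eps n *\<^sub>R w) * \<kappa> n w) * \<eta> y) =
      (LINT w|lborel. \<kappa> n w * h (eps n *\<^sub>R w))" for n
  proof -
    define f where "f w y = \<kappa> n w * (\<phi> (y + eps n *\<^sub>R w) * \<eta> y)" for w y
    have "integrable (lborel \<Otimes>\<^sub>M lborel) (\<lambda>(w, y). f w y)"
    proof (rule lborel_pair.Fubini_integrable)
      show "(\<lambda>(w, y). f w y) \<in> borel_measurable (lborel \<Otimes>\<^sub>M lborel)" unfolding f_def by measurable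
      have bnd: "norm (LINT y|lborel. norm (f w y)) \<le> norm (k w * (l2_norm \<phi> * l2_norm \<eta>))" for w
      proof -
        have "(LINT y|lborel. norm (f w y)) = norm (\<kappa> n w) * (LINT y|lborel. norm (\<phi> (y + eps n *\<^sub>R w) * \<eta> y))"
          unfolding f_def norm_mult[of "\<kappa> n w"] by simp
        also have "\<dots> \<le> k w * (l2_norm \<phi> * l2_norm \<eta>)"
          using L2_Cauchy_Schwarz_norm[OF tr(1) \<eta>2, of "eps n *\<^sub>R w"] k(2)[of n w] order_trans[OF norm_ge_zero k(2)]
          by (intro mult_mono) (auto simp: tr)
        finally show ?thesis by (simp add: integral_nonneg_AE)
      qed
      have int: "integrable lborel (\<lambda>w. k w * (l2_norm \<phi> * l2_norm \<eta>))" using k(1) by simp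
      have meas: "(\<lambda>w. LINT y|lborel. norm (f w y)) \<in> borel_measurable lborel" unfolding f_def by measurable
      from Bochner_Integration.integrable_bound[OF int meas AE_I2[OF bnd]]
      show "integrable lborel (\<lambda>w. LINT y|lborel. norm (case (w, y) of (w, y) \<Rightarrow> f w y))"
        by simp
      show "AE w in lborel. integrable lborel (\<lambda>y. case (w, y) of (w, y) \<Rightarrow> f w y)"
        unfolding f_def by (auto intro!: integrable_mult_right L2_mult_integrable tr \<eta>2)
    qed
    from lborel_pair.Fubini_integral[OF this]
    have "(LINT y|lborel. LINT w|lborel. f w y) = (LINT w|lborel. LINT y|lborel. f w y)" .
    moreover have "(LINT w|lborel. \<phi> (y + eps n *\<^sub>R w) * \<kappa> n w) * \<eta> y = (LINT w|lborel. f w y)" for y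
      unfolding f_def by (subst integral_mult_left_zero[symmetric]) (simp add: mult_ac)
    moreover have "(LINT y|lborel. f w y) = \<kappa> n w * h (eps n *\<^sub>R w)" for w
      unfolding f_def h_def by simp
    ultimately show ?thesis by simp
  qed
  have h_lim: "(\<lambda>n. h (eps n *\<^sub>R w)) \<longlonglongrightarrow> (LINT y|lborel. \<phi> y * \<eta> y)" for w
  proof -
    obtain R where R: "R > 0" "\<And>x. \<eta> x \<noteq> 0 \<Longrightarrow> norm x \<le> R" using test_function_support[OF \<eta>] by blast
    note c\<eta> = smooth_continuous[OF test_function_smooth[OF \<eta>]]
    obtain B where B: "B > 0" "\<And>x. norm (\<eta> x) \<le> B * indicator (cball 0 R) x"
      using compact_support_bounded[OF c\<eta> R(2)] by blast
    have eq: "h t = (LINT x|lborel. \<phi> x * \<eta> (x - t))" for t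
      using integral_translate[of "\<lambda>x. \<phi> x * \<eta> (x - t)" t] by (simp add: h_def add.commute)
    let ?b = "\<lambda>x. norm (\<phi> x * complex_of_real (B * indicator (cball 0 (R + norm w)) x))"
    have "(\<lambda>n. LINT x|lborel. \<phi> x * \<eta> (x - eps n *\<^sub>R w)) \<longlonglongrightarrow> (LINT x|lborel. \<phi> x * \<eta> x)"
    proof (rule integral_dominated_convergence[where w="?b"])
      show "integrable lborel ?b" by (intro integrable_norm L2_mult_integrable \<phi> indicator_cball_L2)
      show "AE x in lborel. (\<lambda>n. \<phi> x * \<eta> (x - eps n *\<^sub>R w)) \<longlonglongrightarrow> \<phi> x * \<eta> x"
      proof (rule AE_I2, rule tendsto_mult[OF tendsto_const])
        fix x
        have "isCont \<eta> x" using c\<eta> by (simp add: continuous_on_eq_continuous_at)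
        moreover have "(\<lambda>n. x - eps n *\<^sub>R w) \<longlonglongrightarrow> x - 0 *\<^sub>R w" by (intro tendsto_intros eps)
        ultimately show "(\<lambda>n. \<eta> (x - eps n *\<^sub>R w)) \<longlonglongrightarrow> \<eta> x"
          using isCont_tendsto_compose by fastforce
      qed
      fix n
      have "norm (\<eta> (x - eps n *\<^sub>R w)) \<le> norm (complex_of_real (B * indicator (cball 0 (R + norm w)) x))" for x
      proof (cases "norm x \<le> R + norm w")
        case True
        have "norm (\<eta> (x - eps n *\<^sub>R w)) \<le> B * 1"
          by (rule order_trans[OF B(2)]) (use B(1) in \<open>auto split: split_indicator\<close>)
        then show ?thesis using True B(1) by simp
      next
        case False
        have "norm (eps n *\<^sub>R w) \<le> norm w" using eps(1,2)[of n] by (simp add: mult_left_le_one_le)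
        then have "\<not> norm (x - eps n *\<^sub>R w) \<le> R"
          using False norm_triangle_ineq2[of x "eps n *\<^sub>R w"] by linarith
        then have "\<eta> (x - eps n *\<^sub>R w) = 0" using R(2) by blast
        then show ?thesis by simp
      qed
      then show "AE x in lborel. norm (\<phi> x * \<eta> (x - eps n *\<^sub>R w)) \<le> ?b x"
        by (auto simp only: norm_mult intro!: AE_I2 mult_left_mono norm_ge_zero)
    qed auto
    then show ?thesis by (simp add: eq)
  qed
  have "(\<lambda>n. LINT w|lborel. \<kappa> n w * h (eps n *\<^sub>R w)) \<longlonglongrightarrow> (LINT w|lborel. \<kappa>0 w * (LINT y|lborel. \<phi> y * \<eta> y))"
  proof (rule integral_dominated_convergence[where w="\<lambda>w. k w * (l2_norm \<phi> * l2_norm \<eta>)"])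
    show "(\<lambda>w. \<kappa> n w * h (eps n *\<^sub>R w)) \<in> borel_measurable lborel" for n unfolding h_def by measurable
    show "integrable lborel (\<lambda>w. k w * (l2_norm \<phi> * l2_norm \<eta>))" using k(1) by simp
    show "AE w in lborel. (\<lambda>n. \<kappa> n w * h (eps n *\<^sub>R w)) \<longlonglongrightarrow> \<kappa>0 w * (LINT y|lborel. \<phi> y * \<eta> y)"
      by (intro AE_I2 tendsto_mult lim h_lim)
    show "AE w in lborel. norm (\<kappa> n w * h (eps n *\<^sub>R w)) \<le> k w * (l2_norm \<phi> * l2_norm \<eta>)" for n
      unfolding norm_mult using order_trans[OF norm_ge_zero k(2)] by (intro AE_I2 mult_mono k h_bound) auto
  qed auto
  then show ?thesis unfolding swap by simp
qed

section \<open>The resolvent kernel of the Laplacian\<close>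

text \<open>The function \<open>g0 \<mu>\<close> is the profile of the fundamental solution of \<open>\<mu>\<^sup>2 - \<Delta>\<close>, and \<open>g1 \<mu>\<close>, \<open>g2 \<mu>\<close>
  are its first two derivatives. The condition \<open>point_mass\<close> fixes the normalisation: the regularised
  kernel satisfies the Helmholtz equation up to a bump whose total mass tends to one. One kernel alone
  need not lie in \<^const>\<open>H2\<close>, but by \<open>diff_bound1\<close> the singularities of two kernels cancel to the order that
  makes their difference a member of \<^const>\<open>H2\<close>, with the value \<open>u0 \<mu> \<nu>\<close> at the centre.\<close>

locale helmholtz_kernel =
  fixes T :: "'a::euclidean_space itself"
    and g0 g1 g2 :: "complex \<Rightarrow> real \<Rightarrow> complex" and m :: nat and u0 :: "complex \<Rightarrow> complex \<Rightarrow> complex"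
  assumes m: "2 * m < DIM('a)"
    and deriv0: "\<And>\<mu> s. Re \<mu> > 0 \<Longrightarrow> s > 0 \<Longrightarrow> (g0 \<mu> has_vector_derivative g1 \<mu> s) (at s)"
    and deriv1: "\<And>\<mu> s. Re \<mu> > 0 \<Longrightarrow> s > 0 \<Longrightarrow> (g1 \<mu> has_vector_derivative g2 \<mu> s) (at s)"
    and cont2: "\<And>\<mu>. Re \<mu> > 0 \<Longrightarrow> continuous_on {0<..} (g2 \<mu>)"
    and smooth_reg: "\<And>\<mu> \<epsilon> y. Re \<mu> > 0 \<Longrightarrow> \<epsilon> > 0 \<Longrightarrow> smooth (\<lambda>x::'a. g0 \<mu> (reg_dist \<epsilon> y x))"
    and helmholtz: "\<And>\<mu> s. Re \<mu> > 0 \<Longrightarrow> s > 0 \<Longrightarrow>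
      g2 \<mu> s + of_nat (DIM('a) - 1) * g1 \<mu> s / of_real s = \<mu>\<^sup>2 * g0 \<mu> s"
    and bound0: "\<And>\<mu>. Re \<mu> > 0 \<Longrightarrow> \<exists>K. \<forall>s>0. norm (g0 \<mu> s) \<le> K * decay m (Re \<mu>) s"
    and bound1: "\<And>\<mu>. Re \<mu> > 0 \<Longrightarrow> \<exists>K. \<forall>s>0. norm (g1 \<mu> s) \<le> K * decay (DIM('a) - 1) (Re \<mu>) s"
    and point_mass: "\<And>\<mu>. Re \<mu> > 0 \<Longrightarrow>
      ((\<lambda>t. of_real (t ^ DIM('a)) * (g2 \<mu> t - g1 \<mu> t / of_real t)) \<longlongrightarrow> of_real (1 / unit_ball_vol DIM('a))) (at_right 0)"
    and diff_bound1: "\<And>\<mu> \<nu>. Re \<mu> > 0 \<Longrightarrow> Re \<nu> > 0 \<Longrightarrow> \<exists>K. \<forall>s>0.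
      norm (g1 \<mu> s - g1 \<nu> s) \<le> K * decay m (min (Re \<mu>) (Re \<nu>)) s \<and>
      norm (g1 \<mu> s - g1 \<nu> s) / s \<le> K * decay m (min (Re \<mu>) (Re \<nu>)) s"
    and diff_limit: "\<And>\<mu> \<nu>. Re \<mu> > 0 \<Longrightarrow> Re \<nu> > 0 \<Longrightarrow> ((\<lambda>s. g0 \<mu> s - g0 \<nu> s) \<longlongrightarrow> u0 \<mu> \<nu>) (at_right 0)"
    and cnj_g0: "\<And>\<mu> s. cnj (g0 \<mu> s) = g0 (cnj \<mu>) s"
begin

text \<open>The Helmholtz equation expresses the second derivative by the profile and its first derivative, so
  bounds for these two suffice.\<close>

lemma g2_eq: "Re \<mu> > 0 \<Longrightarrow> s > 0 \<Longrightarrow> g2 \<mu> s = \<mu>\<^sup>2 * g0 \<mu> s - of_nat (DIM('a) - 1) * (g1 \<mu> s / of_real s)"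
  using helmholtz[of \<mu> s] by (simp add: algebra_simps)

lemma bound_far:
  assumes \<mu>: "Re \<mu> > 0" and \<epsilon>: "\<epsilon> > 0"
  shows "\<exists>K. \<forall>s\<ge>\<epsilon>. norm (g1 \<mu> s) \<le> K * decay m (Re \<mu>) s \<and> norm (g2 \<mu> s) \<le> K * decay m (Re \<mu>) s"
proof -
  let ?n = "DIM('a) - 1"
  obtain K0 K1 where K: "\<And>s. s > 0 \<Longrightarrow> norm (g0 \<mu> s) \<le> K0 * decay m (Re \<mu>) s"
    "\<And>s. s > 0 \<Longrightarrow> norm (g1 \<mu> s) \<le> K1 * decay ?n (Re \<mu>) s"
    using bound0[OF \<mu>] bound1[OF \<mu>] by blast
  have nn: "K0 \<ge> 0" "K1 \<ge> 0" by (rule decay_bound_nonneg[OF K(1)[of 1]] decay_bound_nonneg[OF K(2)[of 1]]; simp)+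
  define L where "L = K1 * (1 + 1 / \<epsilon> ^ ?n)"
  define K where "K = L + (norm \<mu>)\<^sup>2 * K0 + real ?n * (L / \<epsilon>)"
  have L: "L \<ge> 0" unfolding L_def using nn \<epsilon> by simp
  have "norm (g1 \<mu> s) \<le> K * decay m (Re \<mu>) s \<and> norm (g2 \<mu> s) \<le> K * decay m (Re \<mu>) s" if "s \<ge> \<epsilon>" for s
  proof -
    let ?D = "decay m (Re \<mu>) s"
    have s: "s > 0" using that \<epsilon> by linarith
    have D: "?D \<ge> 0" using s by (simp add: decay_nonneg)
    have "decay ?n (Re \<mu>) s \<le> (1 + 1 / \<epsilon> ^ ?n) * exp (- Re \<mu> * s)"
      unfolding decay_def mult.commute[of "exp _"] using that \<epsilon>
      by (intro mult_right_mono add_left_mono divide_left_mono power_mono) auto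
    also have "\<dots> \<le> (1 + 1 / \<epsilon> ^ ?n) * ?D"
      using s \<epsilon> by (intro mult_left_mono) (auto simp: decay_def distrib_left)
    finally have g1: "norm (g1 \<mu> s) \<le> L * ?D"
      using K(2)[OF s] mult_left_mono[OF _ nn(2)] unfolding L_def by (fastforce simp: mult.assoc)
    have "norm (g1 \<mu> s) / s \<le> L * ?D / \<epsilon>" using g1 that s \<epsilon> D L by (intro frac_le) auto
    then have "real ?n * (norm (g1 \<mu> s) / s) \<le> real ?n * (L / \<epsilon>) * ?D"
      using mult_left_mono[of _ _ "real ?n"] by fastforce
    moreover have "norm (g2 \<mu> s) \<le> (norm \<mu>)\<^sup>2 * norm (g0 \<mu> s) + real ?n * (norm (g1 \<mu> s) / s)"
      unfolding g2_eq[OF \<mu> s] by (rule order_trans[OF norm_triangle_ineq4]) (unfold norm_mult norm_divide norm_power norm_of_nat norm_of_real, use s in simp)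
    moreover have "(norm \<mu>)\<^sup>2 * norm (g0 \<mu> s) \<le> (norm \<mu>)\<^sup>2 * K0 * ?D"
      using mult_left_mono[OF K(1)[OF s], of "(norm \<mu>)\<^sup>2"] by (simp add: mult.assoc)
    moreover have "0 \<le> L * ?D" "0 \<le> (norm \<mu>)\<^sup>2 * K0 * ?D" "0 \<le> real ?n * (L / \<epsilon>) * ?D"
      using nn L D \<epsilon> by auto
    ultimately show ?thesis using g1 unfolding K_def distrib_right by (intro conjI; linarith)
  qed
  then show ?thesis by blast
qed

lemma point_mass_bound:
  assumes \<mu>: "Re \<mu> > 0"
  shows "\<exists>K. \<forall>t>0. norm (of_real (t ^ DIM('a)) * (g2 \<mu> t - g1 \<mu> t / of_real t)) \<le> K"
proof -
  let ?d = "DIM('a)" and ?n = "DIM('a) - 1" and ?c = "Re \<mu>"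
  obtain K0 K1 where K: "\<And>s. s > 0 \<Longrightarrow> norm (g0 \<mu> s) \<le> K0 * decay m ?c s"
    "\<And>s. s > 0 \<Longrightarrow> norm (g1 \<mu> s) \<le> K1 * decay ?n ?c s"
    using bound0[OF \<mu>] bound1[OF \<mu>] by blast
  have nn: "K0 \<ge> 0" "K1 \<ge> 0" by (rule decay_bound_nonneg[OF K(1)[of 1]] decay_bound_nonneg[OF K(2)[of 1]]; simp)+
  define B where "B k j = real k ^ k / ?c ^ k + real (k - j) ^ (k - j) / ?c ^ (k - j)" for k j
  have B: "t ^ k * decay j ?c t \<le> B k j" if "t > 0" "j \<le> k" for t k j
  proof -
    have "t ^ k * decay j ?c t = t ^ k * exp (- ?c * t) + t ^ (k - j) * exp (- ?c * t)"
      using that by (simp add: decay_def distrib_left power_diff)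
    then show ?thesis using power_times_exp_le[OF \<mu>, of t] that(1) unfolding B_def by (simp add: add_mono)
  qed
  have dn: "?d = Suc ?n" using DIM_positive[where 'a='a] by simp
  have pow_d: "x ^ ?d = x * x ^ ?n" for x :: complex using power_Suc[of x ?n] unfolding dn[symmetric] .
  have nat_d: "complex_of_nat ?d = 1 + of_nat ?n" using of_nat_Suc[of ?n, where 'a=complex] unfolding dn[symmetric] .
  have "norm (of_real (t ^ ?d) * (g2 \<mu> t - g1 \<mu> t / of_real t)) \<le> (norm \<mu>)\<^sup>2 * (K0 * B ?d m) + real ?d * (K1 * B ?n ?n)"
    if t: "t > 0" for t
  proof -
    have "of_real (t ^ ?d) * (g2 \<mu> t - g1 \<mu> t / of_real t) =
        \<mu>\<^sup>2 * (of_real (t ^ ?d) * g0 \<mu> t) - of_nat ?d * (of_real (t ^ ?n) * g1 \<mu> t)"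
    proof -
      have "x * y * (l * a - k * (b / x) - b / x) = l * (x * y * a) - (1 + k) * (y * b)"
        if "x \<noteq> 0" for x y a b k l :: complex
        using that by (simp add: field_simps)
      then show ?thesis unfolding g2_eq[OF \<mu> t] of_real_power pow_d nat_d by this (use t in simp)
    qed
    also have "norm \<dots> \<le> (norm \<mu>)\<^sup>2 * (t ^ ?d * norm (g0 \<mu> t)) + real ?d * (t ^ ?n * norm (g1 \<mu> t))"
      by (rule order_trans[OF norm_triangle_ineq4]) (use t in \<open>simp add: norm_mult norm_power\<close>)
    also have "\<dots> \<le> (norm \<mu>)\<^sup>2 * (K0 * B ?d m) + real ?d * (K1 * B ?n ?n)"
    proof (intro add_mono mult_left_mono)
      show "t ^ ?d * norm (g0 \<mu> t) \<le> K0 * B ?d m"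
        by (rule order_trans[OF mult_left_mono[OF K(1)[OF t]]])
          (use mult_left_mono[OF B[OF t, of m ?d] nn(1)] m t in \<open>simp_all add: mult.left_commute\<close>)
      show "t ^ ?n * norm (g1 \<mu> t) \<le> K1 * B ?n ?n"
        by (rule order_trans[OF mult_left_mono[OF K(2)[OF t]]])
          (use mult_left_mono[OF B[OF t, of ?n ?n] nn(2)] t in \<open>simp_all add: mult.left_commute\<close>)
    qed auto
    finally show ?thesis .
  qed
  then show ?thesis by blast
qed

lemma diff_bound:
  assumes \<mu>: "Re \<mu> > 0" and \<nu>: "Re \<nu> > 0"
  shows "\<exists>K c. c > 0 \<and> (\<forall>s>0. norm (g0 \<mu> s - g0 \<nu> s) \<le> K * decay m c s \<and>
      norm (g1 \<mu> s - g1 \<nu> s) \<le> K * decay m c s \<and> norm (g2 \<mu> s - g2 \<nu> s) \<le> K * decay m c s \<and>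
      norm (g1 \<mu> s - g1 \<nu> s) / s \<le> K * decay m c s)"
proof -
  define c where "c = min (Re \<mu>) (Re \<nu>)"
  let ?n = "real (DIM('a) - 1)"
  obtain A B C where K: "\<And>s. s > 0 \<Longrightarrow> norm (g0 \<mu> s) \<le> A * decay m (Re \<mu>) s"
    "\<And>s. s > 0 \<Longrightarrow> norm (g0 \<nu> s) \<le> B * decay m (Re \<nu>) s"
    and C: "\<And>s. s > 0 \<Longrightarrow> norm (g1 \<mu> s - g1 \<nu> s) \<le> C * decay m c s \<and> norm (g1 \<mu> s - g1 \<nu> s) / s \<le> C * decay m c s"
    using bound0[OF \<mu>] bound0[OF \<nu>] diff_bound1[OF \<mu> \<nu>] unfolding c_def by blast
  have nn: "A \<ge> 0" "B \<ge> 0" "C \<ge> 0"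
    by (rule decay_bound_nonneg[OF K(1)[of 1]] decay_bound_nonneg[OF K(2)[of 1]]
        decay_bound_nonneg[OF conjunct1[OF C[of 1]]]; simp)+
  define K where "K = A + B + (norm \<mu>)\<^sup>2 * A + (norm \<nu>)\<^sup>2 * B + C + ?n * C"
  have "norm (g0 \<mu> s - g0 \<nu> s) \<le> K * decay m c s \<and> norm (g1 \<mu> s - g1 \<nu> s) \<le> K * decay m c s \<and>
      norm (g2 \<mu> s - g2 \<nu> s) \<le> K * decay m c s \<and> norm (g1 \<mu> s - g1 \<nu> s) / s \<le> K * decay m c s" if s: "s > 0" for s
  proof -
    let ?D = "decay m c s"
    have D: "decay m (Re \<mu>) s \<le> ?D" "decay m (Re \<nu>) s \<le> ?D" "0 \<le> ?D"
      using s by (auto intro!: decay_rate_mono decay_nonneg simp: c_def)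
    have a: "norm (g0 \<mu> s) \<le> A * ?D" and b: "norm (g0 \<nu> s) \<le> B * ?D"
      using K[OF s] mult_left_mono[OF D(1) nn(1)] mult_left_mono[OF D(2) nn(2)] by linarith+
    have a2: "(norm \<mu>)\<^sup>2 * norm (g0 \<mu> s) \<le> (norm \<mu>)\<^sup>2 * A * ?D" and b2: "(norm \<nu>)\<^sup>2 * norm (g0 \<nu> s) \<le> (norm \<nu>)\<^sup>2 * B * ?D"
      using mult_left_mono[OF a, of "(norm \<mu>)\<^sup>2"] mult_left_mono[OF b, of "(norm \<nu>)\<^sup>2"] by (simp_all add: mult.assoc)
    have c2: "?n * (norm (g1 \<mu> s - g1 \<nu> s) / s) \<le> ?n * C * ?D"
      using mult_left_mono[OF conjunct2[OF C[OF s]], of ?n] by (simp add: mult.assoc)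
    have "g2 \<mu> s - g2 \<nu> s = (\<mu>\<^sup>2 * g0 \<mu> s - \<nu>\<^sup>2 * g0 \<nu> s) - of_nat (DIM('a) - 1) * ((g1 \<mu> s - g1 \<nu> s) / of_real s)"
      unfolding g2_eq[OF \<mu> s] g2_eq[OF \<nu> s] by (simp add: algebra_simps diff_divide_distrib)
    also have "norm \<dots> \<le> (norm (\<mu>\<^sup>2 * g0 \<mu> s) + norm (\<nu>\<^sup>2 * g0 \<nu> s)) + norm (of_nat (DIM('a) - 1) * ((g1 \<mu> s - g1 \<nu> s) / of_real s))"
      by (intro order_trans[OF norm_triangle_ineq4] add_mono order_refl norm_triangle_ineq4)
    also have "\<dots> = (norm \<mu>)\<^sup>2 * norm (g0 \<mu> s) + (norm \<nu>)\<^sup>2 * norm (g0 \<nu> s) + ?n * (norm (g1 \<mu> s - g1 \<nu> s) / s)"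
      unfolding norm_mult norm_divide norm_power norm_of_nat norm_of_real using s by simp
    finally have "norm (g2 \<mu> s - g2 \<nu> s) \<le> (norm \<mu>)\<^sup>2 * A * ?D + (norm \<nu>)\<^sup>2 * B * ?D + ?n * C * ?D"
      using a2 b2 c2 by linarith
    moreover have "norm (g0 \<mu> s - g0 \<nu> s) \<le> A * ?D + B * ?D" using norm_triangle_ineq4[of "g0 \<mu> s" "g0 \<nu> s"] a b by linarith
    moreover have "0 \<le> A * ?D" "0 \<le> B * ?D" "0 \<le> C * ?D" "0 \<le> (norm \<mu>)\<^sup>2 * A * ?D" "0 \<le> (norm \<nu>)\<^sup>2 * B * ?D" "0 \<le> ?n * C * ?D"
      using nn D by auto
    ultimately show ?thesis using C[OF s] unfolding K_def distrib_right by (intro conjI; linarith)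
  qed
  moreover have "c > 0" using \<mu> \<nu> by (simp add: c_def)
  ultimately show ?thesis by blast
qed

lemma kernel_L2:
  assumes \<mu>: "Re \<mu> > 0"
  shows "(\<lambda>x::'a. g0 \<mu> (norm (x - y))) \<in> L2"
proof -
  obtain K where K: "\<And>s. s > 0 \<Longrightarrow> norm (g0 \<mu> s) \<le> K * decay m (Re \<mu>) s" using bound0[OF \<mu>] by blast
  show ?thesis
  proof (rule L2_bound[OF decay_L2[OF \<mu> m, of K y]])
    show "(\<lambda>x. g0 \<mu> (norm (x - y))) \<in> borel_measurable borel"
      by (rule borel_measurable_continuous_off_point[OF continuous_profile(2)[OF continuous_on_profile[OF deriv0[OF \<mu>]]]])
    show "AE x in lborel. norm (g0 \<mu> (norm (x - y))) \<le> norm (complex_of_real (K * decay m (Re \<mu>) (norm (x - y))))"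
      using AE_lborel_singleton[of y]
    proof eventually_elim
      case (elim x)
      then show ?case using K[of "norm (x - y)"] unfolding norm_of_real by simp
    qed
  qed
qed

text \<open>The regularised kernel is an admissible test function in the weak formulation, and the error it
  leaves in the Helmholtz equation is the rescaled profile of \<open>kernel_mass\<close>, up to a factor
  that tends to a constant.\<close>

definition defect :: "complex \<Rightarrow> real \<Rightarrow> 'a \<Rightarrow> 'a \<Rightarrow> complex" where
  "defect \<mu> \<epsilon> y x = (let s = reg_dist \<epsilon> y x in of_real (\<epsilon>\<^sup>2 / s\<^sup>2) * (g2 \<mu> s - g1 \<mu> s / of_real s))"

definition profile :: "complex \<Rightarrow> real \<Rightarrow> 'a \<Rightarrow> complex" where
  "profile \<mu> \<epsilon> w = of_real (\<epsilon> ^ DIM('a)) * defect \<mu> \<epsilon> 0 (\<epsilon> *\<^sub>R w)"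

lemma profile_eq:
  fixes w :: 'a
  assumes "\<epsilon> > 0"
  defines "\<sigma> \<equiv> reg_dist 1 0 w"
  shows "profile \<mu> \<epsilon> w = (of_real ((\<epsilon> * \<sigma>) ^ DIM('a)) *
      (g2 \<mu> (\<epsilon> * \<sigma>) - g1 \<mu> (\<epsilon> * \<sigma>) / of_real (\<epsilon> * \<sigma>))) * of_real (1 / \<sigma> ^ (DIM('a) + 2))"
proof -
  have "\<sigma> > 0" unfolding \<sigma>_def by (rule reg_dist_pos) simp
  have "reg_dist \<epsilon> 0 (\<epsilon> *\<^sub>R w) = \<epsilon> * \<sigma>"
  proof -
    have "(\<epsilon> *\<^sub>R w) \<bullet> (\<epsilon> *\<^sub>R w) + \<epsilon>\<^sup>2 = \<epsilon>\<^sup>2 * (w \<bullet> w + 1)" by (simp add: power2_eq_square algebra_simps)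
    then show ?thesis unfolding \<sigma>_def reg_dist_def using assms(1) by (simp add: real_sqrt_mult)
  qed
  moreover have "\<epsilon> ^ DIM('a) * (\<epsilon>\<^sup>2 / (\<epsilon> * \<sigma>)\<^sup>2) = (\<epsilon> * \<sigma>) ^ DIM('a) * (1 / \<sigma> ^ (DIM('a) + 2))"
    using assms(1) \<open>\<sigma> > 0\<close> by (simp add: power_mult_distrib power_add field_simps power2_eq_square)
  ultimately show ?thesis
    unfolding profile_def defect_def Let_def
    by (simp only: mult.assoc[symmetric] of_real_mult[symmetric]) (simp add: mult_ac)
qed

lemma defect_translate: "defect \<mu> \<epsilon> y (y + x) = defect \<mu> \<epsilon> 0 x"
  by (simp add: defect_def reg_dist_def)

text \<open>The convolution of \<open>\<Delta>\<phi> - \<mu>\<^sup>2\<phi>\<close> with the kernel is a continuous function, being a uniform limit of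
  the continuous convolutions with the regularised kernels. Moving the Laplacian onto the regularised
  kernel turns these convolutions into averages of \<open>- \<phi>\<close>, which converge weakly to \<open>- \<phi>\<close>. Hence \<open>\<phi>\<close> agrees
  almost everywhere with a continuous function, given by the integral. This contains the
  embedding of \<^const>\<open>H2\<close> into the continuous functions.\<close>

theorem helmholtz_representation:
  assumes \<phi>: "(\<phi> :: 'a \<Rightarrow> complex) \<in> H2" and \<mu>: "Re \<mu> > 0"
  obtains v where "continuous_on UNIV v" "AE x in lborel. v x = \<phi> x"
    "\<And>y. (LINT x|lborel. (laplacian \<phi> x - \<mu>\<^sup>2 * \<phi> x) * g0 \<mu> (norm (x - y))) = - v y"
proof -
  define f where "f x = laplacian \<phi> x - \<mu>\<^sup>2 * \<phi> x" for x
  have f: "f \<in> L2" unfolding f_def by (intro L2_diff L2_cmult laplacian_L2 H2_L2 \<phi>)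
  obtain K where K: "\<And>s. s > 0 \<Longrightarrow> norm (g0 \<mu> s) \<le> K * decay m (Re \<mu>) s" using bound0[OF \<mu>] by blast
  have K0: "K \<ge> 0" by (rule decay_bound_nonneg[OF K[of 1]]) auto
  define G where "G y x = g0 \<mu> (norm (x - y))" for x y :: 'a
  define Gn where "Gn n y x = g0 \<mu> (reg_dist (eps n) y x)" for n and x y :: 'a
  define W where "W y x = complex_of_real (K * decay m (Re \<mu>) (norm (x - y)))" for x y :: 'a
  have W: "W y \<in> L2" for y unfolding W_def by (rule decay_L2[OF \<mu> m])
  have nW: "norm (W y x) = K * decay m (Re \<mu>) (norm (x - y))" for x y
    unfolding W_def norm_of_real using K0 by (simp add: decay_nonneg)
  have G: "G y \<in> L2" for y unfolding G_def by (rule kernel_L2[OF \<mu>])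
  have pos: "reg_dist (eps n) y x > 0" for n and x y :: 'a by (rule reg_dist_pos[OF eps(1)])
  have smGn: "smooth (Gn n y)" for n y unfolding Gn_def by (rule smooth_reg[OF \<mu> eps(1)])
  have dec: "decay m (Re \<mu>) (reg_dist (eps n) y x) \<le> decay m (Re \<mu>) (norm (x - y))" if "x \<noteq> y" for n and x y :: 'a
    using that \<mu> reg_dist_ge(1)[of x y "eps n"] by (intro decay_mono) auto
  have GnW: "norm (Gn n y x) \<le> norm (W y x)" if "x \<noteq> y" for n x y
    unfolding Gn_def nW using K[OF pos, of n y x] mult_left_mono[OF dec[OF that, of n] K0] by linarith
  have Gn: "Gn n y \<in> L2" for n y
    by (rule L2_bound[OF W[of y] smooth_borel[OF smGn] AE_off_point[OF GnW]])
  have pd1: "partial_deriv i (Gn n y) = radial1 (g1 \<mu>) (eps n) y i" for n y i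
    unfolding Gn_def using partial_deriv_eq[OF radial_has_derivative[OF eps(1) deriv0[OF \<mu>]]] by (intro ext) auto
  have pd2: "partial_deriv j (radial1 (g1 \<mu>) (eps n) y i) = radial2 (g1 \<mu>) (g2 \<mu>) (eps n) y i j" for n i j and y :: 'a
    using partial_deriv_eq[OF radial1_has_derivative[OF eps(1) deriv1[OF \<mu>]]] by (intro ext) auto
  have L2_pd: "partial_deriv i (Gn n y) \<in> L2 \<and> partial_deriv i (partial_deriv i (Gn n y)) \<in> L2"
    if i: "i \<in> Basis" for n y i
  proof -
    obtain L where L: "\<And>s. s \<ge> eps n \<Longrightarrow> norm (g1 \<mu> s) \<le> L * decay m (Re \<mu>) s"
      "\<And>s. s \<ge> eps n \<Longrightarrow> norm (g2 \<mu> s) \<le> L * decay m (Re \<mu>) s"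
      using bound_far[OF \<mu> eps(1)] by blast
    have L0: "L \<ge> 0" by (rule decay_bound_nonneg[OF L(1)[OF order_refl] eps(1)])
    let ?s = "reg_dist (eps n) y"
    define M where "M = L + 2 * L / eps n"
    have M0: "M \<ge> L" "M \<ge> 0" unfolding M_def using L0 eps(1)[of n] by auto
    have sge: "?s x \<ge> eps n" for x using reg_dist_ge(2)[OF eps(1)] .
    have b1: "norm (radial1 (g1 \<mu>) (eps n) y i x) \<le> norm (complex_of_real (M * decay m (Re \<mu>) (norm (x - y))))" if "x \<noteq> y" for x
    proof -
      have "norm (radial1 (g1 \<mu>) (eps n) y i x) \<le> L * decay m (Re \<mu>) (?s x)"
        using radial1_bound[OF i, of "g1 \<mu>" "eps n" y x] L(1)[OF sge, of x] by linarith
      also have "\<dots> \<le> M * decay m (Re \<mu>) (norm (x - y))"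
        using M0 dec[OF that, of n] L0 by (intro mult_mono) (auto simp: decay_nonneg less_imp_le[OF pos])
      finally show ?thesis unfolding norm_of_real by linarith
    qed
    have b2: "norm (radial2 (g1 \<mu>) (g2 \<mu>) (eps n) y i i x) \<le> norm (complex_of_real (M * decay m (Re \<mu>) (norm (x - y))))" if "x \<noteq> y" for x
    proof -
      have "2 * norm (g1 \<mu> (?s x)) / ?s x \<le> 2 * (L * decay m (Re \<mu>) (?s x)) / eps n"
        using L(1)[OF sge, of x] sge[of x] eps(1)[of n] order_trans[OF norm_ge_zero L(1)[OF sge, of x]]
        by (intro frac_le) auto
      then have "norm (radial2 (g1 \<mu>) (g2 \<mu>) (eps n) y i i x) \<le> M * decay m (Re \<mu>) (?s x)"
        using radial2_bound[OF i i pos, of "g1 \<mu>" "g2 \<mu>" n y x] L(2)[OF sge, of x]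
        unfolding M_def by (simp add: algebra_simps)
      also have "\<dots> \<le> M * decay m (Re \<mu>) (norm (x - y))"
        using M0 dec[OF that, of n] by (intro mult_left_mono) auto
      finally show ?thesis unfolding norm_of_real by linarith
    qed
    have meas: "partial_deriv i (Gn n y) \<in> borel_measurable borel" "partial_deriv i (partial_deriv i (Gn n y)) \<in> borel_measurable borel"
      by (intro smooth_borel smooth_partial_deriv smGn i)+
    show ?thesis
      using L2_bound[OF decay_L2[OF \<mu> m, of M y] meas(1)[unfolded pd1] AE_off_point[OF b1]]
        L2_bound[OF decay_L2[OF \<mu> m, of M y] meas(2)[unfolded pd1 pd2] AE_off_point[OF b2]]
      unfolding pd1 pd2 ..
  qed
  have lap: "(\<Sum>i\<in>Basis. partial_deriv i (partial_deriv i (Gn n y)) x) = \<mu>\<^sup>2 * Gn n y x - defect \<mu> (eps n) y x" for n y x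
    unfolding pd1 pd2 radial2_trace[OF pos] helmholtz[OF \<mu> pos] Gn_def defect_def Let_def ..
  have defect_L2: "defect \<mu> (eps n) y \<in> L2" for n y
  proof -
    have "(\<lambda>x. \<mu>\<^sup>2 * Gn n y x - (\<Sum>i\<in>Basis. partial_deriv i (partial_deriv i (Gn n y)) x)) \<in> L2"
      using L2_pd by (intro L2_diff L2_cmult L2_sum Gn) auto
    then show ?thesis unfolding lap by simp
  qed
  \<comment> \<open>\<open>V\<close> is the convolution with the singular kernel, \<open>Vn n\<close> the regularised one.\<close>
  define V where "V y = (LINT x|lborel. f x * G y x)" for y
  define Vn where "Vn n y = (LINT x|lborel. f x * Gn n y x)" for n y
  have Vn_defect: "Vn n y = - (LINT x|lborel. \<phi> x * defect \<mu> (eps n) y x)" for n y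
  proof -
    have "(LINT x|lborel. laplacian \<phi> x * Gn n y x) = (LINT x|lborel. \<mu>\<^sup>2 * (\<phi> x * Gn n y x) - \<phi> x * defect \<mu> (eps n) y x)"
      using L2_pd by (subst laplacian_by_parts[OF \<phi> smGn Gn]) (auto simp: lap algebra_simps)
    moreover have "integrable lborel (\<lambda>x. laplacian \<phi> x * Gn n y x)" "integrable lborel (\<lambda>x. \<phi> x * Gn n y x)"
      "integrable lborel (\<lambda>x. \<phi> x * defect \<mu> (eps n) y x)"
      by (intro L2_mult_integrable laplacian_L2 H2_L2 \<phi> Gn defect_L2)+
    ultimately show ?thesis
      unfolding Vn_def f_def by (simp add: left_diff_distrib mult.assoc)
  qed
  have shift: "Gn n y x = Gn n 0 (- y + x)" "G y x = G 0 (- y + x)" for n x y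
    by (simp_all add: Gn_def G_def reg_dist_def)
  \<comment> \<open>For fixed \<open>n\<close> the kernel is bounded at its centre, so an exponential dominates it locally uniformly in \<open>y\<close>.\<close>
  have contVn: "continuous_on UNIV (Vn n)" for n
    unfolding continuous_on_sequentially
  proof (intro allI ballI impI, elim conjE)
    fix y :: 'a and Y assume Y: "Y \<longlonglongrightarrow> y"
    define c where "c = Re \<mu>"
    define B where "B = K * (1 + 1 / eps n ^ m)"
    have B0: "B \<ge> 0" unfolding B_def using K0 eps(1)[of n] by simp
    have GnB: "norm (Gn n z x) \<le> B * exp (- c * norm (x - z))" for z x
    proof -
      have "decay m c (reg_dist (eps n) z x) \<le> exp (- c * norm (x - z)) * (1 + 1 / eps n ^ m)"
        unfolding decay_def using reg_dist_ge(1)[of x z "eps n"] reg_dist_ge(2)[OF eps(1)[of n], of z x] eps(1)[of n] \<mu> pos[of n z x]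
        by (intro mult_mono add_left_mono divide_left_mono power_mono) (auto simp: c_def intro: mult_left_mono)
      from mult_left_mono[OF this K0] show ?thesis
        using K[OF pos, of n z x] unfolding Gn_def B_def c_def by (simp add: mult_ac)
    qed
    let ?w = "\<lambda>x. norm (f x * complex_of_real ((B * exp c) * decay 0 c (norm (x - y))))"
    obtain N where N: "\<And>k. k \<ge> N \<Longrightarrow> dist (Y k) y < 1" using Y by (metis lim_sequentially zero_less_one)
    have "(\<lambda>k. LINT x|lborel. f x * Gn n (Y (k + N)) x) \<longlonglongrightarrow> (LINT x|lborel. f x * Gn n y x)"
    proof (rule integral_dominated_convergence[where w="?w"])
      have c0: "c > 0" "2 * (0::nat) < DIM('a)" using \<mu> by (auto simp: c_def)
      show "integrable lborel ?w" by (intro integrable_norm L2_mult_integrable f decay_L2 c0)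
      show "(\<lambda>x. f x * Gn n y x) \<in> borel_measurable lborel" "(\<lambda>x. f x * Gn n (Y (k + N)) x) \<in> borel_measurable lborel" for k
        using L2_borel[OF f] smooth_borel[OF smGn] by measurable
      show "AE x in lborel. (\<lambda>k. f x * Gn n (Y (k + N)) x) \<longlonglongrightarrow> f x * Gn n y x"
      proof (rule AE_I2, rule tendsto_mult[OF tendsto_const])
        fix x
        have lim: "(\<lambda>k. reg_dist (eps n) (Y (k + N)) x) \<longlonglongrightarrow> reg_dist (eps n) y x"
          unfolding reg_dist_def using LIMSEQ_ignore_initial_segment[OF Y] by (intro tendsto_intros)
        have "isCont (g0 \<mu>) (reg_dist (eps n) y x)"
          by (rule continuous_profile(3)[OF continuous_on_profile[OF deriv0[OF \<mu>]] pos])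
        from isCont_tendsto_compose[OF this lim]
        show "(\<lambda>k. Gn n (Y (k + N)) x) \<longlonglongrightarrow> Gn n y x" unfolding Gn_def .
      qed
      fix k
      have "norm (Gn n (Y (k + N)) x) \<le> norm (complex_of_real ((B * exp c) * decay 0 c (norm (x - y))))" for x
      proof -
        have "norm (x - y) \<le> norm (x - Y (k + N)) + norm (Y (k + N) - y)"
          using norm_triangle_ineq[of "x - Y (k + N)" "Y (k + N) - y"] by simp
        moreover have "norm (Y (k + N) - y) < 1" using N[of "k + N"] by (simp add: dist_norm)
        ultimately have "- c * norm (x - Y (k + N)) \<le> c + (- c * norm (x - y))"
          using c0 mult_left_mono[of "norm (x - y)" "norm (x - Y (k + N)) + 1" c] by (simp add: algebra_simps)
        then have "exp (- c * norm (x - Y (k + N))) \<le> exp c * exp (- c * norm (x - y))"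
          unfolding exp_add[symmetric] by simp
        from mult_left_mono[OF this B0] have "norm (Gn n (Y (k + N)) x) \<le> B * exp c * exp (- c * norm (x - y))"
          using GnB[of "Y (k + N)" x] by (simp add: mult.assoc)
        also have "\<dots> \<le> (B * exp c) * decay 0 c (norm (x - y))"
          unfolding decay_def using B0 by (intro mult_left_mono) auto
        finally show ?thesis unfolding norm_of_real by linarith
      qed
      then show "AE x in lborel. norm (f x * Gn n (Y (k + N)) x) \<le> ?w x"
        by (auto simp only: norm_mult intro!: AE_I2 mult_left_mono norm_ge_zero)
    qed
    then show "(Vn n \<circ> Y) \<longlonglongrightarrow> Vn n y"
      unfolding Vn_def comp_def by (rule LIMSEQ_offset)
  qed
  have l2_lim: "(\<lambda>n. l2_norm (\<lambda>x. Gn n 0 x - G 0 x)) \<longlonglongrightarrow> 0"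
  proof -
    have "(\<lambda>n. LINT x|lborel. (norm (Gn n 0 x - G 0 x))\<^sup>2) \<longlonglongrightarrow> (LINT x|(lborel :: 'a measure). (0::real))"
    proof (rule integral_dominated_convergence[where w="\<lambda>x. 4 * (norm (W 0 x))\<^sup>2"])
      show "integrable lborel (\<lambda>x. 4 * (norm (W 0 x))\<^sup>2)" by (intro integrable_mult_right L2_integrable_sq W)
      show "(\<lambda>x. (norm (Gn n 0 x - G 0 x))\<^sup>2) \<in> borel_measurable lborel" for n
        using L2_borel[OF Gn[of n 0]] L2_borel[OF G[of 0]] by measurable
      show "AE x in lborel. (\<lambda>n. (norm (Gn n 0 x - G 0 x))\<^sup>2) \<longlonglongrightarrow> 0"
        using AE_lborel_singleton[of 0]
      proof eventually_elim
        case (elim x)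
        have "(\<lambda>n. Gn n 0 x) \<longlonglongrightarrow> G 0 x" unfolding Gn_def G_def
          by (rule isCont_tendsto_compose[OF continuous_profile(3)[OF continuous_on_profile[OF deriv0[OF \<mu>]]] reg_dist_eps_tendsto])
            (use elim in auto)
        then have "(\<lambda>n. (norm (Gn n 0 x - G 0 x))\<^sup>2) \<longlonglongrightarrow> (norm (G 0 x - G 0 x))\<^sup>2"
          by (intro tendsto_intros)
        then show ?case by simp
      qed
      show "AE x in lborel. norm ((norm (Gn n 0 x - G 0 x))\<^sup>2) \<le> 4 * (norm (W 0 x))\<^sup>2" for n
        using AE_lborel_singleton[of 0]
      proof eventually_elim
        case (elim x)
        have "norm (G 0 x) \<le> norm (W 0 x)"
          unfolding G_def nW using elim by (intro K) auto
        then have "norm (Gn n 0 x - G 0 x) \<le> 2 * norm (W 0 x)"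
          using GnW[OF elim, of n] norm_triangle_ineq4[of "Gn n 0 x" "G 0 x"] by linarith
        from power_mono[OF this, of 2] show ?case by (simp add: power_mult_distrib)
      qed
    qed simp
    from tendsto_real_sqrt[OF this] show ?thesis unfolding l2_norm_def by simp
  qed
  \<comment> \<open>By translation invariance the bound does not depend on \<open>y\<close>, which makes the convergence uniform.\<close>
  have V_diff: "norm (Vn n y - V y) \<le> l2_norm f * l2_norm (\<lambda>x. Gn n 0 x - G 0 x)" for n y
  proof -
    have "Vn n y - V y = (LINT x|lborel. f x * (Gn n y x - G y x))"
      unfolding Vn_def V_def right_diff_distrib
      by (rule Bochner_Integration.integral_diff[symmetric]) (intro L2_mult_integrable f Gn G)+
    also have "norm \<dots> \<le> l2_norm f * l2_norm (\<lambda>x. Gn n y x - G y x)"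
      by (intro L2_Cauchy_Schwarz f L2_diff Gn G)
    also have "l2_norm (\<lambda>x. Gn n y x - G y x) = l2_norm (\<lambda>x. Gn n 0 x - G 0 x)"
      unfolding shift(1)[of n y] shift(2)[of y] using L2_translate(2)[OF L2_diff[OF Gn[of n 0] G[of 0]], of "- y"] .
    finally show ?thesis .
  qed
  have V_diff_lim: "(\<lambda>n. l2_norm f * l2_norm (\<lambda>x. Gn n 0 x - G 0 x)) \<longlonglongrightarrow> 0"
    by (rule tendsto_mult_right_zero[OF l2_lim])
  have contV: "continuous_on UNIV V"
  proof (rule uniform_limit_theorem[where F=sequentially and f=Vn])
    show "uniform_limit UNIV Vn V sequentially"
    proof (rule uniform_limitI)
      fix e :: real assume "e > 0"
      then have "\<forall>\<^sub>F n in sequentially. l2_norm f * l2_norm (\<lambda>x. Gn n 0 x - G 0 x) < e"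
        using V_diff_lim by (simp add: order_tendstoD)
      then show "\<forall>\<^sub>F n in sequentially. \<forall>y\<in>UNIV. dist (Vn n y) (V y) < e"
      proof eventually_elim
        case (elim n)
        show ?case using V_diff[of n] elim by (auto simp: dist_norm intro: le_less_trans)
      qed
    qed
  qed (use contVn in auto)
  have weak: "(LINT y|lborel. V y * \<eta> y) = - (LINT y|lborel. \<phi> y * \<eta> y)" if \<eta>: "\<eta> \<in> test_functions" for \<eta>
  proof (rule LIMSEQ_unique)
    note \<eta>2 = test_function_L2[OF \<eta>]
    show "(\<lambda>n. LINT y|lborel. Vn n y * \<eta> y) \<longlonglongrightarrow> (LINT y|lborel. V y * \<eta> y)"
    proof (rule integral_dominated_convergence[where w="\<lambda>y. (l2_norm f * l2_norm (W 0)) * norm (\<eta> y)"])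
      show "integrable lborel (\<lambda>y. (l2_norm f * l2_norm (W 0)) * norm (\<eta> y))"
        by (intro integrable_mult_right integrable_norm \<eta>2)
      show "(\<lambda>y. V y * \<eta> y) \<in> borel_measurable lborel" "(\<lambda>y. Vn n y * \<eta> y) \<in> borel_measurable lborel" for n
        using L2_borel[OF \<eta>2(1)] borel_measurable_continuous_onI[OF contV] borel_measurable_continuous_onI[OF contVn]
        by measurable
      show "AE y in lborel. (\<lambda>n. Vn n y * \<eta> y) \<longlonglongrightarrow> V y * \<eta> y"
      proof (rule AE_I2, rule tendsto_mult[OF _ tendsto_const])
        fix y
        have "(\<lambda>n. Vn n y - V y) \<longlonglongrightarrow> 0"
          by (rule Lim_null_comparison[OF _ V_diff_lim]) (use V_diff in auto)
        then show "(\<lambda>n. Vn n y) \<longlonglongrightarrow> V y" by (simp add: LIM_zero_iff)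
      qed
      fix n
      have "norm (Vn n y) \<le> l2_norm f * l2_norm (W 0)" for y
      proof -
        have "norm (Vn n y) \<le> l2_norm f * l2_norm (Gn n y)"
          unfolding Vn_def by (intro L2_Cauchy_Schwarz f Gn)
        also have "l2_norm (Gn n y) \<le> l2_norm (W y)"
          unfolding l2_norm_def
        proof (rule real_sqrt_le_mono, rule integral_mono_AE)
          show "AE x in lborel. (norm (Gn n y x))\<^sup>2 \<le> (norm (W y x))\<^sup>2"
            using AE_lborel_singleton[of y] by eventually_elim (intro power_mono GnW norm_ge_zero)
        qed (intro L2_integrable_sq Gn W)+
        also have "W y = (\<lambda>x. W 0 (- y + x))" by (rule ext) (simp add: W_def)
        also have "l2_norm \<dots> = l2_norm (W 0)" by (rule L2_translate(2)[OF W])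
        finally show ?thesis by (simp add: mult_left_mono)
      qed
      then show "AE y in lborel. norm (Vn n y * \<eta> y) \<le> (l2_norm f * l2_norm (W 0)) * norm (\<eta> y)"
        unfolding norm_mult by (intro AE_I2 mult_right_mono) auto
    qed
    \<comment> \<open>Substitute \<open>x = y + eps n *\<^sub>R w\<close>.\<close>
    have Vn_profile: "Vn n y = - (LINT w|lborel. \<phi> (y + eps n *\<^sub>R w) * profile \<mu> (eps n) w)" for n y
    proof -
      have "(LINT x|lborel. \<phi> x * defect \<mu> (eps n) y x) =
          of_real (eps n ^ DIM('a)) * (LINT w|lborel. \<phi> (y + eps n *\<^sub>R w) * defect \<mu> (eps n) y (y + eps n *\<^sub>R w))"
        using L2_borel[OF H2_L2[OF \<phi>]] L2_borel[OF defect_L2] by (intro integral_affine eps) measurable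
      also have "\<dots> = (LINT w|lborel. \<phi> (y + eps n *\<^sub>R w) * profile \<mu> (eps n) w)"
        unfolding defect_translate profile_def by (subst integral_mult_right_zero[symmetric]) (simp add: mult_ac)
      finally show ?thesis unfolding Vn_defect by simp
    qed
    obtain P where P: "\<And>t. t > 0 \<Longrightarrow> norm (of_real (t ^ DIM('a)) * (g2 \<mu> t - g1 \<mu> t / of_real t)) \<le> P"
      using point_mass_bound[OF \<mu>] by blast
    let ?\<kappa> = "\<lambda>w::'a. of_real (1 / unit_ball_vol DIM('a)) * complex_of_real (1 / reg_dist 1 0 w ^ (DIM('a) + 2))"
    have \<sigma>: "reg_dist 1 0 w > 0" for w :: 'a by (rule reg_dist_pos) simp
    have "(\<lambda>n. LINT y|lborel. (LINT w|lborel. \<phi> (y + eps n *\<^sub>R w) * profile \<mu> (eps n) w) * \<eta> y) \<longlonglongrightarrow>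
        (LINT w|lborel. ?\<kappa> w) * (LINT y|lborel. \<phi> y * \<eta> y)"
    proof (rule approximate_identity[OF H2_L2[OF \<phi>] \<eta>, where k="\<lambda>w. P * (1 / reg_dist 1 0 w ^ (DIM('a) + 2))"])
      show "profile \<mu> (eps n) \<in> borel_measurable borel" for n
        using L2_borel[OF defect_L2] unfolding profile_def by measurable
      show "?\<kappa> \<in> borel_measurable borel" unfolding reg_dist_def by measurable
      show "integrable lborel (\<lambda>w::'a. P * (1 / reg_dist 1 0 w ^ (DIM('a) + 2)))"
        by (intro integrable_mult_right kernel_mass)
      show "norm (profile \<mu> (eps n) w) \<le> P * (1 / reg_dist 1 0 w ^ (DIM('a) + 2))" for n w
        unfolding profile_eq[OF eps(1)] norm_mult[of _ "of_real (1 / _)"] norm_of_real[of "1 / _"]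
        using P[of "eps n * reg_dist 1 0 w"] \<sigma>[of w] eps(1)[of n]
        by (intro mult_mono) (auto simp: order_trans[OF norm_ge_zero])
      show "(\<lambda>n. profile \<mu> (eps n) w) \<longlonglongrightarrow> ?\<kappa> w" for w
        unfolding profile_eq[OF eps(1)]
      proof (rule tendsto_mult[OF _ tendsto_const])
        have "eps n \<noteq> 0" for n using eps(1)[of n] by simp
        then have "filterlim (\<lambda>n. eps n * reg_dist 1 0 w) (at_right 0) sequentially"
          unfolding filterlim_at
          using \<sigma>[of w] eps(1) by (auto intro!: tendsto_eq_intros eps(3))
        from filterlim_compose[OF point_mass[OF \<mu>] this]
        show "(\<lambda>n. of_real ((eps n * reg_dist 1 0 w) ^ DIM('a)) * (g2 \<mu> (eps n * reg_dist 1 0 w) -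
            g1 \<mu> (eps n * reg_dist 1 0 w) / of_real (eps n * reg_dist 1 0 w))) \<longlonglongrightarrow> of_real (1 / unit_ball_vol DIM('a))" .
      qed
    qed
    moreover have "(LINT w|lborel. ?\<kappa> w) = 1"
    proof -
      have "(LINT w|lborel. ?\<kappa> w) = of_real (1 / unit_ball_vol DIM('a)) * of_real (LINT w|lborel. 1 / reg_dist 1 0 (w::'a) ^ (DIM('a) + 2))"
        by (simp only: integral_mult_right_zero integral_complex_of_real)
      also have "\<dots> = 1" unfolding kernel_mass(2) of_real_mult[symmetric]
        using unit_ball_vol_pos[of "real DIM('a)"] by (simp add: less_imp_neq[THEN not_sym])
      finally show ?thesis .
    qed
    ultimately show "(\<lambda>n. LINT y|lborel. Vn n y * \<eta> y) \<longlonglongrightarrow> - (LINT y|lborel. \<phi> y * \<eta> y)"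
      unfolding Vn_profile by (simp add: tendsto_minus_cancel_left[symmetric])
  qed
  have locV: "integrable lborel (\<lambda>x. indicator (cbox a b) x *\<^sub>R V x)" for a b
    by (rule borel_integrable_compact) (auto intro: continuous_on_subset[OF contV])
  have "AE x in lborel. V x + \<phi> x = 0"
  proof (rule fundamental_lemma)
    show "(\<lambda>x. V x + \<phi> x) \<in> borel_measurable borel"
      using L2_borel[OF H2_L2[OF \<phi>]] borel_measurable_continuous_onI[OF contV] by measurable
    show "integrable lborel (\<lambda>x. indicator (cbox a b) x *\<^sub>R (V x + \<phi> x))" for a b
      unfolding scaleR_add_right
      by (intro Bochner_Integration.integrable_add locV L2_locally_integrable H2_L2 \<phi>)
    fix \<eta> :: "'a \<Rightarrow> complex" assume \<eta>: "\<eta> \<in> test_functions"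
    obtain R where R: "\<And>x. \<eta> x \<noteq> 0 \<Longrightarrow> norm x \<le> R" using test_function_support[OF \<eta>] by blast
    have "integrable lborel (\<lambda>x. V x * \<eta> x)"
      by (rule compact_support_L2(2)[where R=R])
        (use R in \<open>auto intro!: continuous_intros contV smooth_continuous[OF test_function_smooth[OF \<eta>]]\<close>)
    moreover have "integrable lborel (\<lambda>x. \<phi> x * \<eta> x)"
      by (intro L2_mult_integrable H2_L2 \<phi> test_function_L2 \<eta>)
    ultimately show "(LINT x|lborel. (V x + \<phi> x) * \<eta> x) = 0"
      using weak[OF \<eta>] by (simp add: distrib_right)
  qed
  then have ae: "AE x in lborel. - V x = \<phi> x"
  proof eventually_elim
    case (elim x)
    show ?case using minus_unique[OF elim] .
  qed
  have cont: "continuous_on UNIV (\<lambda>x. - V x)" by (intro continuous_intros contV)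
  have "(LINT x|lborel. (laplacian \<phi> x - \<mu>\<^sup>2 * \<phi> x) * g0 \<mu> (norm (x - y))) = - (- V y)" for y
    by (simp add: V_def f_def G_def)
  then show ?thesis by (rule that[OF cont ae])
qed

end

section \<open>The resolvent of the bi-Laplacian\<close>

context helmholtz_kernel
begin

lemma helmholtz_identity:
  assumes "(\<phi> :: 'a \<Rightarrow> complex) \<in> H2" "Re \<mu> > 0"
  shows "(LINT x|lborel. (laplacian \<phi> x - \<mu>\<^sup>2 * \<phi> x) * g0 \<mu> (norm (x - y))) = - continuous_rep \<phi> y"
  using helmholtz_representation[OF assms] continuous_rep_eq by metis

lemma continuous_rep_AE:
  assumes "(\<phi> :: 'a \<Rightarrow> complex) \<in> H2"
  shows "AE x in lborel. continuous_rep \<phi> x = \<phi> x"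
proof -
  obtain v where v: "continuous_on UNIV v" "AE x in lborel. v x = \<phi> x"
    using helmholtz_representation[OF assms, of 1] by auto
  then show ?thesis using continuous_rep_eq[OF v] by simp
qed

text \<open>For \<open>\<nu>\<^sup>2 = - \<mu>\<^sup>2\<close> one has \<open>\<Delta>\<^sup>2 - \<mu>\<^sup>4 = (\<Delta> - \<mu>\<^sup>2) (\<Delta> - \<nu>\<^sup>2)\<close>, and by partial fractions this difference
  is a multiple of the Green function of \<open>\<Delta>\<^sup>2 - \<mu>\<^sup>4\<close> with pole \<open>y\<close>.\<close>

definition green :: "complex \<Rightarrow> complex \<Rightarrow> 'a \<Rightarrow> 'a \<Rightarrow> complex" where
  "green \<mu> \<nu> y x = g0 \<mu> (norm (x - y)) - g0 \<nu> (norm (x - y))"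

lemma green_H2:
  assumes \<mu>: "Re \<mu> > 0" and \<nu>: "Re \<nu> > 0"
  shows "green \<mu> \<nu> y \<in> H2"
    and "AE x in lborel. laplacian (green \<mu> \<nu> y) x = \<mu>\<^sup>2 * g0 \<mu> (norm (x - y)) - \<nu>\<^sup>2 * g0 \<nu> (norm (x - y))"
proof -
  obtain K c where c: "c > 0" and K: "\<And>s. s > 0 \<Longrightarrow>
      norm (g0 \<mu> s - g0 \<nu> s) \<le> K * decay m c s \<and> norm (g1 \<mu> s - g1 \<nu> s) \<le> K * decay m c s \<and>
      norm (g2 \<mu> s - g2 \<nu> s) \<le> K * decay m c s \<and> norm (g1 \<mu> s - g1 \<nu> s) / s \<le> K * decay m c s"
    using diff_bound[OF \<mu> \<nu>] by blast
  have U: "green \<mu> \<nu> y = (\<lambda>x. (\<lambda>s. g0 \<mu> s - g0 \<nu> s) (norm (x - y)))" by (simp add: green_def fun_eq_iff)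
  note H2 = radial_H2[where F="\<lambda>s. g0 \<mu> s - g0 \<nu> s" and ?F1.0="\<lambda>s. g1 \<mu> s - g1 \<nu> s" and
      ?F2.0="\<lambda>s. g2 \<mu> s - g2 \<nu> s" and y=y and c=c and m=m and K=K,
      OF has_vector_derivative_diff[OF deriv0[OF \<mu>] deriv0[OF \<nu>]]
        has_vector_derivative_diff[OF deriv1[OF \<mu>] deriv1[OF \<nu>]]
        continuous_on_diff[OF cont2[OF \<mu>] cont2[OF \<nu>]] c m]
  show "green \<mu> \<nu> y \<in> H2" unfolding U by (rule H2(1)) (use K in auto)
  have "AE x in lborel. laplacian (green \<mu> \<nu> y) x = (g2 \<mu> (norm (x - y)) - g2 \<nu> (norm (x - y))) +
      of_nat (DIM('a) - 1) * (g1 \<mu> (norm (x - y)) - g1 \<nu> (norm (x - y))) / of_real (norm (x - y))"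
    unfolding U by (rule H2(2)) (use K in auto)
  then show "AE x in lborel. laplacian (green \<mu> \<nu> y) x = \<mu>\<^sup>2 * g0 \<mu> (norm (x - y)) - \<nu>\<^sup>2 * g0 \<nu> (norm (x - y))"
    using AE_lborel_singleton[of y]
  proof eventually_elim
    case (elim x)
    then have "norm (x - y) > 0" by simp
    show ?case unfolding elim(1) helmholtz[OF \<mu> \<open>norm (x - y) > 0\<close>, symmetric] helmholtz[OF \<nu> \<open>norm (x - y) > 0\<close>, symmetric]
      by (simp add: right_diff_distrib diff_divide_distrib)
  qed
qed

lemma green_cnj: "green (cnj \<mu>) (cnj \<nu>) y x = cnj (green \<mu> \<nu> y x)"
  by (simp add: green_def cnj_g0)

lemma laplacian_green_cnj:
  assumes "Re \<mu> > 0" "Re \<nu> > 0"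
  shows "AE x in lborel. laplacian (green (cnj \<mu>) (cnj \<nu>) y) x = cnj (laplacian (green \<mu> \<nu> y) x)"
  using green_H2(2)[of "cnj \<mu>" "cnj \<nu>" y, simplified, OF assms] green_H2(2)[OF assms, of y]
  by eventually_elim (simp add: cnj_g0)

lemma continuous_rep_green:
  assumes \<mu>: "Re \<mu> > 0" and \<nu>: "Re \<nu> > 0"
  shows "continuous_rep (green \<mu> \<nu> y) = (\<lambda>x. if x = y then u0 \<mu> \<nu> else green \<mu> \<nu> y x)"
proof (rule continuous_rep_eq)
  let ?F = "\<lambda>s. g0 \<mu> s - g0 \<nu> s" and ?v = "\<lambda>x. if x = y then u0 \<mu> \<nu> else green \<mu> \<nu> y x"
  show "AE x in lborel. ?v x = green \<mu> \<nu> y x"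
    using AE_lborel_singleton[of y] by eventually_elim simp
  have "isCont ?v x" for x
  proof (cases "x = y")
    case True
    have "filterlim (\<lambda>x. norm (x - y)) (at_right 0) (at y)"
      unfolding filterlim_at by (auto simp: eventually_at_filter intro!: tendsto_eq_intros)
    from filterlim_compose[OF diff_limit[OF \<mu> \<nu>] this]
    have "((\<lambda>x. ?F (norm (x - y))) \<longlongrightarrow> u0 \<mu> \<nu>) (at y)" .
    then have "(?v \<longlongrightarrow> u0 \<mu> \<nu>) (at y)"
      by (rule tendsto_cong[THEN iffD1, rotated]) (auto simp: eventually_at_filter green_def)
    then show ?thesis using True by (simp add: isCont_def)
  next
    case False
    have "continuous_on (- {y}) (\<lambda>x. ?F (norm (x - y)))"
      by (rule continuous_profile(2)[OF continuous_on_profile[OF has_vector_derivative_diff[OF deriv0[OF \<mu>] deriv0[OF \<nu>]]]])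
    then have "continuous_on (- {y}) ?v"
      by (rule continuous_on_eq) (auto simp: green_def)
    moreover have "open (- {y})" by (intro open_Compl closed_singleton)
    ultimately show ?thesis using False continuous_on_eq_continuous_at by blast
  qed
  then show "continuous_on UNIV ?v" by (intro continuous_at_imp_continuous_on) auto
qed

text \<open>The weak form of \<open>(\<Delta>\<^sup>2 - \<mu>\<^sup>4) green = - 2 \<mu>\<^sup>2 \<delta>\<close>: a combination of the two Helmholtz identities for \<open>\<mu>\<close> and
  \<open>\<nu>\<close>.\<close>

theorem biharmonic_identity:
  assumes \<phi>: "\<phi> \<in> H2" and \<mu>: "Re \<mu> > 0" and \<nu>: "Re \<nu> > 0" and eq: "\<nu>\<^sup>2 = - \<mu>\<^sup>2"
  shows "(LINT x|lborel. laplacian \<phi> x * laplacian (green \<mu> \<nu> y) x) =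
    \<mu> ^ 4 * (LINT x|lborel. \<phi> x * green \<mu> \<nu> y x) - 2 * \<mu>\<^sup>2 * continuous_rep \<phi> y"
proof -
  let ?g = "\<lambda>\<mu> x. g0 \<mu> (norm (x - y))"
  define A where "A \<mu> = (LINT x|lborel. laplacian \<phi> x * ?g \<mu> x)" for \<mu>
  define B where "B \<mu> = (LINT x|lborel. \<phi> x * ?g \<mu> x)" for \<mu>
  have int: "integrable lborel (\<lambda>x. laplacian \<phi> x * ?g \<mu> x)" "integrable lborel (\<lambda>x. \<phi> x * ?g \<mu> x)"
    if "Re \<mu> > 0" for \<mu>
    by (intro L2_mult_integrable laplacian_L2 H2_L2 \<phi> kernel_L2 that)+
  have AB: "A \<mu> = \<mu>\<^sup>2 * B \<mu> - continuous_rep \<phi> y" if "Re \<mu> > 0" for \<mu>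
  proof -
    have "A \<mu> - \<mu>\<^sup>2 * B \<mu> = - continuous_rep \<phi> y"
      using helmholtz_identity[OF \<phi> that, of y] int[OF that]
      by (simp add: A_def B_def left_diff_distrib mult.assoc)
    then show ?thesis by (simp add: algebra_simps)
  qed
  have "(LINT x|lborel. laplacian \<phi> x * laplacian (green \<mu> \<nu> y) x) =
    (LINT x|lborel. \<mu>\<^sup>2 * (laplacian \<phi> x * ?g \<mu> x) - \<nu>\<^sup>2 * (laplacian \<phi> x * ?g \<nu> x))"
  proof (rule integral_cong_AE)
    have [measurable]: "laplacian \<phi> \<in> borel_measurable borel" "laplacian (green \<mu> \<nu> y) \<in> borel_measurable borel"
      "?g \<mu> \<in> borel_measurable borel" "?g \<nu> \<in> borel_measurable borel"
      by (intro L2_borel laplacian_L2 \<phi> green_H2 kernel_L2 \<mu> \<nu>)+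
    show "(\<lambda>x. laplacian \<phi> x * laplacian (green \<mu> \<nu> y) x) \<in> borel_measurable lborel"
      "(\<lambda>x. \<mu>\<^sup>2 * (laplacian \<phi> x * ?g \<mu> x) - \<nu>\<^sup>2 * (laplacian \<phi> x * ?g \<nu> x)) \<in> borel_measurable lborel"
      by measurable
    show "AE x in lborel. laplacian \<phi> x * laplacian (green \<mu> \<nu> y) x =
      \<mu>\<^sup>2 * (laplacian \<phi> x * ?g \<mu> x) - \<nu>\<^sup>2 * (laplacian \<phi> x * ?g \<nu> x)"
      using green_H2(2)[OF \<mu> \<nu>, of y]
    proof eventually_elim
      case (elim x)
      show ?case unfolding elim by (simp add: algebra_simps)
    qed
  qed
  also have "\<dots> = \<mu>\<^sup>2 * (A \<mu> + A \<nu>)"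
    unfolding eq A_def distrib_left using int[OF \<mu>] int[OF \<nu>] by simp
  also have "\<dots> = \<mu> ^ 4 * (B \<mu> - B \<nu>) - 2 * \<mu>\<^sup>2 * continuous_rep \<phi> y"
    unfolding AB[OF \<mu>] AB[OF \<nu>] eq by (simp add: algebra_simps power2_eq_square power4_eq_xxxx)
  also have "B \<mu> - B \<nu> = (LINT x|lborel. \<phi> x * green \<mu> \<nu> y x)"
    using int[OF \<mu>] int[OF \<nu>] by (simp add: B_def green_def right_diff_distrib)
  finally show ?thesis .
qed

text \<open>The form \<^const>\<open>h_delta\<close> conjugates its first argument; this is the conjugate of the preceding identity
  for the conjugate parameters.\<close>

lemma biharmonic_identity_cnj:
  assumes \<phi>: "\<phi> \<in> H2" and \<mu>: "Re \<mu> > 0" and \<nu>: "Re \<nu> > 0" and eq: "\<nu>\<^sup>2 = - \<mu>\<^sup>2"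
  shows "(LINT x|lborel. cnj (laplacian \<phi> x) * laplacian (green \<mu> \<nu> y) x) =
    \<mu> ^ 4 * (LINT x|lborel. cnj (\<phi> x) * green \<mu> \<nu> y x) - 2 * \<mu>\<^sup>2 * cnj (continuous_rep \<phi> y)"
proof -
  have eq': "(cnj \<nu>)\<^sup>2 = - (cnj \<mu>)\<^sup>2"
    by (metis complex_cnj_minus complex_cnj_power eq)
  have "(LINT x|lborel. laplacian \<phi> x * laplacian (green (cnj \<mu>) (cnj \<nu>) y) x) =
    (LINT x|lborel. cnj (cnj (laplacian \<phi> x) * laplacian (green \<mu> \<nu> y) x))"
  proof (rule integral_cong_AE)
    have [measurable]: "laplacian \<phi> \<in> borel_measurable borel" "laplacian (green \<mu> \<nu> y) \<in> borel_measurable borel"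
      "laplacian (green (cnj \<mu>) (cnj \<nu>) y) \<in> borel_measurable borel"
      using \<mu> \<nu> by (intro L2_borel laplacian_L2 \<phi> green_H2; simp)+
    show "(\<lambda>x. laplacian \<phi> x * laplacian (green (cnj \<mu>) (cnj \<nu>) y) x) \<in> borel_measurable lborel"
      "(\<lambda>x. cnj (cnj (laplacian \<phi> x) * laplacian (green \<mu> \<nu> y) x)) \<in> borel_measurable lborel"
      by measurable
    show "AE x in lborel. laplacian \<phi> x * laplacian (green (cnj \<mu>) (cnj \<nu>) y) x =
        cnj (cnj (laplacian \<phi> x) * laplacian (green \<mu> \<nu> y) x)"
      using laplacian_green_cnj[OF \<mu> \<nu>, of y] by eventually_elim simp
  qed
  also have "\<dots> = cnj (LINT x|lborel. cnj (laplacian \<phi> x) * laplacian (green \<mu> \<nu> y) x)"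
    by (rule Bochner_Integration.integral_cnj)
  finally have "cnj (LINT x|lborel. cnj (laplacian \<phi> x) * laplacian (green \<mu> \<nu> y) x) =
      (cnj \<mu>) ^ 4 * (LINT x|lborel. \<phi> x * green (cnj \<mu>) (cnj \<nu>) y x) - 2 * (cnj \<mu>)\<^sup>2 * continuous_rep \<phi> y"
    using biharmonic_identity[OF \<phi>, of "cnj \<mu>" "cnj \<nu>" y] \<mu> \<nu> eq' by simp
  also have "(LINT x|lborel. \<phi> x * green (cnj \<mu>) (cnj \<nu>) y x) = (LINT x|lborel. cnj (cnj (\<phi> x) * green \<mu> \<nu> y x))"
    by (simp add: green_cnj)
  also have "\<dots> = cnj (LINT x|lborel. cnj (\<phi> x) * green \<mu> \<nu> y x)"
    by (rule Bochner_Integration.integral_cnj)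
  finally show ?thesis
    by (subst complex_cnj_cancel_iff[symmetric]) simp
qed

text \<open>The Green function with pole at the origin solves the weak eigenvalue equation as soon as the point
  evaluation produced by \<open>biharmonic_identity_cnj\<close> cancels the one in the form.\<close>

theorem eigenvalue_if:
  assumes \<mu>: "Re \<mu> > 0" and \<nu>: "Re \<nu> > 0" and eq: "\<nu>\<^sup>2 = - \<mu>\<^sup>2" and \<gamma>: "\<gamma> * u0 \<mu> \<nu> = 2 * \<mu>\<^sup>2"
  shows "\<mu> ^ 4 \<in> point_spectrum (H_delta \<gamma> :: ('a \<Rightarrow> complex) \<Rightarrow> ('a \<Rightarrow> complex) \<Rightarrow> bool)"
proof -
  note U = green_H2[OF \<mu> \<nu>, of 0]
  have rep: "continuous_rep (green \<mu> \<nu> 0) 0 = u0 \<mu> \<nu>" by (simp add: continuous_rep_green[OF \<mu> \<nu>])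
  have "\<not> (AE x in lborel. green \<mu> \<nu> 0 x = 0)"
  proof
    assume "AE x in lborel. green \<mu> \<nu> 0 x = 0"
    then have "AE x in lborel. (\<lambda>x. 0) x = green \<mu> \<nu> 0 x" by eventually_elim simp
    then have "continuous_rep (green \<mu> \<nu> 0) = (\<lambda>x. 0)" by (intro continuous_rep_eq) auto
    then have "u0 \<mu> \<nu> = 0" using rep by simp
    then show False using \<gamma> \<mu> by auto
  qed
  moreover have "H_delta \<gamma> (green \<mu> \<nu> 0) (\<lambda>x. \<mu> ^ 4 * green \<mu> \<nu> 0 x)"
    unfolding H_delta_def
  proof (intro conjI ballI)
    show "(\<lambda>x. \<mu> ^ 4 * green \<mu> \<nu> 0 x) \<in> L2" by (intro L2_cmult H2_L2 U)
    fix \<phi> :: "'a \<Rightarrow> complex" assume \<phi>: "\<phi> \<in> H2"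
    have "h_delta \<gamma> \<phi> (green \<mu> \<nu> 0) = \<mu> ^ 4 * (LINT x|lborel. cnj (\<phi> x) * green \<mu> \<nu> 0 x) +
        (\<gamma> * u0 \<mu> \<nu> - 2 * \<mu>\<^sup>2) * cnj (continuous_rep \<phi> 0)"
      unfolding h_delta_def rep biharmonic_identity_cnj[OF \<phi> \<mu> \<nu> eq] by (simp add: algebra_simps)
    also have "\<dots> = (LINT x|lborel. \<mu> ^ 4 * (cnj (\<phi> x) * green \<mu> \<nu> 0 x))" by (simp add: \<gamma>)
    also have "\<dots> = (LINT x|lborel. cnj (\<phi> x) * (\<mu> ^ 4 * green \<mu> \<nu> 0 x))" by (simp only: mult.left_commute)
    finally show "h_delta \<gamma> \<phi> (green \<mu> \<nu> 0) = (LINT x|lborel. cnj (\<phi> x) * (\<mu> ^ 4 * green \<mu> \<nu> 0 x))" .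
  qed (rule U)
  ultimately show ?thesis unfolding point_spectrum_def by blast
qed

text \<open>Conversely, the weak eigenvalue equation is tested with the conjugate of the Green function with an
  arbitrary pole \<open>y\<close> and an arbitrary spectral parameter \<open>\<mu>\<close>. This gives a pointwise formula for the
  eigenfunction and takes the place of solving a differential equation. If \<open>\<mu> ^ 4 = z\<close>, the right-hand
  side is zero.\<close>

theorem eigenfunction_equation:
  assumes \<psi>: "H_delta \<gamma> \<psi> (\<lambda>x. z * \<psi> x)" and \<mu>: "Re \<mu> > 0" and \<nu>: "Re \<nu> > 0" and eq: "\<nu>\<^sup>2 = - \<mu>\<^sup>2"
  shows "\<gamma> * continuous_rep (green \<mu> \<nu> y) 0 * continuous_rep \<psi> 0 - 2 * \<mu>\<^sup>2 * continuous_rep \<psi> y =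
    (z - \<mu> ^ 4) * (LINT x|lborel. \<psi> x * green \<mu> \<nu> y x)"
proof -
  have H2: "\<psi> \<in> H2" using \<psi> by (simp add: H_delta_def)
  let ?\<phi> = "green (cnj \<mu>) (cnj \<nu>) y"
  have \<phi>: "?\<phi> \<in> H2" using \<mu> \<nu> by (intro green_H2) auto
  have rep: "cnj (continuous_rep ?\<phi> 0) = continuous_rep (green \<mu> \<nu> y) 0"
  proof -
    have "((\<lambda>s. g0 (cnj \<mu>) s - g0 (cnj \<nu>) s) \<longlongrightarrow> cnj (u0 \<mu> \<nu>)) (at_right 0)"
      using tendsto_cnj[OF diff_limit[OF \<mu> \<nu>]] by (simp add: cnj_g0)
    moreover have "((\<lambda>s. g0 (cnj \<mu>) s - g0 (cnj \<nu>) s) \<longlongrightarrow> u0 (cnj \<mu>) (cnj \<nu>)) (at_right 0)"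
      using \<mu> \<nu> by (intro diff_limit) auto
    ultimately have "u0 (cnj \<mu>) (cnj \<nu>) = cnj (u0 \<mu> \<nu>)"
      using tendsto_unique[OF trivial_limit_at_right_real] by blast
    then show ?thesis
      using continuous_rep_green[OF \<mu> \<nu>, of y] continuous_rep_green[of "cnj \<mu>" "cnj \<nu>" y] \<mu> \<nu> by (simp add: green_cnj)
  qed
  have "(LINT x|lborel. cnj (laplacian ?\<phi> x) * laplacian \<psi> x) = (LINT x|lborel. laplacian \<psi> x * laplacian (green \<mu> \<nu> y) x)"
  proof (rule integral_cong_AE)
    have [measurable]: "laplacian \<psi> \<in> borel_measurable borel" "laplacian (green \<mu> \<nu> y) \<in> borel_measurable borel"
      "laplacian ?\<phi> \<in> borel_measurable borel"
      by (intro L2_borel laplacian_L2 \<phi> H2 green_H2 \<mu> \<nu>)+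
    show "(\<lambda>x. cnj (laplacian ?\<phi> x) * laplacian \<psi> x) \<in> borel_measurable lborel"
      "(\<lambda>x. laplacian \<psi> x * laplacian (green \<mu> \<nu> y) x) \<in> borel_measurable lborel" by measurable
    show "AE x in lborel. cnj (laplacian ?\<phi> x) * laplacian \<psi> x = laplacian \<psi> x * laplacian (green \<mu> \<nu> y) x"
      using laplacian_green_cnj[OF \<mu> \<nu>, of y] by eventually_elim (simp add: mult.commute)
  qed
  then have form: "h_delta \<gamma> ?\<phi> \<psi> = (LINT x|lborel. laplacian \<psi> x * laplacian (green \<mu> \<nu> y) x) +
      \<gamma> * continuous_rep (green \<mu> \<nu> y) 0 * continuous_rep \<psi> 0"
    by (simp add: h_delta_def rep)
  have weak: "h_delta \<gamma> ?\<phi> \<psi> = (LINT x|lborel. cnj (?\<phi> x) * (z * \<psi> x))"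
    using \<psi> \<phi> unfolding H_delta_def by blast
  have rhs: "(LINT x|lborel. cnj (?\<phi> x) * (z * \<psi> x)) = z * (LINT x|lborel. \<psi> x * green \<mu> \<nu> y x)"
    unfolding integral_mult_right_zero[symmetric] green_cnj complex_cnj_cnj by (simp only: mult_ac)
  from form[unfolded weak rhs biharmonic_identity[OF H2 \<mu> \<nu> eq]]
  show ?thesis by (simp add: algebra_simps)
qed

end

section \<open>The kernels in dimensions one and three\<close>

lemma norm_exp_line: "norm (exp (- (\<mu> * complex_of_real s))) = exp (- Re \<mu> * s)"
  by (simp add: norm_exp_eq_Re)

text \<open>The singularities of the profiles cancel in differences. This is seen by differentiating with
  respect to the spectral parameter \<^term>\<open>\<mu>\<close>.\<close>

lemma spectral_difference:
  fixes f f' :: "complex \<Rightarrow> complex"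
  assumes \<mu>: "Re \<mu> > 0" and \<nu>: "Re \<nu> > 0" and s: "s > 0"
    and f: "\<And>w. (f has_field_derivative f' w) (at w)"
    and f': "\<And>w. norm (f' w) \<le> norm w ^ n * B * norm (exp (- (w * complex_of_real s)))" and B: "B \<ge> 0"
  shows "norm (f \<mu> - f \<nu>) \<le> (max (norm \<mu>) (norm \<nu>)) ^ n * norm (\<mu> - \<nu>) * B * exp (- min (Re \<mu>) (Re \<nu>) * s)"
proof -
  let ?c = "min (Re \<mu>) (Re \<nu>)" and ?M = "max (norm \<mu>) (norm \<nu>)"
  have "norm (f \<mu> - f \<nu>) \<le> (?M ^ n * B * exp (- ?c * s)) * norm (\<mu> - \<nu>)"
  proof (rule field_differentiable_bound[where S="{w. Re w \<ge> ?c} \<inter> cball 0 ?M"])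
    show "convex ({w. Re w \<ge> ?c} \<inter> cball 0 ?M)" by (intro convex_Int convex_halfspace_Re_ge convex_cball)
    fix w assume w: "w \<in> {w. Re w \<ge> ?c} \<inter> cball 0 ?M"
    show "(f has_field_derivative f' w) (at w within {w. Re w \<ge> ?c} \<inter> cball 0 ?M)"
      using f by (rule has_field_derivative_at_within)
    have M0: "0 \<le> ?M" by (simp add: le_max_iff_disj)
    have "- Re w * s \<le> - ?c * s" using w s by (simp add: mult_right_mono)
    then have "norm w ^ n * B * norm (exp (- (w * complex_of_real s))) \<le> ?M ^ n * B * exp (- ?c * s)"
      unfolding norm_exp_line using w B M0 by (intro mult_mono power_mono mult_nonneg_nonneg zero_le_power) auto
    then show "norm (f' w) \<le> ?M ^ n * B * exp (- ?c * s)" using f'[of w] by linarith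
  qed auto
  then show ?thesis by (simp add: mult_ac)
qed

text \<open>The Green functions \<open>exp (- \<mu> * \<bar>x\<bar>) / (2 * \<mu>)\<close> on the line and \<open>exp (- \<mu> * \<bar>x\<bar>) / (4 * pi * \<bar>x\<bar>)\<close> in
  space.\<close>

definition line0 :: "complex \<Rightarrow> real \<Rightarrow> complex" where
  "line0 \<mu> s = exp (- (\<mu> * of_real s)) / (2 * \<mu>)"
definition line1 :: "complex \<Rightarrow> real \<Rightarrow> complex" where
  "line1 \<mu> s = - exp (- (\<mu> * of_real s)) / 2"
definition line2 :: "complex \<Rightarrow> real \<Rightarrow> complex" where
  "line2 \<mu> s = \<mu> * exp (- (\<mu> * of_real s)) / 2"

lemma line_kernel:
  "helmholtz_kernel TYPE(real) line0 line1 line2 0 (\<lambda>\<mu> \<nu>. 1 / (2 * \<mu>) - 1 / (2 * \<nu>))"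
proof
  show "2 * 0 < DIM(real)" by simp
next
  fix \<mu> :: complex and s :: real assume \<mu>: "Re \<mu> > 0" and s: "s > 0"
  then have "\<mu> \<noteq> 0" by auto
  show "(line0 \<mu> has_vector_derivative line1 \<mu> s) (at s)"
    unfolding line0_def line1_def
    by (rule has_vector_derivative_real_field) (use \<open>\<mu> \<noteq> 0\<close> in \<open>auto intro!: derivative_eq_intros\<close>)
  show "(line1 \<mu> has_vector_derivative line2 \<mu> s) (at s)"
    unfolding line1_def line2_def
    by (rule has_vector_derivative_real_field) (auto intro!: derivative_eq_intros)
  show "line2 \<mu> s + of_nat (DIM(real) - 1) * line1 \<mu> s / complex_of_real s = \<mu>\<^sup>2 * line0 \<mu> s"
    using \<open>\<mu> \<noteq> 0\<close> by (simp add: line2_def line0_def power2_eq_square)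
next
  fix \<mu> :: complex assume \<mu>: "Re \<mu> > 0"
  then have \<mu>0: "\<mu> \<noteq> 0" by auto
  show "continuous_on {0<..} (line2 \<mu>)" unfolding line2_def by (intro continuous_intros) auto
  show "\<exists>K. \<forall>s>0. norm (line0 \<mu> s) \<le> K * decay 0 (Re \<mu>) s"
    by (rule exI[of _ "1 / (4 * norm \<mu>)"]) (simp add: line0_def norm_divide norm_mult norm_exp_line decay_def)
  show "\<exists>K. \<forall>s>0. norm (line1 \<mu> s) \<le> K * decay (DIM(real) - 1) (Re \<mu>) s"
    by (rule exI[of _ 1]) (simp add: line1_def norm_divide norm_exp_line decay_def)
  have eq: "complex_of_real (t ^ DIM(real)) * (line2 \<mu> t - line1 \<mu> t / of_real t) =
      exp (- (\<mu> * of_real t)) * (\<mu> * of_real t + 1) / 2" if "t > 0" for t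
    using that by (simp add: line1_def line2_def field_simps)
  have "((\<lambda>t. exp (- (\<mu> * complex_of_real t)) * (\<mu> * of_real t + 1) / 2) \<longlongrightarrow> exp (- (\<mu> * of_real 0)) * (\<mu> * of_real 0 + 1) / 2) (at_right 0)"
    by (intro tendsto_intros) auto
  then show "((\<lambda>t. of_real (t ^ DIM(real)) * (line2 \<mu> t - line1 \<mu> t / of_real t)) \<longlongrightarrow> complex_of_real (1 / unit_ball_vol (real DIM(real)))) (at_right 0)"
    by (subst tendsto_cong[OF eventually_mono[OF eventually_at_right_less[of 0] eq]]) auto
next
  fix \<mu> :: complex and \<epsilon> :: real and y :: real assume "Re \<mu> > 0" "\<epsilon> > 0"
  have "smooth (\<lambda>x. 1 / (2 * \<mu>) * exp (- \<mu> * complex_of_real (reg_dist \<epsilon> y x)))"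
    by (intro smooth_mult smooth_const smooth_exp_reg_dist \<open>\<epsilon> > 0\<close>)
  then show "smooth (\<lambda>x. line0 \<mu> (reg_dist \<epsilon> y x))" by (simp add: line0_def)
next
  fix \<mu> \<nu> :: complex assume \<mu>: "Re \<mu> > 0" and \<nu>: "Re \<nu> > 0"
  let ?c = "min (Re \<mu>) (Re \<nu>)"
  let ?K = "norm (\<mu> - \<nu>) + 1"
  have nz: "norm \<mu> > 0" "norm \<nu> > 0" using \<mu> \<nu> by auto
  show "\<exists>K. \<forall>s>0. norm (line1 \<mu> s - line1 \<nu> s) \<le> K * decay 0 ?c s \<and> norm (line1 \<mu> s - line1 \<nu> s) / s \<le> K * decay 0 ?c s"
  proof (intro exI allI impI conjI)
    fix s :: real assume s: "s > 0"
    have "norm (line1 \<kappa> s) \<le> decay 0 ?c s / 4" if "?c \<le> Re \<kappa>" for \<kappa>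
      using decay_rate_mono[OF that, of s 0] s by (simp add: line1_def norm_divide norm_exp_line decay_def)
    from this[of \<mu>] this[of \<nu>] have "norm (line1 \<mu> s - line1 \<nu> s) \<le> 1 * decay 0 ?c s"
      using norm_triangle_ineq4[of "line1 \<mu> s" "line1 \<nu> s"] decay_nonneg[of s 0 ?c] s by simp
    also have "\<dots> \<le> ?K * decay 0 ?c s" using s by (intro mult_right_mono decay_nonneg) auto
    finally show "norm (line1 \<mu> s - line1 \<nu> s) \<le> ?K * decay 0 ?c s" .
    let ?e = "exp (- (\<mu> * of_real s)) - exp (- (\<nu> * of_real s))"
    have a: "norm ?e \<le> (max (norm \<mu>) (norm \<nu>)) ^ 0 * norm (\<mu> - \<nu>) * s * exp (- ?c * s)"
      by (rule spectral_difference[where f="\<lambda>w. exp (- (w * of_real s))" and f'="\<lambda>w. - of_real s * exp (- (w * of_real s))", OF \<mu> \<nu> s])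
        (use s in \<open>auto intro!: derivative_eq_intros simp: norm_mult\<close>)
    have b: "norm (line1 \<mu> s - line1 \<nu> s) = norm ?e / 2"
      unfolding line1_def by (simp add: norm_minus_commute norm_divide flip: diff_divide_distrib)
    have "norm (line1 \<mu> s - line1 \<nu> s) / s \<le> norm (\<mu> - \<nu>) * decay 0 ?c s"
    proof -
      have "norm (line1 \<mu> s - line1 \<nu> s) / s = norm ?e / (2 * s)" unfolding b by simp
      also have "\<dots> \<le> ((norm (\<mu> - \<nu>) * exp (- ?c * s)) * s) / (2 * s)"
        using a s by (intro divide_right_mono) (simp_all add: mult_ac)
      also have "\<dots> = (norm (\<mu> - \<nu>) * exp (- ?c * s)) / 2" using s by simp
      also have "\<dots> \<le> norm (\<mu> - \<nu>) * exp (- ?c * s)" by simp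
      also have "\<dots> \<le> norm (\<mu> - \<nu>) * decay 0 ?c s" by (intro mult_left_mono) (auto simp: decay_def)
      finally show ?thesis .
    qed
    also have "\<dots> \<le> ?K * decay 0 ?c s" using s by (intro mult_right_mono decay_nonneg) auto
    finally show "norm (line1 \<mu> s - line1 \<nu> s) / s \<le> ?K * decay 0 ?c s" .
  qed
  have "((\<lambda>s. line0 \<mu> s - line0 \<nu> s) \<longlongrightarrow> line0 \<mu> 0 - line0 \<nu> 0) (at_right 0)"
    unfolding line0_def using nz by (intro tendsto_intros) auto
  then show "((\<lambda>s. line0 \<mu> s - line0 \<nu> s) \<longlongrightarrow> 1 / (2 * \<mu>) - 1 / (2 * \<nu>)) (at_right 0)"
    by (simp add: line0_def)
qed (simp add: line0_def exp_cnj)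

definition space0 :: "complex \<Rightarrow> real \<Rightarrow> complex" where
  "space0 \<mu> s = exp (- (\<mu> * of_real s)) / (4 * of_real pi * of_real s)"
definition space1 :: "complex \<Rightarrow> real \<Rightarrow> complex" where
  "space1 \<mu> s = - exp (- (\<mu> * of_real s)) * (\<mu> * of_real s + 1) / (4 * of_real pi * of_real s ^ 2)"
definition space2 :: "complex \<Rightarrow> real \<Rightarrow> complex" where
  "space2 \<mu> s = exp (- (\<mu> * of_real s)) * ((\<mu> * of_real s)\<^sup>2 + 2 * (\<mu> * of_real s) + 2) / (4 * of_real pi * of_real s ^ 3)"

lemma space_kernel:
  "helmholtz_kernel TYPE(real ^ 3) space0 space1 space2 1 (\<lambda>\<mu> \<nu>. (\<nu> - \<mu>) / (4 * of_real pi))"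
proof
  show "2 * 1 < DIM(real ^ 3)" by simp
next
  fix \<mu> :: complex and s :: real assume \<mu>: "Re \<mu> > 0" and s: "s > 0"
  show "(space0 \<mu> has_vector_derivative space1 \<mu> s) (at s)"
    unfolding space0_def space1_def
    by (rule has_vector_derivative_real_field)
      (use s in \<open>auto intro!: derivative_eq_intros simp: field_simps power2_eq_square\<close>)
  show "(space1 \<mu> has_vector_derivative space2 \<mu> s) (at s)"
    unfolding space1_def space2_def
    by (rule has_vector_derivative_real_field)
      (use s in \<open>auto intro!: derivative_eq_intros simp: field_simps power2_eq_square power3_eq_cube\<close>)
  show "space2 \<mu> s + of_nat (DIM(real ^ 3) - 1) * space1 \<mu> s / complex_of_real s = \<mu>\<^sup>2 * space0 \<mu> s"
    using s by (simp add: space2_def space1_def space0_def field_simps power2_eq_square power3_eq_cube)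
next
  fix \<mu> :: complex assume \<mu>: "Re \<mu> > 0"
  show "continuous_on {0<..} (space2 \<mu>)" unfolding space2_def by (intro continuous_intros) auto
  have pi1: "1 \<le> 4 * pi" using pi_ge_two by linarith
  show "\<exists>K. \<forall>s>0. norm (space0 \<mu> s) \<le> K * decay 1 (Re \<mu>) s"
  proof (intro exI[of _ 1] allI impI)
    fix s :: real assume s: "s > 0"
    have "norm (space0 \<mu> s) = exp (- Re \<mu> * s) * (1 / (4 * pi * s))"
      using s by (simp add: space0_def norm_divide norm_mult norm_exp_line)
    also have "\<dots> \<le> exp (- Re \<mu> * s) * (1 + 1 / s)"
    proof -
      have "1 / (4 * pi * s) \<le> 1 / s" using s pi1 by (intro divide_left_mono) auto
      then show ?thesis by (intro mult_left_mono) auto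
    qed
    finally show "norm (space0 \<mu> s) \<le> 1 * decay 1 (Re \<mu>) s" by (simp add: decay_def)
  qed
  show "\<exists>K. \<forall>s>0. norm (space1 \<mu> s) \<le> K * decay (DIM(real ^ 3) - 1) (Re \<mu>) s"
  proof (intro exI allI impI)
    fix s :: real assume s: "s > 0"
    have "norm (\<mu> * of_real s + 1) \<le> norm \<mu> * s + 1"
      using norm_triangle_ineq[of "\<mu> * of_real s" 1] s by (simp add: norm_mult)
    also have "\<dots> \<le> (norm \<mu> + 1) * (s\<^sup>2 + 1)"
    proof -
      have "s \<le> s\<^sup>2 + 1" using zero_le_power2[of "s - 1"] s by (simp add: power2_diff)
      from mult_left_mono[OF this norm_ge_zero[of \<mu>]] show ?thesis
        using zero_le_power2[of s] unfolding distrib_left distrib_right by linarith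
    qed
    finally have "norm (\<mu> * of_real s + 1) / s\<^sup>2 \<le> (norm \<mu> + 1) * (s\<^sup>2 + 1) / s\<^sup>2"
      by (rule divide_right_mono) simp
    also have "\<dots> = (norm \<mu> + 1) * (1 + 1 / s\<^sup>2)" using s by (simp add: field_simps)
    finally have "norm (\<mu> * of_real s + 1) / s\<^sup>2 \<le> (norm \<mu> + 1) * (1 + 1 / s\<^sup>2)" .
    then have le: "exp (- Re \<mu> * s) * (norm (\<mu> * of_real s + 1) / s\<^sup>2) \<le> exp (- Re \<mu> * s) * ((norm \<mu> + 1) * (1 + 1 / s\<^sup>2))"
      by (rule mult_left_mono) simp
    have "norm (space1 \<mu> s) = exp (- Re \<mu> * s) * (norm (\<mu> * of_real s + 1) / s\<^sup>2) / (4 * pi)"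
      using s unfolding space1_def by (simp add: norm_divide norm_mult norm_exp_line norm_power mult_ac)
    also have "\<dots> \<le> exp (- Re \<mu> * s) * (norm (\<mu> * of_real s + 1) / s\<^sup>2) / 1"
      using pi1 by (intro divide_left_mono mult_nonneg_nonneg) auto
    also have "\<dots> \<le> (norm \<mu> + 1) * decay (DIM(real ^ 3) - 1) (Re \<mu>) s"
      using le by (simp add: decay_def mult.left_commute)
    finally show "norm (space1 \<mu> s) \<le> (norm \<mu> + 1) * decay (DIM(real ^ 3) - 1) (Re \<mu>) s" .
  qed
  have eq: "complex_of_real (t ^ DIM(real ^ 3)) * (space2 \<mu> t - space1 \<mu> t / of_real t) =
      exp (- (\<mu> * of_real t)) * ((\<mu> * of_real t)\<^sup>2 + 3 * (\<mu> * of_real t) + 3) / (4 * of_real pi)" if "t > 0" for t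
    using that by (simp add: space1_def space2_def field_simps power2_eq_square power3_eq_cube)
  have "((\<lambda>t. exp (- (\<mu> * complex_of_real t)) * ((\<mu> * of_real t)\<^sup>2 + 3 * (\<mu> * of_real t) + 3) / (4 * of_real pi)) \<longlongrightarrow>
      exp (- (\<mu> * of_real 0)) * ((\<mu> * of_real 0)\<^sup>2 + 3 * (\<mu> * of_real 0) + 3) / (4 * of_real pi)) (at_right 0)"
    by (intro tendsto_intros) auto
  then show "((\<lambda>t. of_real (t ^ DIM(real ^ 3)) * (space2 \<mu> t - space1 \<mu> t / of_real t)) \<longlongrightarrow> complex_of_real (1 / unit_ball_vol (real DIM(real ^ 3)))) (at_right 0)"
    by (subst tendsto_cong[OF eventually_mono[OF eventually_at_right_less[of 0] eq]]) (auto simp: unit_ball_vol_3)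
next
  fix \<mu> :: complex and \<epsilon> :: real and y :: "real ^ 3" assume "Re \<mu> > 0" "\<epsilon> > 0"
  have "smooth (\<lambda>x. 1 / (4 * pi) * (exp (- \<mu> * complex_of_real (reg_dist \<epsilon> y x)) * complex_of_real (1 / reg_dist \<epsilon> y x)))"
    by (intro smooth_mult smooth_const smooth_exp_reg_dist smooth_inverse_reg_dist \<open>\<epsilon> > 0\<close>)
  then show "smooth (\<lambda>x. space0 \<mu> (reg_dist \<epsilon> y x))" by (simp add: space0_def)
next
  fix \<mu> \<nu> :: complex assume \<mu>: "Re \<mu> > 0" and \<nu>: "Re \<nu> > 0"
  let ?c = "min (Re \<mu>) (Re \<nu>)" and ?M = "max (norm \<mu>) (norm \<nu>)"
  let ?K = "?M ^ 1 * norm (\<mu> - \<nu>)"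
  have pi1: "1 \<le> 4 * pi" using pi_ge_two by linarith
  have K0: "0 \<le> ?K" by (intro mult_nonneg_nonneg zero_le_power) (auto simp: le_max_iff_disj)
  show "\<exists>K. \<forall>s>0. norm (space1 \<mu> s - space1 \<nu> s) \<le> K * decay 1 ?c s \<and> norm (space1 \<mu> s - space1 \<nu> s) / s \<le> K * decay 1 ?c s"
  proof (rule exI[of _ ?K], intro allI impI)
    fix s :: real assume s: "s > 0"
    let ?a = "exp (- (\<mu> * of_real s)) * (\<mu> * s + 1) - exp (- (\<nu> * of_real s)) * (\<nu> * s + 1)"
    have a: "norm ?a \<le> ?M ^ 1 * norm (\<mu> - \<nu>) * s ^ 2 * exp (- ?c * s)"
      by (rule spectral_difference[where f="\<lambda>w. exp (- (w * of_real s)) * (w * s + 1)" and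
            f'="\<lambda>w. - w * of_real (s ^ 2) * exp (- (w * of_real s))", OF \<mu> \<nu> s])
        (use s in \<open>auto intro!: derivative_eq_intros simp: norm_mult norm_power algebra_simps power2_eq_square\<close>)
    have "space1 \<mu> s - space1 \<nu> s = - (?a / (4 * complex_of_real pi * complex_of_real s ^ 2))"
      by (simp add: space1_def diff_divide_distrib)
    then have "norm (space1 \<mu> s - space1 \<nu> s) = norm ?a / (4 * pi * s ^ 2)"
      using s by (simp only: norm_minus_cancel norm_divide) (simp add: norm_mult norm_power)
    also have "\<dots> \<le> norm ?a / (1 * s ^ 2)"
      using s pi1 by (intro divide_left_mono mult_right_mono) auto
    also have "\<dots> \<le> ?K * exp (- ?c * s)" using a s by (simp add: divide_le_eq mult_ac)
    finally have 1: "norm (space1 \<mu> s - space1 \<nu> s) \<le> ?K * exp (- ?c * s)" .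
    have dec: "exp (- ?c * s) \<le> decay 1 ?c s" "exp (- ?c * s) / s \<le> decay 1 ?c s"
      unfolding decay_def using s by (simp_all add: distrib_left)
    have "norm (space1 \<mu> s - space1 \<nu> s) / s \<le> ?K * (exp (- ?c * s) / s)"
      using divide_right_mono[OF 1, of s] s by simp
    with 1 show "norm (space1 \<mu> s - space1 \<nu> s) \<le> ?K * decay 1 ?c s \<and> norm (space1 \<mu> s - space1 \<nu> s) / s \<le> ?K * decay 1 ?c s"
      using mult_left_mono[OF dec(1) K0] mult_left_mono[OF dec(2) K0] by (meson order_trans)
  qed
  have "((\<lambda>w. exp (- (\<mu> * w)) - exp (- (\<nu> * w))) has_field_derivative (\<nu> - \<mu>)) (at 0)"
    by (auto intro!: derivative_eq_intros)
  then have "((\<lambda>h. (exp (- (\<mu> * h)) - exp (- (\<nu> * h))) / h) \<longlongrightarrow> \<nu> - \<mu>) (at 0)"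
    by (simp add: DERIV_def)
  moreover have "filterlim complex_of_real (at 0) (at_right 0)"
    unfolding filterlim_at by (auto simp: eventually_at_filter intro!: tendsto_eq_intros)
  ultimately have "((\<lambda>s. (exp (- (\<mu> * complex_of_real s)) - exp (- (\<nu> * complex_of_real s))) / complex_of_real s) \<longlongrightarrow> \<nu> - \<mu>) (at_right 0)"
    by (auto dest: filterlim_compose)
  from tendsto_divide[OF this tendsto_const[of "4 * complex_of_real pi"]]
  show "((\<lambda>s. space0 \<mu> s - space0 \<nu> s) \<longlongrightarrow> (\<nu> - \<mu>) / (4 * complex_of_real pi)) (at_right 0)"
    by (simp add: space0_def diff_divide_distrib mult.commute)
qed (simp add: space0_def exp_cnj)

interpretation line: helmholtz_kernel "TYPE(real)" line0 line1 line2 0 "\<lambda>\<mu> \<nu>. 1 / (2 * \<mu>) - 1 / (2 * \<nu>)"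
  by (rule line_kernel)

interpretation space: helmholtz_kernel "TYPE(real ^ 3)" space0 space1 space2 1 "\<lambda>\<mu> \<nu>. (\<nu> - \<mu>) / (4 * of_real pi)"
  by (rule space_kernel)

section \<open>The eigenvalues\<close>

text \<open>With \<open>k = - \<alpha> * (1 + \<i>) / 2\<close>, the values \<open>\<mu> = - \<i> * k\<close> and \<open>\<nu> = k\<close> solve \<open>\<nu>\<^sup>2 = - \<mu>\<^sup>2\<close> and the condition
  of \<open>eigenvalue_if\<close>. The assumption on \<open>\<alpha>\<close> says that both have positive real part.\<close>

lemma eigenvalue_dim3:
  assumes \<alpha>: "Re \<alpha> < - \<bar>Im \<alpha>\<bar>"
  shows "- (1 / 4) * \<alpha> ^ 4 \<in> point_spectrum (H_delta (4 * of_real pi * \<alpha>) ::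
    (real ^ 3 \<Rightarrow> complex) \<Rightarrow> (real ^ 3 \<Rightarrow> complex) \<Rightarrow> bool)"
proof -
  define \<mu> \<nu> where "\<mu> = - \<alpha> * (1 - \<i>) / 2" and "\<nu> = - \<alpha> * (1 + \<i>) / 2"
  have "Re \<mu> > 0" "Re \<nu> > 0" using \<alpha> by (auto simp: \<mu>_def \<nu>_def)
  moreover have sq: "\<mu>\<^sup>2 = - \<i> * \<alpha>\<^sup>2 / 2" "\<nu>\<^sup>2 = \<i> * \<alpha>\<^sup>2 / 2"
    by (simp_all add: \<mu>_def \<nu>_def power2_eq_square algebra_simps)
  moreover have "4 * of_real pi * \<alpha> * ((\<nu> - \<mu>) / (4 * of_real pi)) = 2 * \<mu>\<^sup>2"
    unfolding sq by (simp add: \<mu>_def \<nu>_def power2_eq_square field_simps)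
  ultimately have "\<mu> ^ 4 \<in> point_spectrum (H_delta (4 * of_real pi * \<alpha>) ::
      (real ^ 3 \<Rightarrow> complex) \<Rightarrow> (real ^ 3 \<Rightarrow> complex) \<Rightarrow> bool)"
    by (intro space.eigenvalue_if) auto
  moreover have "\<mu> ^ 4 = - (1 / 4) * \<alpha> ^ 4"
  proof -
    have "\<mu> ^ 4 = (\<mu>\<^sup>2)\<^sup>2" by simp
    also have "\<dots> = - (1 / 4) * \<alpha> ^ 4" unfolding sq by (simp add: power_mult_distrib power_divide)
    finally show ?thesis .
  qed
  ultimately show ?thesis by simp
qed

lemma line_green_norm:
  assumes "Re \<mu> \<ge> c" "Re \<nu> \<ge> c" "c > 0" and k: "norm \<mu> = r" "norm \<nu> = r"
  shows "l2_norm (line.green \<mu> \<nu> y) \<le> 1 / (r * sqrt c)"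
proof -
  have r: "r > 0" using assms by auto
  have "Re \<mu> > 0" "Re \<nu> > 0" using assms by auto
  then have UL2: "line.green \<mu> \<nu> y \<in> L2" by (intro H2_L2 line.green_H2)
  have le: "(norm (line.green \<mu> \<nu> y x))\<^sup>2 \<le> (1 / r\<^sup>2) * exp (- 2 * c * norm (x - y))" for x
  proof -
    have "norm (line0 \<kappa> (norm (x - y))) \<le> exp (- c * norm (x - y)) / (2 * r)" if "Re \<kappa> \<ge> c" "norm \<kappa> = r" for \<kappa>
      unfolding line0_def norm_divide norm_exp_line norm_mult
      using that r by (auto intro!: divide_right_mono mult_right_mono)
    then have "norm (line.green \<mu> \<nu> y x) \<le> exp (- c * norm (x - y)) / (2 * r) + exp (- c * norm (x - y)) / (2 * r)"
      unfolding line.green_def using assms by (intro order_trans[OF norm_triangle_ineq4] add_mono) auto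
    then have "norm (line.green \<mu> \<nu> y x) \<le> exp (- c * norm (x - y)) / r" using r by (simp add: field_simps)
    from power_mono[OF this, of 2] show ?thesis
      by (simp add: power_divide exp_double[symmetric] mult.assoc)
  qed
  have nn: "(\<integral>\<^sup>+x. ennreal (exp (- 2 * c * norm (x::real))) \<partial>lborel) = ennreal (1 / c)"
  proof -
    have "(\<integral>\<^sup>+x. ennreal (exp (- 2 * c * norm (x::real))) \<partial>lborel) =
        (\<integral>\<^sup>+r. ennreal (unit_ball_vol DIM(real) * DIM(real) * r ^ (DIM(real) - 1)) * indicator {0..} r * ennreal (exp (- 2 * c * r)) \<partial>lborel)"
      by (rule nn_integral_radial) measurable
    also have "\<dots> = (\<integral>\<^sup>+r. ennreal (2 * exp (- 2 * c * r)) * indicator {0..} r \<partial>lborel)"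
      by (intro nn_integral_cong) (auto simp: ennreal_mult split: split_indicator)
    also have "\<dots> = ennreal (0 - (- exp (- 2 * c * 0) / c))"
    proof (rule nn_integral_FTC_atLeast)
      show "((\<lambda>r. - exp (- 2 * c * r) / c) \<longlongrightarrow> 0) at_top" using assms(3) by real_asymp
    qed (use assms(3) in \<open>auto intro!: derivative_eq_intros\<close>)
    finally show ?thesis by simp
  qed
  have int: "integrable lborel (\<lambda>x::real. exp (- 2 * c * norm x))"
    by (rule integrableI_nonneg) (use nn in auto)
  have val: "(LINT x|lborel. exp (- 2 * c * norm (x::real))) = 1 / c"
    by (rule integral_eq_nn_integral[THEN trans]) (use nn assms(3) in auto)
  have eq: "exp (- 2 * c * norm (x - y)) = (\<lambda>x. exp (- 2 * c * norm x)) (- y + x)" for x by simp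
  have "(LINT x|lborel. (norm (line.green \<mu> \<nu> y x))\<^sup>2) \<le> (LINT x|lborel. (1 / r\<^sup>2) * exp (- 2 * c * norm (x - y)))"
  proof (rule integral_mono)
    show "integrable lborel (\<lambda>x. (1 / r\<^sup>2) * exp (- 2 * c * norm (x - y)))"
      unfolding eq by (intro integrable_mult_right, subst integrable_translate) (use int in auto)
  qed (use le L2_integrable_sq[OF UL2] in auto)
  also have "\<dots> = (1 / r\<^sup>2) * (1 / c)"
    unfolding eq integral_mult_right_zero by (subst integral_translate) (use val in auto)
  finally have "l2_norm (line.green \<mu> \<nu> y) \<le> sqrt ((1 / r\<^sup>2) * (1 / c))"
    unfolding l2_norm_def by (rule real_sqrt_le_mono)
  also have "\<dots> = 1 / (r * sqrt c)" using r by (simp add: real_sqrt_mult real_sqrt_divide)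
  finally show ?thesis .
qed

text \<open>For \<^term>\<open>k\<close> on the boundary of the quadrant the Green function leaves \<^const>\<open>L2\<close>, so the
  equation is used at nearby interior points, for \<open>k\<close> shifted by \<open>eps n * (1 + \<i>)\<close>. There the
  right-hand side is of order \<open>eps n\<close> times the norm of the Green function, which grows only like
  \<open>1 / sqrt (eps n)\<close>.\<close>

lemma eigenfunction_estimate:
  fixes k :: complex and \<psi> :: "real \<Rightarrow> complex"
  assumes \<psi>: "H_delta \<alpha> \<psi> (\<lambda>x. z * \<psi> x)" and k: "Re k \<ge> 0" "Im k \<ge> 0" "k ^ 4 = z"
  defines "\<kappa> \<equiv> \<lambda>n. k + of_real (eps n) * (1 + \<i>)"
  shows "Re (\<kappa> n) \<ge> eps n" "Im (\<kappa> n) \<ge> eps n"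
    and "norm (\<alpha> * continuous_rep (line.green (- \<i> * \<kappa> n) (\<kappa> n) y) 0 * continuous_rep \<psi> 0 + 2 * (\<kappa> n)\<^sup>2 * continuous_rep \<psi> y)
      \<le> 8 * (norm (\<kappa> n))\<^sup>2 * sqrt (eps n) * l2_norm \<psi>"
proof -
  let ?\<kappa> = "\<kappa> n" and ?e = "eps n"
  have e: "?e > 0" by (rule eps)
  show re: "Re ?\<kappa> \<ge> ?e" and im: "Im ?\<kappa> \<ge> ?e" using k by (auto simp: \<kappa>_def)
  have \<mu>: "Re (- \<i> * ?\<kappa>) > 0" and \<nu>: "Re ?\<kappa> > 0" using re im e by auto
  have sq: "?\<kappa>\<^sup>2 = - (- \<i> * ?\<kappa>)\<^sup>2" by (simp add: power_mult_distrib)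
  have p4: "(- \<i> * ?\<kappa>) ^ 4 = ?\<kappa> ^ 4" by (simp add: power_mult_distrib)
  have \<psi>L2: "\<psi> \<in> L2" using \<psi> by (auto simp: H_delta_def H2_L2)
  have UL2: "line.green (- \<i> * ?\<kappa>) ?\<kappa> y \<in> L2" by (intro H2_L2 line.green_H2 \<mu> \<nu>)
  have nk: "norm ?\<kappa> > 0" using \<nu> by auto
  have "norm k \<le> norm ?\<kappa>"
    unfolding cmod_def using k e by (intro real_sqrt_le_mono add_mono power_mono) (auto simp: \<kappa>_def)
  then have pk: "norm k ^ j \<le> norm ?\<kappa> ^ j" for j by (intro power_mono) auto
  have diff: "norm (z - ?\<kappa> ^ 4) \<le> 8 * ?e * norm ?\<kappa> ^ 3"
  proof -
    have eq: "z - ?\<kappa> ^ 4 = (k - ?\<kappa>) * (k ^ 3 + k\<^sup>2 * ?\<kappa> + k * ?\<kappa>\<^sup>2 + ?\<kappa> ^ 3)"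
      unfolding k(3)[symmetric] by (simp add: algebra_simps power2_eq_square power3_eq_cube power4_eq_xxxx)
    have b1: "norm (k - ?\<kappa>) \<le> 2 * ?e"
    proof -
      have "norm (k - ?\<kappa>) = ?e * norm (1 + \<i>)" using e by (simp add: \<kappa>_def norm_mult)
      also have "\<dots> \<le> ?e * 2" using norm_triangle_ineq[of 1 \<i>] e by (intro mult_left_mono) auto
      finally show ?thesis by simp
    qed
    have b2: "norm (k ^ 3 + k\<^sup>2 * ?\<kappa> + k * ?\<kappa>\<^sup>2 + ?\<kappa> ^ 3) \<le> 4 * norm ?\<kappa> ^ 3"
    proof -
      have "norm (k ^ 3 + k\<^sup>2 * ?\<kappa> + k * ?\<kappa>\<^sup>2 + ?\<kappa> ^ 3) \<le>
          norm k ^ 3 + norm k ^ 2 * norm ?\<kappa> + norm k ^ 1 * norm ?\<kappa> ^ 2 + norm ?\<kappa> ^ 3"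
        by (intro order_trans[OF norm_triangle_ineq] add_mono) (auto simp: norm_mult norm_power)
      also have "\<dots> \<le> norm ?\<kappa> ^ 3 + norm ?\<kappa> ^ 2 * norm ?\<kappa> + norm ?\<kappa> ^ 1 * norm ?\<kappa> ^ 2 + norm ?\<kappa> ^ 3"
        by (intro add_mono mult_right_mono pk) auto
      also have "\<dots> = 4 * norm ?\<kappa> ^ 3" by (simp add: power2_eq_square power3_eq_cube)
      finally show ?thesis .
    qed
    have "norm (z - ?\<kappa> ^ 4) \<le> (2 * ?e) * (4 * norm ?\<kappa> ^ 3)"
      unfolding eq norm_mult by (rule mult_mono[OF b1 b2]) (use e in auto)
    then show ?thesis by simp
  qed
  have "norm (LINT x|lborel. \<psi> x * line.green (- \<i> * ?\<kappa>) ?\<kappa> y x) \<le> l2_norm \<psi> * (1 / (norm ?\<kappa> * sqrt ?e))"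
    by (rule order_trans[OF L2_Cauchy_Schwarz[OF \<psi>L2 UL2] mult_left_mono[OF line_green_norm]])
      (use re im e in \<open>auto simp: norm_mult\<close>)
  then have "norm ((z - ?\<kappa> ^ 4) * (LINT x|lborel. \<psi> x * line.green (- \<i> * ?\<kappa>) ?\<kappa> y x)) \<le>
      (8 * ?e * norm ?\<kappa> ^ 3) * (l2_norm \<psi> * (1 / (norm ?\<kappa> * sqrt ?e)))"
    unfolding norm_mult using diff e by (intro mult_mono) auto
  also have "\<dots> = 8 * (norm ?\<kappa>)\<^sup>2 * sqrt ?e * l2_norm \<psi>"
  proof -
    have "?e = sqrt ?e * sqrt ?e" using e by simp
    then have "?e / sqrt ?e = sqrt ?e" using e by (metis nonzero_mult_div_cancel_left real_sqrt_eq_zero_cancel_iff less_irrefl)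
    moreover have "(8 * ?e * norm ?\<kappa> ^ 3) * (l2_norm \<psi> * (1 / (norm ?\<kappa> * sqrt ?e))) =
        8 * (norm ?\<kappa>)\<^sup>2 * (?e / sqrt ?e) * l2_norm \<psi>"
      using nk by (simp add: field_simps power2_eq_square power3_eq_cube)
    ultimately show ?thesis by simp
  qed
  finally show "norm (\<alpha> * continuous_rep (line.green (- \<i> * ?\<kappa>) ?\<kappa> y) 0 * continuous_rep \<psi> 0 + 2 * ?\<kappa>\<^sup>2 * continuous_rep \<psi> y)
      \<le> 8 * (norm ?\<kappa>)\<^sup>2 * sqrt ?e * l2_norm \<psi>"
    using line.eigenfunction_equation[OF \<psi> \<mu> \<nu> sq, of y] unfolding p4 by (simp add: power_mult_distrib)
qed

text \<open>The choice of \<open>k\<close> among the fourth roots of \<open>z\<close> in the closed quadrant is left open. There are two of them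
  if \<open>z > 0\<close>, and the two conditions exclude each other: positive numbers are no eigenvalues.\<close>

lemma eigenvalue_condition:
  fixes k :: complex and \<psi> :: "real \<Rightarrow> complex"
  assumes \<psi>: "H_delta \<alpha> \<psi> (\<lambda>x. z * \<psi> x)" and k: "Re k \<ge> 0" "Im k \<ge> 0" "k ^ 4 = z"
  shows "(4 * k ^ 3 - \<alpha> * (1 - \<i>)) * continuous_rep \<psi> 0 = 0"
    and "continuous_rep \<psi> 0 = 0 \<Longrightarrow> continuous_rep \<psi> y = 0"
proof -
  define \<kappa> where "\<kappa> n = k + of_real (eps n) * (1 + \<i>)" for n
  note est = eigenfunction_estimate[OF \<psi> k, folded \<kappa>_def]
  have nz: "\<kappa> n \<noteq> 0" for n using est(1)[of n] eps(1)[of n] by auto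
  have \<kappa>lim: "\<kappa> \<longlonglongrightarrow> k"
  proof -
    have "\<kappa> \<longlonglongrightarrow> k + of_real 0 * (1 + \<i>)" unfolding \<kappa>_def by (intro tendsto_intros eps)
    then show ?thesis by simp
  qed
  have slim: "(\<lambda>n. sqrt (eps n)) \<longlonglongrightarrow> 0" using tendsto_real_sqrt[OF eps(3)] by simp
  have bound: "norm ((4 * \<kappa> n ^ 3 - \<alpha> * (1 - \<i>)) * continuous_rep \<psi> 0) \<le> 16 * norm (\<kappa> n) ^ 3 * sqrt (eps n) * l2_norm \<psi>" for n
  proof -
    have pos: "Re (- \<i> * \<kappa> n) > 0" "Re (\<kappa> n) > 0" using est(1,2)[of n] eps(1)[of n] by auto
    have rep: "continuous_rep (line.green (- \<i> * \<kappa> n) (\<kappa> n) 0) 0 = (\<i> - 1) / (2 * \<kappa> n)"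
      unfolding line.continuous_rep_green[OF pos] using nz[of n] by (simp add: field_simps)
    have "(4 * \<kappa> n ^ 3 - \<alpha> * (1 - \<i>)) * continuous_rep \<psi> 0 =
        2 * \<kappa> n * (\<alpha> * continuous_rep (line.green (- \<i> * \<kappa> n) (\<kappa> n) 0) 0 * continuous_rep \<psi> 0 + 2 * (\<kappa> n)\<^sup>2 * continuous_rep \<psi> 0)"
      unfolding rep using nz[of n] by (simp add: field_simps power2_eq_square power3_eq_cube)
    also have "norm \<dots> \<le> 2 * norm (\<kappa> n) * (8 * (norm (\<kappa> n))\<^sup>2 * sqrt (eps n) * l2_norm \<psi>)"
      unfolding norm_mult[of "2 * \<kappa> n"] using est(3)[of n 0] by (intro mult_mono) (auto simp: norm_mult)
    finally show ?thesis by (simp add: power2_eq_square power3_eq_cube mult_ac)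
  qed
  have "(\<lambda>n. 16 * norm (\<kappa> n) ^ 3 * sqrt (eps n) * l2_norm \<psi>) \<longlonglongrightarrow> 16 * norm k ^ 3 * 0 * l2_norm \<psi>"
    by (intro tendsto_intros \<kappa>lim slim)
  then have "(\<lambda>n. 16 * norm (\<kappa> n) ^ 3 * sqrt (eps n) * l2_norm \<psi>) \<longlonglongrightarrow> 0" by simp
  from Lim_null_comparison[OF always_eventually[OF allI[OF bound]] this]
  have "(\<lambda>n. (4 * \<kappa> n ^ 3 - \<alpha> * (1 - \<i>)) * continuous_rep \<psi> 0) \<longlonglongrightarrow> 0" .
  moreover have "(\<lambda>n. (4 * \<kappa> n ^ 3 - \<alpha> * (1 - \<i>)) * continuous_rep \<psi> 0) \<longlonglongrightarrow> (4 * k ^ 3 - \<alpha> * (1 - \<i>)) * continuous_rep \<psi> 0"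
    by (intro tendsto_intros \<kappa>lim)
  ultimately show "(4 * k ^ 3 - \<alpha> * (1 - \<i>)) * continuous_rep \<psi> 0 = 0"
    using LIMSEQ_unique by blast
  show "continuous_rep \<psi> y = 0" if 0: "continuous_rep \<psi> 0 = 0"
  proof -
    have "norm (continuous_rep \<psi> y) \<le> 4 * sqrt (eps n) * l2_norm \<psi>" for n
      using est(3)[of n y] nz[of n] by (simp add: 0 norm_mult norm_power mult_ac)
    moreover have "(\<lambda>n. 4 * sqrt (eps n) * l2_norm \<psi>) \<longlonglongrightarrow> 4 * 0 * l2_norm \<psi>"
      by (intro tendsto_intros slim)
    ultimately have "norm (continuous_rep \<psi> y) \<le> 0"
      by (intro LIMSEQ_le_const[where X="\<lambda>n. 4 * sqrt (eps n) * l2_norm \<psi>"]) auto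
    then show ?thesis by simp
  qed
qed

lemma fourth_root_quadrant:
  obtains k :: complex where "Re k \<ge> 0" "Im k \<ge> 0" "k ^ 4 = z"
proof
  define k where "k = of_real (root 4 (norm z)) * exp (\<i> * of_real (Arg2pi z / 4))"
  have a: "0 \<le> Arg2pi z / 4" "Arg2pi z / 4 \<le> pi / 2" using Arg2pi[of z] by auto
  show "Re k \<ge> 0" "Im k \<ge> 0"
    using a by (auto simp: k_def Re_exp Im_exp intro!: mult_nonneg_nonneg cos_ge_zero sin_ge_zero)
  have "k ^ 4 = of_real (root 4 (norm z) ^ 4) * exp (of_nat 4 * (\<i> * of_real (Arg2pi z / 4)))"
    by (simp only: k_def power_mult_distrib exp_of_nat_mult of_real_power)
  also have "root 4 (norm z) ^ 4 = norm z" by (simp add: real_root_pow_pos2)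
  also have "of_real (norm z) * exp (of_nat 4 * (\<i> * of_real (Arg2pi z / 4))) = z"
    using Arg2pi_eq[of z] by simp
  finally show "k ^ 4 = z" .
qed

text \<open>The quotient would be a cube root of unity with positive real part. The proof multiplies by \<open>(norm l)\<^sup>2\<close>
  to avoid the division.\<close>

lemma cube_eq_in_quadrant:
  assumes "Re k > 0" "Im k > 0" "Re l > 0" "Im l > 0" "k ^ 3 = l ^ 3"
  shows "k = (l :: complex)"
proof (rule ccontr)
  assume "k \<noteq> l"
  have l: "l \<noteq> 0" using assms by auto
  define w where "w = k * cnj l"
  have w: "Re w > 0" unfolding w_def using assms by (simp add: add_pos_pos)
  define r where "r = (norm l)\<^sup>2"
  have r: "r > 0" using l by (simp add: r_def)
  have rl: "of_real r = l * cnj l" unfolding r_def by (rule complex_norm_square)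
  have "(w - of_real r) * (w\<^sup>2 + w * of_real r + (of_real r)\<^sup>2) = w ^ 3 - (of_real r) ^ 3"
    by (simp add: algebra_simps power2_eq_square power3_eq_cube)
  also have "\<dots> = 0" unfolding rl w_def power_mult_distrib assms(5) by simp
  finally have "w = of_real r \<or> w\<^sup>2 + w * of_real r + (of_real r)\<^sup>2 = 0" by simp
  then show False
  proof
    assume "w = of_real r"
    then show False using \<open>k \<noteq> l\<close> l by (simp add: rl w_def)
  next
    assume 0: "w\<^sup>2 + w * of_real r + (of_real r)\<^sup>2 = 0"
    have "Im w * (2 * Re w + r) = Im (w\<^sup>2 + w * of_real r + (of_real r)\<^sup>2)"
      by (simp add: power2_eq_square algebra_simps)
    then have "Im w = 0" using w r unfolding 0 by auto
    then have "(Re w)\<^sup>2 + Re w * r + r\<^sup>2 = Re (w\<^sup>2 + w * of_real r + (of_real r)\<^sup>2)"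
      by (simp add: power2_eq_square)
    also have "\<dots> = 0" unfolding 0 by simp
    finally show False using w r by (smt (verit) mult_pos_pos zero_le_power2)
  qed
qed

text \<open>The standard argument in \<open>[0, 2 * pi)\<close> lies in the range of the branch, because \<open>cos t \<ge> \<bar>sin t\<bar>\<close> at all
  other points.\<close>

lemma arg_branch:
  assumes "Re \<alpha> < \<bar>Im \<alpha>\<bar>"
  shows "pi / 4 < arg_branch \<alpha>" "arg_branch \<alpha> < 7 * pi / 4" "\<alpha> = of_real (norm \<alpha>) * exp (\<i> * of_real (arg_branch \<alpha>))"
proof -
  have nz: "\<alpha> \<noteq> 0" using assms by auto
  let ?t = "Arg2pi \<alpha>"
  have range: "0 \<le> ?t" "?t < 2 * pi" and arg: "is_Arg \<alpha> ?t" using Arg2pi[of \<alpha>] by auto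
  have cs: "Re \<alpha> = norm \<alpha> * cos ?t" "Im \<alpha> = norm \<alpha> * sin ?t" by (simp_all add: cos_Arg2pi sin_Arg2pi)
  have key: "cos s \<ge> \<bar>sin s\<bar>" if "0 \<le> s" "s \<le> pi / 4" for s :: real
  proof -
    have "cos s \<ge> cos (pi / 4)" using that by (intro cos_monotone_0_pi_le) auto
    moreover have "sin s \<le> sin (pi / 4)" using that by (intro sin_monotone_2pi_le) auto
    moreover have "sin s \<ge> 0" using that by (intro sin_ge_zero) auto
    ultimately show ?thesis by (simp add: sin_45 cos_45)
  qed
  have no: "\<not> cos ?t \<ge> \<bar>sin ?t\<bar>"
  proof
    assume "cos ?t \<ge> \<bar>sin ?t\<bar>"
    then have "norm \<alpha> * \<bar>sin ?t\<bar> \<le> norm \<alpha> * cos ?t" by (intro mult_left_mono) auto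
    then show False using assms unfolding cs by (simp add: abs_mult)
  qed
  have 1: "pi / 4 < ?t" using key[of ?t] no range by linarith
  have 2: "?t < 7 * pi / 4"
  proof (rule ccontr)
    assume "\<not> ?t < 7 * pi / 4"
    then have "cos (2 * pi - ?t) \<ge> \<bar>sin (2 * pi - ?t)\<bar>" using range by (intro key) auto
    then show False using no by (simp add: cos_diff sin_diff)
  qed
  have "arg_branch \<alpha> = ?t"
    unfolding arg_branch_def
  proof (rule the_equality)
    fix t assume t: "pi / 4 < t \<and> t < 7 * pi / 4 \<and> is_Arg \<alpha> t"
    show "t = ?t" by (rule is_Arg_eqI[OF _ arg _ nz]) (use t 1 2 in auto)
  qed (use 1 2 arg in auto)
  then show "pi / 4 < arg_branch \<alpha>" "arg_branch \<alpha> < 7 * pi / 4" "\<alpha> = of_real (norm \<alpha>) * exp (\<i> * of_real (arg_branch \<alpha>))"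
    using 1 2 arg by (auto simp: is_Arg_def)
qed

text \<open>While \<open>k\<close> runs through the open quadrant, the argument of \<open>4 k\<^sup>3 / (1 - \<i>)\<close> runs through the interval from
  \<open>pi / 4\<close> to \<open>7 * pi / 4\<close>. This is the origin of the branch in \<^const>\<open>pow_four_thirds\<close>.\<close>

lemma spectral_parameter:
  assumes \<alpha>: "Re \<alpha> < \<bar>Im \<alpha>\<bar>"
  obtains k where "Re k > 0" "Im k > 0" "4 * k ^ 3 = \<alpha> * (1 - \<i>)"
    "k ^ 4 = 1 / 4 * pow_four_thirds \<alpha> * exp (- \<i> * of_real pi / 3)"
proof
  let ?t = "arg_branch \<alpha>"
  note t = arg_branch[OF \<alpha>]
  have n0: "norm \<alpha> > 0" using \<alpha> by auto
  define r where "r = norm \<alpha> powr (1 / 3) / sqrt 2"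
  define k where "k = of_real r * exp (\<i> * of_real ((?t - pi / 4) / 3))"
  have r: "r > 0" using n0 by (simp add: r_def)
  show "Re k > 0" "Im k > 0"
    using t(1,2) r by (auto simp: k_def Re_exp Im_exp intro!: mult_pos_pos cos_gt_zero_pi sin_gt_zero)
  have s3: "sqrt 2 ^ 3 = 2 * sqrt (2::real)" "sqrt 2 ^ 4 = (4::real)" by (simp_all add: power3_eq_cube power4_eq_xxxx)
  have p: "(norm \<alpha> powr (1 / 3)) ^ j = norm \<alpha> powr (real j / 3)" for j
    using n0 by (simp add: powr_powr flip: powr_realpow)
  have r3: "r ^ 3 = norm \<alpha> / (2 * sqrt 2)" and r4: "r ^ 4 = norm \<alpha> powr (4 / 3) / 4"
    using n0 by (simp_all add: r_def power_divide s3 p)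
  have kp: "k ^ j = of_real (r ^ j) * exp (of_nat j * (\<i> * of_real ((?t - pi / 4) / 3)))" for j
    unfolding k_def power_mult_distrib exp_of_nat_mult by simp
  have e1: "1 - \<i> = of_real (sqrt 2) * exp (- (\<i> * of_real (pi / 4)))"
    by (simp add: complex_eq_iff Re_exp Im_exp cos_45 sin_45)
  have e3: "of_nat 3 * (\<i> * complex_of_real ((?t - pi / 4) / 3)) = \<i> * of_real ?t + (- (\<i> * of_real (pi / 4)))"
    by (simp add: field_simps)
  have "4 * k ^ 3 = 4 * of_real (r ^ 3) * (exp (\<i> * of_real ?t) * exp (- (\<i> * of_real (pi / 4))))"
    unfolding kp[of 3] e3 exp_add[symmetric] by (simp only: mult.assoc)
  also have "4 * r ^ 3 = norm \<alpha> * sqrt 2" unfolding r3 by (simp add: field_simps)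
  then have "4 * complex_of_real (r ^ 3) = of_real (norm \<alpha>) * of_real (sqrt 2)"
    by (metis of_real_mult of_real_numeral)
  then have "4 * of_real (r ^ 3) * (exp (\<i> * of_real ?t) * exp (- (\<i> * of_real (pi / 4)))) =
      (of_real (norm \<alpha>) * exp (\<i> * of_real ?t)) * (of_real (sqrt 2) * exp (- (\<i> * of_real (pi / 4))))"
    by (simp only: mult_ac)
  also have "\<dots> = \<alpha> * (1 - \<i>)" unfolding t(3)[symmetric] e1 ..
  finally show "4 * k ^ 3 = \<alpha> * (1 - \<i>)" .
  have e4: "of_nat 4 * (\<i> * of_real ((?t - pi / 4) / 3)) = 4 / 3 * \<i> * of_real ?t + (- \<i> * of_real pi / 3)"
    by (simp add: field_simps)
  show "k ^ 4 = 1 / 4 * pow_four_thirds \<alpha> * exp (- \<i> * of_real pi / 3)"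
    unfolding kp[of 4] r4 pow_four_thirds_def e4 exp_add by simp
qed

lemma point_spectrum_dim1:
  assumes \<alpha>: "Re \<alpha> < \<bar>Im \<alpha>\<bar>"
  shows "point_spectrum (H_delta \<alpha> :: (real \<Rightarrow> complex) \<Rightarrow> (real \<Rightarrow> complex) \<Rightarrow> bool)
    = {1 / 4 * pow_four_thirds \<alpha> * exp (- \<i> * of_real pi / 3)}"
proof -
  obtain l where l: "Re l > 0" "Im l > 0" "4 * l ^ 3 = \<alpha> * (1 - \<i>)"
    and l4: "l ^ 4 = 1 / 4 * pow_four_thirds \<alpha> * exp (- \<i> * of_real pi / 3)"
    using spectral_parameter[OF \<alpha>] by blast
  have nz: "l \<noteq> 0" "\<alpha> \<noteq> 0" using l \<alpha> by auto
  have "(- \<i> * l) ^ 4 \<in> point_spectrum (H_delta \<alpha> :: (real \<Rightarrow> complex) \<Rightarrow> (real \<Rightarrow> complex) \<Rightarrow> bool)"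
  proof (rule line.eigenvalue_if[where \<nu>=l])
    have "\<alpha> * (1 / (2 * (- \<i> * l)) - 1 / (2 * l)) = - (\<alpha> * (1 - \<i>)) / (2 * l)"
      using nz by (simp add: field_simps)
    also have "\<dots> = 2 * (- \<i> * l)\<^sup>2"
      unfolding l(3)[symmetric] using nz by (simp add: power_mult_distrib power2_eq_square power3_eq_cube)
    finally show "\<alpha> * (1 / (2 * (- \<i> * l)) - 1 / (2 * l)) = 2 * (- \<i> * l)\<^sup>2" .
  qed (use l in \<open>auto simp: power_mult_distrib\<close>)
  then have "l ^ 4 \<in> point_spectrum (H_delta \<alpha> :: (real \<Rightarrow> complex) \<Rightarrow> (real \<Rightarrow> complex) \<Rightarrow> bool)"
    by (simp add: power_mult_distrib)
  moreover have "z = l ^ 4" if z: "z \<in> point_spectrum (H_delta \<alpha> :: (real \<Rightarrow> complex) \<Rightarrow> (real \<Rightarrow> complex) \<Rightarrow> bool)" for z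
  proof -
    obtain \<psi> :: "real \<Rightarrow> complex" where \<psi>0: "\<not> (AE x in lborel. \<psi> x = 0)" and \<psi>: "H_delta \<alpha> \<psi> (\<lambda>x. z * \<psi> x)"
      using z unfolding point_spectrum_def by blast
    obtain k where k: "Re k \<ge> 0" "Im k \<ge> 0" "k ^ 4 = z" by (rule fourth_root_quadrant)
    have "continuous_rep \<psi> 0 \<noteq> 0"
    proof
      assume "continuous_rep \<psi> 0 = 0"
      then have "continuous_rep \<psi> y = 0" for y using eigenvalue_condition(2)[OF \<psi> k] by blast
      moreover have "AE x in lborel. continuous_rep \<psi> x = \<psi> x"
        by (rule line.continuous_rep_AE) (use \<psi> in \<open>simp add: H_delta_def\<close>)
      ultimately show False using \<psi>0 by simp
    qed
    then have root: "4 * k' ^ 3 = \<alpha> * (1 - \<i>)" if "Re k' \<ge> 0" "Im k' \<ge> 0" "k' ^ 4 = z" for k'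
      using eigenvalue_condition(1)[OF \<psi> that] by simp
    have k0: "k \<noteq> 0"
    proof
      assume "k = 0"
      then have "\<alpha> * (1 - \<i>) = 0" using root[OF k] by simp
      then show False using nz by (auto simp: complex_eq_iff)
    qed
    \<comment> \<open>On an axis, \<open>k\<close> and its rotation by a right angle would both be admissible fourth roots, but
      their cubes differ.\<close>
    have no_rot: False if "u \<in> {\<i>, - \<i>}" "Re (u * k) \<ge> 0" "Im (u * k) \<ge> 0" for u
    proof -
      have "(u * k) ^ 4 = z" using that(1) k(3) by (auto simp: power_mult_distrib)
      then have "4 * (u * k) ^ 3 = 4 * k ^ 3" using root[OF that(2,3)] root[OF k] by simp
      then have "u ^ 3 = 1" using k0 by (simp add: power_mult_distrib)
      then show False using that(1) by (auto simp: power3_eq_cube complex_eq_iff)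
    qed
    have "Re k > 0" using no_rot[of "- \<i>"] k by (cases "Re k = 0") auto
    moreover have "Im k > 0" using no_rot[of "\<i>"] k by (cases "Im k = 0") auto
    moreover have "4 * k ^ 3 = 4 * l ^ 3" unfolding root[OF k] l(3) ..
    then have "k ^ 3 = l ^ 3" by simp
    ultimately have "k = l" using l(1,2) by (rule_tac cube_eq_in_quadrant)
    then show ?thesis using k(3) by simp
  qed
  ultimately show ?thesis unfolding l4[symmetric] by blast
qed

theorem mainTheorem6:
  shows "(\<forall>\<alpha>::complex. Re \<alpha> < \<bar>Im \<alpha>\<bar> \<longrightarrow>
            point_spectrum (H_delta \<alpha> :: (real \<Rightarrow> complex) \<Rightarrow> (real \<Rightarrow> complex) \<Rightarrow> bool)
              = {1 / 4 * pow_four_thirds \<alpha> * exp (- \<i> * of_real pi / 3)})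
       \<and> (\<forall>\<alpha>::complex. Re \<alpha> < - \<bar>Im \<alpha>\<bar> \<longrightarrow>
            point_spectrum (H_delta (4 * of_real pi * \<alpha>) ::
                (real ^ 3 \<Rightarrow> complex) \<Rightarrow> (real ^ 3 \<Rightarrow> complex) \<Rightarrow> bool)
              \<supseteq> {- (1 / 4) * \<alpha> ^ 4})"
  using point_spectrum_dim1 eigenvalue_dim3 by blast

end
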